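(* Let $G$ be an abelian totally ordered (torsion-free) group with positive cone $G^+$, and let $S$ be a subsemigroup of $G^+$ which contains $0$ and does not contain nontrivial groups. Then the following properties of the semigroup $S$ are equivalent: (1) $S=G^+$; (2) all representations in $\Delta_S$ are canonically isomorphic, i.e. for any $V,W\in\Delta_S$ there is a $*$-isomorphism from the $C^*$-algebra generated by $\{V_a: a\in S\}$ onto the $C^*$-algebra generated by $\{W_a: a\in S\}$ sending $V_a$ to $W_a$ for every $a\in S$; (3) all representations in $\Delta_S$ are inverse; (4) for any representation $V$ in $\Delta_S$ and for any $a,b\in S$, $$V_aV_a^*V_bV_b^*=V_bV_b^*V_aV_a^*.$$
   Context: Groups are written additively. A positive cone $G^+$ of an abelian group $G$ is a subsemigroup with $G=G^+\cup(-G^+)$ and $G^+\cap(-G^+)=\{0\}$; the associated total order on $G$ is given by: $a$ precedes $b$ iff $a+c=b$ for some $c\in G^+$. An isometric representation of $S$ is a semigroup homomorphism $a\mapsto V_a=V(a)$ from $S$ into the isometries on a Hilbert space. It is faithful if $a\mapsto V_a$ is injective, non-unitary if it is not a representation by unitary operators, and irreducible if the family $\{V_a,V_a^*: a\in S\}$ has no nontrivial closed invariant subspace. $\Delta_S$ denotes the set of unitary equivalence classes of faithful irreducible non-unitary isometric representations of $S$. For $V\in\Delta_S$, $S_V$ denotes the (multiplicative) semigroup generated by the operators $V_a$ and $V_b^*$, $a,b\in S$. An inverse semigroup is a semigroup $P$ in which each element $x$ has a unique inverse element $x^*$, satisfying $xx^*x=x$ and $x^*xx^*=x^*$. A representation $V\in\Delta_S$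 is called inverse if $S_V$ is an inverse semigroup.
   Formalization: Two corrections: S is assumed to generate G, G=S-S (else G=Z, S=2N is a counterexample), and "non-unitary" means that no V_a with a≠0 is unitary (else (1)⇒(2) fails for lexicographic Z^2). *)

theory Defs
  imports "HOL-Analysis.Analysis"
begin

section \<open>Complex Hilbert spaces\<close>

text \<open>The inner product is linear in its first argument. The last axiom yields positive
  definiteness; completeness is part of \<^class>\<open>banach\<close>.\<close>

class chilbert_space = banach +
  fixes scaleC :: "complex \<Rightarrow> 'a \<Rightarrow> 'a" (infixr "*\<^sub>C" 75)
    and cinner :: "'a \<Rightarrow> 'a \<Rightarrow> complex"
  assumes scaleC_add_right: "c *\<^sub>C (x + y) = c *\<^sub>C x + c *\<^sub>C y"
    and scaleC_add_left: "(c + d) *\<^sub>C x = c *\<^sub>C x + d *\<^sub>C x"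
    and scaleC_scaleC: "c *\<^sub>C (d *\<^sub>C x) = (c * d) *\<^sub>C x"
    and scaleC_of_real: "complex_of_real r *\<^sub>C x = r *\<^sub>R x"
    and cinner_commute: "cinner x y = cnj (cinner y x)"
    and cinner_add_left: "cinner (x + y) z = cinner x z + cinner y z"
    and cinner_scaleC_left: "cinner (c *\<^sub>C x) y = c * cinner x y"
    and cinner_self: "cinner x x = complex_of_real ((norm x)\<^sup>2)"

definition closed_csubspace :: "'h::chilbert_space set \<Rightarrow> bool" where
  "closed_csubspace M \<longleftrightarrow> closed M \<and> 0 \<in> M \<and> (\<forall>x\<in>M. \<forall>y\<in>M. x + y \<in> M) \<and>
     (\<forall>c. \<forall>x\<in>M. c *\<^sub>C x \<in> M)"

section \<open>Operators on a closed subspace\<close>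

text \<open>HOL cannot quantify over types inside a formula, so the Hilbert spaces carrying the
  representations are the closed subspaces \<open>K\<close> of an ambient Hilbert space type \<open>'h\<close>.
  A bounded operator on \<open>K\<close> is identified with its extension by \<open>0\<close> to the orthogonal
  complement of \<open>K\<close>. This embeds the bounded operators on \<open>K\<close> into those on \<open>'h\<close> (as the
  corner cut out by the projection onto \<open>K\<close>), preserving sums, products, adjoints and the
  operator norm; the identity of \<open>K\<close> becomes the projection onto \<open>K\<close>.
  Elements of \<open>'h \<Rightarrow>\<^sub>L 'h\<close> are only real linear, hence the explicit complex
  homogeneity.\<close>

definition ops :: "'h::chilbert_space set \<Rightarrow> ('h \<Rightarrow>\<^sub>L 'h) set" where
  "ops K = {A. (\<forall>c x. blinfun_apply A (c *\<^sub>C x) = c *\<^sub>C blinfun_apply A x) \<and>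
               (\<forall>x. blinfun_apply A x \<in> K) \<and>
               (\<forall>x. (\<forall>y\<in>K. cinner x y = 0) \<longrightarrow> blinfun_apply A x = 0)}"

definition cscale_op ::
    "complex \<Rightarrow> ('h::chilbert_space \<Rightarrow>\<^sub>L 'h) \<Rightarrow> ('h \<Rightarrow>\<^sub>L 'h)" where
  "cscale_op c A = Blinfun (\<lambda>x. c *\<^sub>C blinfun_apply A x)"

definition adj :: "('h::chilbert_space \<Rightarrow>\<^sub>L 'h) \<Rightarrow> ('h \<Rightarrow>\<^sub>L 'h)" where
  "adj A = (THE B. \<forall>x y. cinner (blinfun_apply A x) y = cinner x (blinfun_apply B y))"

definition isometry_on :: "'h::chilbert_space set \<Rightarrow> ('h \<Rightarrow>\<^sub>L 'h) \<Rightarrow> bool" where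
  "isometry_on K A \<longleftrightarrow> A \<in> ops K \<and> (\<forall>x\<in>K. norm (blinfun_apply A x) = norm x)"

definition unitary_on :: "'h::chilbert_space set \<Rightarrow> ('h \<Rightarrow>\<^sub>L 'h) \<Rightarrow> bool" where
  "unitary_on K A \<longleftrightarrow> A \<in> ops K \<and>
     (\<forall>x\<in>K. blinfun_apply (adj A) (blinfun_apply A x) = x \<and>
            blinfun_apply A (blinfun_apply (adj A) x) = x)"

definition star_subalgebra ::
    "'h::chilbert_space set \<Rightarrow> ('h \<Rightarrow>\<^sub>L 'h) set \<Rightarrow> bool" where
  "star_subalgebra K \<A> \<longleftrightarrow> \<A> \<subseteq> ops K \<and> 0 \<in> \<A> \<and>
     (\<forall>A\<in>\<A>. \<forall>B\<in>\<A>. A + B \<in> \<A> \<and> A o\<^sub>L B \<in> \<A>) \<and>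
     (\<forall>A\<in>\<A>. adj A \<in> \<A> \<and> (\<forall>c. cscale_op c A \<in> \<A>))"

text \<open>The C*-algebra generated by \<open>X\<close>; \<open>closed\<close> refers to the operator norm.\<close>

definition cstar_gen ::
    "'h::chilbert_space set \<Rightarrow> ('h \<Rightarrow>\<^sub>L 'h) set \<Rightarrow> ('h \<Rightarrow>\<^sub>L 'h) set" where
  "cstar_gen K X = \<Inter>{\<A>. star_subalgebra K \<A> \<and> closed \<A> \<and> X \<subseteq> \<A>}"

definition star_isomorphism ::
    "('h::chilbert_space \<Rightarrow>\<^sub>L 'h) set \<Rightarrow> ('h \<Rightarrow>\<^sub>L 'h) set \<Rightarrow>
     (('h \<Rightarrow>\<^sub>L 'h) \<Rightarrow> ('h \<Rightarrow>\<^sub>L 'h)) \<Rightarrow> bool" where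
  "star_isomorphism \<A> \<B> \<phi> \<longleftrightarrow> bij_betw \<phi> \<A> \<B> \<and>
     (\<forall>A\<in>\<A>. \<forall>B\<in>\<A>. \<phi> (A + B) = \<phi> A + \<phi> B \<and> \<phi> (A o\<^sub>L B) = \<phi> A o\<^sub>L \<phi> B) \<and>
     (\<forall>A\<in>\<A>. \<phi> (adj A) = adj (\<phi> A) \<and> (\<forall>c. \<phi> (cscale_op c A) = cscale_op c (\<phi> A)))"

section \<open>Positive cones and subsemigroups\<close>

definition subsemigroup :: "'g::ab_group_add set \<Rightarrow> bool" where
  "subsemigroup S \<longleftrightarrow> (\<forall>a\<in>S. \<forall>b\<in>S. a + b \<in> S)"

definition positive_cone :: "'g::ab_group_add set \<Rightarrow> bool" where
  "positive_cone P \<longleftrightarrow> subsemigroup P \<and> P \<union> uminus ` P = UNIV \<and> P \<inter> uminus ` P = {0}"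

definition no_nontrivial_subgroup :: "'g::ab_group_add set \<Rightarrow> bool" where
  "no_nontrivial_subgroup S \<longleftrightarrow>
     (\<forall>H. H \<subseteq> S \<and> 0 \<in> H \<and> subsemigroup H \<and> (\<forall>a\<in>H. - a \<in> H) \<longrightarrow> H = {0})"

section \<open>Isometric representations\<close>

definition isometric_rep ::
    "'g::ab_group_add set \<Rightarrow> 'h::chilbert_space set \<Rightarrow> ('g \<Rightarrow> 'h \<Rightarrow>\<^sub>L 'h) \<Rightarrow> bool" where
  "isometric_rep S K V \<longleftrightarrow> closed_csubspace K \<and> (\<forall>a\<in>S. isometry_on K (V a)) \<and>
     (\<forall>a\<in>S. \<forall>b\<in>S. V (a + b) = V a o\<^sub>L V b)"

definition faithful_rep ::
    "'g::ab_group_add set \<Rightarrow> ('g \<Rightarrow> 'h::chilbert_space \<Rightarrow>\<^sub>L 'h) \<Rightarrow> bool" where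
  "faithful_rep S V \<longleftrightarrow> inj_on V S"

text \<open>Non-unitarity is meant elementwise, as in Murphy's theorem: besides \<open>V\<close> not being a
  unitary representation, no \<open>V a\<close> with \<open>a \<noteq> 0\<close> is unitary (\<open>V 0\<close> is always the identity).
  Excluding only the case that all \<open>V a\<close> are unitary is not enough: for the lexicographic
  cone of \<open>\<int> \<times> \<int>\<close>, the unilateral shift \<open>T\<close> and \<open>\<theta> / (2 \<pi>)\<close> irrational,
  \<open>(m, n) \<mapsto> exp (\<i> n \<theta>) T ^ m\<close> is faithful and irreducible, but the C*-algebra it
  generates is not canonically isomorphic to that of the regular representation.\<close>

definition nonunitary_rep ::
    "'g::ab_group_add set \<Rightarrow> 'h::chilbert_space set \<Rightarrow> ('g \<Rightarrow> 'h \<Rightarrow>\<^sub>L 'h) \<Rightarrow> bool" where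
  "nonunitary_rep S K V \<longleftrightarrow>
     \<not> (\<forall>a\<in>S. unitary_on K (V a)) \<and> (\<forall>a\<in>S. a \<noteq> 0 \<longrightarrow> \<not> unitary_on K (V a))"

definition irreducible_rep ::
    "'g::ab_group_add set \<Rightarrow> 'h::chilbert_space set \<Rightarrow> ('g \<Rightarrow> 'h \<Rightarrow>\<^sub>L 'h) \<Rightarrow> bool" where
  "irreducible_rep S K V \<longleftrightarrow>
     (\<forall>M. closed_csubspace M \<and> M \<subseteq> K \<and>
          (\<forall>a\<in>S. \<forall>x\<in>M. blinfun_apply (V a) x \<in> M \<and> blinfun_apply (adj (V a)) x \<in> M)
          \<longrightarrow> M = {0} \<or> M = K)"

text \<open>Representatives \<open>(K, V)\<close> of the unitary equivalence classes in \<open>\<Delta>\<^sub>S\<close>; all properties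
  considered below are invariant under unitary equivalence.\<close>

definition Delta ::
    "'g::ab_group_add set \<Rightarrow> ('h::chilbert_space set \<times> ('g \<Rightarrow> 'h \<Rightarrow>\<^sub>L 'h)) set" where
  "Delta S = {(K, V). isometric_rep S K V \<and> faithful_rep S V \<and> irreducible_rep S K V \<and>
                      nonunitary_rep S K V}"

definition canonically_isomorphic ::
    "'g::ab_group_add set \<Rightarrow> 'h::chilbert_space set \<times> ('g \<Rightarrow> 'h \<Rightarrow>\<^sub>L 'h) \<Rightarrow>
     'h set \<times> ('g \<Rightarrow> 'h \<Rightarrow>\<^sub>L 'h) \<Rightarrow> bool" where
  "canonically_isomorphic S = (\<lambda>(K, V) (L, W).
     \<exists>\<phi>. star_isomorphism (cstar_gen K (V ` S)) (cstar_gen L (W ` S)) \<phi> \<and>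
         (\<forall>a\<in>S. \<phi> (V a) = W a))"

inductive_set rep_semigroup ::
    "'g::ab_group_add set \<Rightarrow> ('g \<Rightarrow> 'h::chilbert_space \<Rightarrow>\<^sub>L 'h) \<Rightarrow> ('h \<Rightarrow>\<^sub>L 'h) set"
  for S :: "'g set" and V :: "'g \<Rightarrow> 'h \<Rightarrow>\<^sub>L 'h" where
  gen: "a \<in> S \<Longrightarrow> V a \<in> rep_semigroup S V"
| gen_adj: "a \<in> S \<Longrightarrow> adj (V a) \<in> rep_semigroup S V"
| mult: "A \<in> rep_semigroup S V \<Longrightarrow> B \<in> rep_semigroup S V \<Longrightarrow> A o\<^sub>L B \<in> rep_semigroup S V"

definition inverse_semigroup :: "'a set \<Rightarrow> ('a \<Rightarrow> 'a \<Rightarrow> 'a) \<Rightarrow> bool" where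
  "inverse_semigroup P m \<longleftrightarrow>
     (\<forall>x\<in>P. \<forall>y\<in>P. m x y \<in> P) \<and>
     (\<forall>x\<in>P. \<forall>y\<in>P. \<forall>z\<in>P. m (m x y) z = m x (m y z)) \<and>
     (\<forall>x\<in>P. \<exists>!y. y \<in> P \<and> m (m x y) x = x \<and> m (m y x) y = y)"

definition inverse_rep ::
    "'g::ab_group_add set \<Rightarrow> ('g \<Rightarrow> 'h::chilbert_space \<Rightarrow>\<^sub>L 'h) \<Rightarrow> bool" where
  "inverse_rep S V \<longleftrightarrow> inverse_semigroup (rep_semigroup S V) (o\<^sub>L)"

text \<open>The ambient space \<open>'h\<close> must be large enough. An irreducible representation of \<open>S\<close> is
  cyclic, so (as a nontrivial totally ordered group \<open>G\<close> is infinite) it lives on a space of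
  dimension at most \<open>card G\<close>; if \<open>'h\<close> contains an orthonormal family indexed by \<open>G\<close>,
  e.g. if \<open>'h\<close> is \<open>\<ell>\<^sup>2(G)\<close>, every class in \<open>\<Delta>\<^sub>S\<close> is realised on a closed subspace.\<close>

definition orthonormal_family :: "('i \<Rightarrow> 'h::chilbert_space) \<Rightarrow> bool" where
  "orthonormal_family e \<longleftrightarrow> (\<forall>i j. cinner (e i) (e j) = (if i = j then 1 else 0))"

end

theory Submission
  imports Defs
begin

text \<open>If \<open>S = G\<^sup>+\<close>, then \<open>V_b\<^sup>* V_a\<close> is \<open>V_(a - b)\<close> or \<open>V_(b - a)\<^sup>*\<close>, so the operators
  \<open>V_a V_b\<^sup>*\<close> form a semigroup, and the range projections \<open>V_a V_a\<^sup>*\<close> form a chain; the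
  semigroup is therefore inverse. That the C*-algebra does not depend on the representation
  (Murphy's theorem) follows from equality of the norms of a polynomial \<open>\<Sum> c_i V_(a_i) V_(b_i)\<^sup>*\<close>
  in two representations \<open>V\<close> and \<open>W\<close>: a non-unitary \<open>W\<close> contains every finite piece of the regular
  representation on \<open>\<ell>\<^sup>2(G\<^sup>+)\<close> exactly, while by amenability of \<open>G\<close> (Folner sets) and a
  decomposition along the chain of range projections, \<open>V\<close> is weakly contained in the regular
  representation.

  If \<open>g\<close> lies in \<open>G\<^sup>+\<close> but not in \<open>S\<close>, restrict the shifts of \<open>\<ell>\<^sup>2(G)\<close> to the closed span
  of \<open>e_0 + e_g\<close> and of all \<open>e_x\<close> with \<open>x \<in> S - {0}\<close> or \<open>x > g\<close>. This representation is in
  \<open>\<Delta>_S\<close>, but the range projections of \<open>V_a\<close> and \<open>V_(a + g)\<close> do not commute. In an inverse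
  semigroup idempotents commute, and in the regular representation of \<open>S\<close> the range projections
  commute, so (2), (3) and (4) all fail.\<close>

section \<open>Complex Hilbert spaces\<close>

text \<open>Two obstacles shape the proof. For a dense order a representation in
  \<open>Delta\<close> may have no vector killed by all \<open>V_d^*\<close> with d > 0 (think of
  translations on L2 of the half-line), so the regular representation cannot simply be embedded;
  only finite pieces of it are available. Hence norms of finite polynomials are compared directly,
  one inequality for each ordered pair of representations, and the Folner ratio
  \<open>1 + \<epsilon>\<close> absorbs the loss at the boundary of the finite pieces. In the other
  direction, shifts restricted to a span of basis vectors have diagonal, hence commuting, range
  projections. A counterexample needs a vector that mixes two basis vectors. Gluing 0 to a gap
  \<open>g\<close> works because \<open>g \<notin> S\<close> keeps nonzero elements of
  \<open>S\<close> from shifting any point of the support onto 0 or \<open>g\<close>, so images of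
  the glued vector need no gluing themselves; the points above \<open>g\<close> are there to receive
  them. Irreducibility is tested with compressions by all group elements, which
  \<open>G = S - S\<close> makes available.\<close>

lemma cinner_add_right: "cinner x (y + z) = cinner x y + cinner x (z::'h::chilbert_space)"
  unfolding cinner_commute[of x] by (simp add: cinner_add_left)

lemma cinner_scaleC_right: "cinner x (c *\<^sub>C y) = cnj c * cinner x (y::'h::chilbert_space)"
  unfolding cinner_commute[of x] by (simp add: cinner_scaleC_left)

lemma cinner_scaleR_left: "cinner (r *\<^sub>R x) y = r *\<^sub>R cinner x (y::'h::chilbert_space)"
  by (metis scaleC_of_real cinner_scaleC_left scaleR_conv_of_real)

lemma cinner_scaleR_right: "cinner x (r *\<^sub>R y) = r *\<^sub>R cinner x (y::'h::chilbert_space)"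
  by (metis scaleC_of_real cinner_scaleC_right scaleR_conv_of_real complex_cnj_complex_of_real)

lemma scaleC_0_right [simp]: "c *\<^sub>C (0::'h::chilbert_space) = 0"
  using scaleC_add_right[of c "0::'h" 0] by simp

lemma scaleC_0_left [simp]: "0 *\<^sub>C (x::'h::chilbert_space) = 0"
  using scaleC_add_left[of 0 0 x] by simp

lemma scaleC_1 [simp]: "1 *\<^sub>C (x::'h::chilbert_space) = x"
  using scaleC_of_real[of 1 x] by simp

lemma scaleC_minus1: "(-1) *\<^sub>C (x::'h::chilbert_space) = - x"
  using scaleC_of_real[of "-1" x] by simp

lemma scaleC_minus_right: "c *\<^sub>C (- x::'h::chilbert_space) = - (c *\<^sub>C x)"
  using scaleC_add_right[of c x "-x"] by (simp add: eq_neg_iff_add_eq_0 add.commute)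

lemma scaleC_minus_left: "(- c) *\<^sub>C (x::'h::chilbert_space) = - (c *\<^sub>C x)"
  using scaleC_add_left[of "-c" c x] by (simp add: eq_neg_iff_add_eq_0)

lemma scaleC_diff_right: "c *\<^sub>C (x - y::'h::chilbert_space) = c *\<^sub>C x - c *\<^sub>C y"
  using scaleC_add_right[of c x "-y"] by (simp add: scaleC_minus_right)

lemma scaleC_sum_right: "c *\<^sub>C (\<Sum>i\<in>I. f i) = (\<Sum>i\<in>I. c *\<^sub>C (f i::'h::chilbert_space))"
  by (induction I rule: infinite_finite_induct) (auto simp: scaleC_add_right)

lemma scaleC_sum_left: "(\<Sum>i\<in>I. f i) *\<^sub>C x = (\<Sum>i\<in>I. f i *\<^sub>C (x::'h::chilbert_space))"
  by (induction I rule: infinite_finite_induct) (auto simp: scaleC_add_left)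

lemma norm_scaleC: "norm (c *\<^sub>C (x::'h::chilbert_space)) = cmod c * norm x"
proof -
  have "complex_of_real ((norm (c *\<^sub>C x))\<^sup>2) = c * cnj c * complex_of_real ((norm x)\<^sup>2)"
    unfolding cinner_self[symmetric] by (simp only: cinner_scaleC_left cinner_scaleC_right mult_ac)
  also have "\<dots> = complex_of_real ((cmod c * norm x)\<^sup>2)"
    unfolding complex_norm_square[symmetric] by (simp add: power_mult_distrib)
  finally have "(norm (c *\<^sub>C x))\<^sup>2 = (cmod c * norm x)\<^sup>2"
    using of_real_eq_iff by blast
  then show ?thesis by (simp add: power2_eq_iff_nonneg)
qed

lemma norm_add_square:
  "(norm (x + y::'h::chilbert_space))\<^sup>2 = (norm x)\<^sup>2 + (norm y)\<^sup>2 + 2 * Re (cinner x y)"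
proof -
  have "complex_of_real ((norm (x + y))\<^sup>2) = cinner x x + cinner y y + (cinner x y + cinner y x)"
    unfolding cinner_self[symmetric] by (simp add: cinner_add_left cinner_add_right)
  then have "(norm (x + y))\<^sup>2 = Re (cinner x x + cinner y y + (cinner x y + cinner y x))"
    by (metis Re_complex_of_real)
  moreover have "Re (cinner y x) = Re (cinner x y)"
    by (subst cinner_commute) simp
  ultimately show ?thesis by (simp add: cinner_self)
qed

lemma cinner_Cauchy_Schwarz: "cmod (cinner x y) \<le> norm x * norm (y::'h::chilbert_space)"
proof (cases "y = 0")
  case True
  then show ?thesis using cinner_scaleC_right[of x 0 0] by simp
next
  case False
  \<comment> \<open>With this \<open>c\<close> the vector \<open>x + c *\<^sub>C y\<close> is
    orthogonal to \<open>y\<close>, so its norm is the least possible.\<close>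
  define c where "c = - cinner x y / complex_of_real ((norm y)\<^sup>2)"
  have "0 \<le> (norm (x + c *\<^sub>C y))\<^sup>2" by simp
  also have "\<dots> = (norm x)\<^sup>2 + (cmod c)\<^sup>2 * (norm y)\<^sup>2 + 2 * Re (cnj c * cinner x y)"
    by (simp add: norm_add_square norm_scaleC cinner_scaleC_right power_mult_distrib)
  also have "cnj c * cinner x y = - complex_of_real ((cmod (cinner x y))\<^sup>2 / (norm y)\<^sup>2)"
    by (simp add: c_def complex_norm_square[unfolded of_real_power] mult.commute)
  also have "(cmod c)\<^sup>2 * (norm y)\<^sup>2 = (cmod (cinner x y))\<^sup>2 / (norm y)\<^sup>2"
    using False by (simp add: c_def norm_divide norm_mult power2_eq_square)
  finally have "(cmod (cinner x y))\<^sup>2 / (norm y)\<^sup>2 \<le> (norm x)\<^sup>2" by simp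
  then have "(cmod (cinner x y))\<^sup>2 \<le> (norm x * norm y)\<^sup>2"
    using False by (simp add: divide_simps power_mult_distrib)
  then show ?thesis by (simp add: power2_le_iff_abs_le)
qed

lemma bounded_bilinear_cinner: "bounded_bilinear (cinner :: 'h::chilbert_space \<Rightarrow> 'h \<Rightarrow> complex)"
  by standard (auto simp: cinner_add_left cinner_add_right cinner_scaleR_left cinner_scaleR_right
      intro!: exI[of _ 1] cinner_Cauchy_Schwarz)

lemma bounded_linear_scaleC: "bounded_linear (\<lambda>x::'h::chilbert_space. c *\<^sub>C x)"
proof (rule bounded_linear_intro[where K = "cmod c"])
  fix r and x :: 'h
  show "c *\<^sub>C r *\<^sub>R x = r *\<^sub>R c *\<^sub>C x"
    by (simp add: scaleC_of_real[symmetric] scaleC_scaleC mult.commute)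
qed (auto simp: scaleC_add_right norm_scaleC)

lemmas cinner_zero_left [simp] = bounded_bilinear.zero_left[OF bounded_bilinear_cinner]
  and cinner_zero_right [simp] = bounded_bilinear.zero_right[OF bounded_bilinear_cinner]
  and cinner_minus_right = bounded_bilinear.minus_right[OF bounded_bilinear_cinner]
  and cinner_diff_left = bounded_bilinear.diff_left[OF bounded_bilinear_cinner]
  and cinner_diff_right = bounded_bilinear.diff_right[OF bounded_bilinear_cinner]
  and cinner_sum_left = bounded_bilinear.sum_left[OF bounded_bilinear_cinner]
  and cinner_sum_right = bounded_bilinear.sum_right[OF bounded_bilinear_cinner]
  and tendsto_scaleC [tendsto_intros] = bounded_linear.tendsto[OF bounded_linear_scaleC]
  and continuous_on_cinner [continuous_intros] =
    bounded_bilinear.continuous_on[OF bounded_bilinear_cinner]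

lemma cinner_self_eq_0 [simp]: "cinner x x = 0 \<longleftrightarrow> x = (0::'h::chilbert_space)"
  by (simp add: cinner_self)

lemma cinner_eq_0_sym: "cinner x y = 0 \<Longrightarrow> cinner y (x::'h::chilbert_space) = 0"
  by (subst cinner_commute) simp

lemma pythagoras:
  "cinner x y = 0 \<Longrightarrow> (norm (x + y::'h::chilbert_space))\<^sup>2 = (norm x)\<^sup>2 + (norm y)\<^sup>2"
  by (simp add: norm_add_square)

lemma pythagoras_sum:
  fixes f :: "'i \<Rightarrow> 'h::chilbert_space"
  assumes "finite I" "\<And>i j. i \<in> I \<Longrightarrow> j \<in> I \<Longrightarrow> i \<noteq> j \<Longrightarrow> cinner (f i) (f j) = 0"
  shows "(norm (\<Sum>i\<in>I. f i))\<^sup>2 = (\<Sum>i\<in>I. (norm (f i))\<^sup>2)"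
  using assms
proof (induction I)
  case (insert i I)
  have "cinner (f i) (\<Sum>j\<in>I. f j) = 0"
    unfolding cinner_sum_right using insert by (intro sum.neutral) auto
  with insert show ?case by (simp add: pythagoras)
qed simp

lemma parallelogram:
  "(norm (x + y::'h::chilbert_space))\<^sup>2 + (norm (x - y))\<^sup>2 = 2 * (norm x)\<^sup>2 + 2 * (norm y)\<^sup>2"
  using norm_add_square[of x y] norm_add_square[of x "-y"] by (simp add: cinner_minus_right)

section \<open>Closed subspaces, orthogonal projections and the Riesz representation\<close>

lemma closed_csubspace_diff: "closed_csubspace M \<Longrightarrow> x \<in> M \<Longrightarrow> y \<in> M \<Longrightarrow> x - y \<in> M"
  by (metis closed_csubspace_def scaleC_minus1 add_uminus_conv_diff)

lemma closed_csubspaceD: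
  assumes "closed_csubspace M"
  shows "closed M" "0 \<in> M" "x \<in> M \<Longrightarrow> y \<in> M \<Longrightarrow> x + y \<in> M" "x \<in> M \<Longrightarrow> c *\<^sub>C x \<in> M"
  using assms by (auto simp: closed_csubspace_def)

lemma closed_csubspace_Int: "closed_csubspace M \<Longrightarrow> closed_csubspace N \<Longrightarrow> closed_csubspace (M \<inter> N)"
  by (auto simp: closed_csubspace_def)

lemma closed_csubspace_orthogonal: "closed_csubspace {x::'h::chilbert_space. \<forall>y\<in>N. cinner x y = 0}"
proof -
  have "closed {x::'h. cinner x y = 0}" for y
    by (intro closed_Collect_eq continuous_intros)
  then have "closed (\<Inter>y\<in>N. {x::'h. cinner x y = 0})" by (intro closed_INT) auto
  moreover have "(\<Inter>y\<in>N. {x::'h. cinner x y = 0}) = {x. \<forall>y\<in>N. cinner x y = 0}" by auto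
  ultimately show ?thesis
    by (simp add: closed_csubspace_def cinner_add_left cinner_scaleC_left)
qed

text \<open>A sequence in \<open>K\<close> minimizing the distance to \<open>x\<close> is Cauchy by
  the parallelogram law, because midpoints stay in \<open>K\<close>. Its limit is a minimizer, and
  moving it by the optimal multiple of \<open>z\<close> cannot decrease the distance, which forces
  orthogonality.\<close>

lemma projection_exists:
  fixes K :: "'h::chilbert_space set"
  assumes K: "closed_csubspace K"
  shows "\<exists>y\<in>K. \<forall>z\<in>K. cinner (x - y) z = 0"
proof -
  define d where "d = (INF k\<in>K. (norm (x - k))\<^sup>2)"
  have bdd: "bdd_below ((\<lambda>k. (norm (x - k))\<^sup>2) ` K)"
    by (rule bdd_belowI[of _ 0]) auto
  have ne: "K \<noteq> {}" using closed_csubspaceD(2)[OF K] by auto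
  have d_le: "d \<le> (norm (x - k))\<^sup>2" if "k \<in> K" for k
    unfolding d_def by (rule cINF_lower[OF bdd that])
  have "\<exists>k\<in>K. (norm (x - k))\<^sup>2 < d + 1 / real (Suc n)" for n
  proof -
    have "Inf ((\<lambda>k. (norm (x - k))\<^sup>2) ` K) < d + 1 / real (Suc n)"
      by (simp add: d_def)
    then show ?thesis using cInf_lessD[of "(\<lambda>k. (norm (x - k))\<^sup>2) ` K"] ne by blast
  qed
  then obtain k where k: "\<And>n. k n \<in> K" "\<And>n. (norm (x - k n))\<^sup>2 < d + 1 / real (Suc n)"
    by metis
  have near: "(norm (k m - k n))\<^sup>2 \<le> 2 / real (Suc m) + 2 / real (Suc n)" for m n
  proof -
    have half: "(1/2) *\<^sub>C (k m + k n) \<in> K"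
      using k(1) K by (blast intro: closed_csubspaceD)
    have "(x - k m) + (x - k n) = 2 *\<^sub>C (x - (1/2) *\<^sub>C (k m + k n))"
      by (simp add: scaleC_diff_right scaleC_scaleC)
         (simp add: scaleC_add_left[of 1 1 x, simplified])
    then have "(norm ((x - k m) + (x - k n)))\<^sup>2 = 4 * (norm (x - (1/2) *\<^sub>C (k m + k n)))\<^sup>2"
      by (simp add: norm_scaleC power_mult_distrib)
    then have "(norm ((x - k m) + (x - k n)))\<^sup>2 \<ge> 4 * d"
      using d_le[OF half] by simp
    moreover have "(norm ((x - k m) - (x - k n)))\<^sup>2 = (norm (k m - k n))\<^sup>2"
      by (simp add: norm_minus_commute)
    ultimately show ?thesis
      using parallelogram[of "x - k m" "x - k n"] k(2)[of m] k(2)[of n] by linarith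
  qed
  have "Cauchy k"
  proof (rule metric_CauchyI)
    fix r :: real assume "0 < r"
    then obtain N where N: "4 / r\<^sup>2 < real N" using reals_Archimedean2 by blast
    show "\<exists>M. \<forall>m\<ge>M. \<forall>n\<ge>M. dist (k m) (k n) < r"
    proof (intro exI allI impI)
      fix m n assume "N \<le> m" "N \<le> n"
      then have "2 / real (Suc m) + 2 / real (Suc n) \<le> 2 / real (Suc N) + 2 / real (Suc N)"
        by (intro add_mono divide_left_mono) auto
      also have "\<dots> = 4 / real (Suc N)" by simp
      also have "\<dots> < r\<^sup>2"
      proof -
        have "4 / r\<^sup>2 < real (Suc N)" using N by simp
        then show ?thesis using \<open>0 < r\<close> by (simp add: divide_less_eq mult.commute)
      qed
      finally have "(norm (k m - k n))\<^sup>2 < r\<^sup>2" using near[of m n] by linarith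
      then show "dist (k m) (k n) < r"
        using \<open>0 < r\<close> by (simp add: dist_norm power_less_imp_less_base)
    qed
  qed
  then obtain y where y: "k \<longlonglongrightarrow> y" using Cauchy_convergent_iff convergent_def by blast
  have yK: "y \<in> K" using closed_csubspaceD(1)[OF K] k(1) y closed_sequentially by blast
  have "(\<lambda>n. (norm (x - k n))\<^sup>2) \<longlonglongrightarrow> (norm (x - y))\<^sup>2" by (intro tendsto_intros y)
  moreover have "(\<lambda>n. d + 1 / real (Suc n)) \<longlonglongrightarrow> d + 0"
    by (intro tendsto_intros LIMSEQ_Suc lim_1_over_n)
  ultimately have min: "(norm (x - y))\<^sup>2 \<le> d"
    using k(2) by (intro LIMSEQ_le) (auto intro: less_imp_le)
  have "cinner (x - y) z = 0" if "z \<in> K" for z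
  proof (cases "z = 0")
    case False
    define c where "c = cinner (x - y) z / complex_of_real ((norm z)\<^sup>2)"
    have "y + c *\<^sub>C z \<in> K" using yK that K by (blast intro: closed_csubspaceD)
    then have "(norm (x - y))\<^sup>2 \<le> (norm ((x - y) + (- c) *\<^sub>C z))\<^sup>2"
      using order_trans[OF min d_le] by (fastforce simp: scaleC_minus_left diff_diff_eq)
    also have "\<dots> = (norm (x - y))\<^sup>2 + (cmod c)\<^sup>2 * (norm z)\<^sup>2 - 2 * Re (cnj c * cinner (x - y) z)"
      by (simp add: norm_add_square norm_scaleC cinner_scaleC_right power_mult_distrib)
    also have "cnj c * cinner (x - y) z = complex_of_real ((cmod (cinner (x - y) z))\<^sup>2 / (norm z)\<^sup>2)"
      by (simp add: c_def complex_norm_square[unfolded of_real_power] mult.commute)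
    also have "(cmod c)\<^sup>2 * (norm z)\<^sup>2 = (cmod (cinner (x - y) z))\<^sup>2 / (norm z)\<^sup>2"
      using False by (simp add: c_def norm_divide norm_mult power2_eq_square)
    finally show ?thesis using False by (simp add: divide_le_0_iff)
  qed simp
  with yK show ?thesis by blast
qed

text \<open>The choice is meaningful only for closed subspaces, where \<open>cproj_eqI\<close> shows
  that there is a single candidate.\<close>

definition cproj :: "'h::chilbert_space set \<Rightarrow> 'h \<Rightarrow> 'h" where
  "cproj K x = (SOME y. y \<in> K \<and> (\<forall>z\<in>K. cinner (x - y) z = 0))"

context
  fixes K :: "'h::chilbert_space set"
  assumes K: "closed_csubspace K"
begin

lemma cproj_mem: "cproj K x \<in> K"
  and cproj_orthogonal: "z \<in> K \<Longrightarrow> cinner (x - cproj K x) z = 0"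
proof -
  have "\<exists>y. y \<in> K \<and> (\<forall>z\<in>K. cinner (x - y) z = 0)" using projection_exists[OF K] by blast
  from someI_ex[OF this] show "cproj K x \<in> K" "z \<in> K \<Longrightarrow> cinner (x - cproj K x) z = 0"
    by (auto simp: cproj_def)
qed

lemma cproj_eqI:
  assumes "y \<in> K" "\<And>z. z \<in> K \<Longrightarrow> cinner (x - y) z = 0"
  shows "cproj K x = y"
proof -
  let ?z = "cproj K x - y"
  have z: "?z \<in> K" using assms(1) cproj_mem closed_csubspace_diff[OF K] by blast
  have "cinner ?z ?z = cinner (x - y) ?z - cinner (x - cproj K x) ?z"
    by (simp add: cinner_diff_left)
  also have "\<dots> = 0" using z assms(2) cproj_orthogonal by simp
  finally show ?thesis by simp
qed

lemma cproj_ident: "x \<in> K \<Longrightarrow> cproj K x = x"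
  by (rule cproj_eqI) auto

lemma cproj_perp: "(\<And>y. y \<in> K \<Longrightarrow> cinner x y = 0) \<Longrightarrow> cproj K x = 0"
  by (rule cproj_eqI) (auto simp: closed_csubspaceD[OF K])

lemma cinner_cproj_left: "z \<in> K \<Longrightarrow> cinner (cproj K x) z = cinner x z"
  using cproj_orthogonal[of z x] by (simp add: cinner_diff_left)

lemma cinner_cproj_right: "z \<in> K \<Longrightarrow> cinner z (cproj K x) = cinner z x"
  using cinner_cproj_left[of z x] by (subst (1 2) cinner_commute) simp

lemma cproj_add: "cproj K (x + y) = cproj K x + cproj K y"
  by (rule cproj_eqI)
     (auto intro: closed_csubspaceD[OF K] cproj_mem
       simp: cinner_cproj_left cinner_add_left cinner_diff_left)

lemma cproj_scaleC: "cproj K (c *\<^sub>C x) = c *\<^sub>C cproj K x"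
  by (rule cproj_eqI)
     (auto intro: closed_csubspaceD[OF K] cproj_mem
       simp: cinner_cproj_left cinner_scaleC_left cinner_diff_left)

lemma norm_cproj_le: "norm (cproj K x) \<le> norm x"
proof -
  have "(norm (cproj K x + (x - cproj K x)))\<^sup>2 = (norm (cproj K x))\<^sup>2 + (norm (x - cproj K x))\<^sup>2"
    by (rule pythagoras, rule cinner_eq_0_sym, rule cproj_orthogonal, rule cproj_mem)
  then have "(norm (cproj K x))\<^sup>2 \<le> (norm x)\<^sup>2" by simp
  then show ?thesis by (simp add: power2_le_iff_abs_le)
qed

lemma bounded_linear_cproj: "bounded_linear (cproj K)"
  by (rule bounded_linear_intro[where K = 1])
     (auto simp: cproj_add norm_cproj_le scaleC_of_real[symmetric] cproj_scaleC)

lemma cproj_diff: "cproj K (x - y) = cproj K x - cproj K y"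
  using linear_diff[OF bounded_linear.linear[OF bounded_linear_cproj]] .

text \<open>A closed subspace is its own double orthogonal complement: test \<open>x\<close> against
  \<open>x - cproj K x\<close>.\<close>

lemma mem_if_orthogonal_complement:
  assumes "\<And>z. (\<And>y. y \<in> K \<Longrightarrow> cinner z y = 0) \<Longrightarrow> cinner x z = 0"
  shows "x \<in> K"
proof -
  let ?z = "x - cproj K x"
  have "cinner x ?z = 0" by (rule assms) (rule cproj_orthogonal)
  moreover have "cinner (cproj K x) ?z = 0"
    by (rule cinner_eq_0_sym, rule cproj_orthogonal, rule cproj_mem)
  ultimately have "cinner ?z ?z = 0" by (simp add: cinner_diff_left)
  then have "x = cproj K x" by simp
  then show ?thesis using cproj_mem by metis
qed

end

text \<open>Totality criterion for invariant subspaces: projecting onto \<open>M\<close> leaves a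
  remainder in \<open>K\<close> orthogonal to \<open>M\<close>.\<close>

lemma closed_csubspace_eqI:
  assumes "closed_csubspace M" "closed_csubspace K" "M \<subseteq> K"
    and "\<And>y. y \<in> K \<Longrightarrow> (\<And>z. z \<in> M \<Longrightarrow> cinner y z = 0) \<Longrightarrow> y = 0"
  shows "M = K"
proof
  show "K \<subseteq> M"
  proof
    fix x assume "x \<in> K"
    then have "x - cproj M x \<in> K"
      using assms(2,3) cproj_mem[OF assms(1)] closed_csubspace_diff by blast
    then have "x - cproj M x = 0"
      by (rule assms(4)) (rule cproj_orthogonal[OF assms(1)])
    then show "x \<in> M" using cproj_mem[OF assms(1), of x] by simp
  qed
qed (fact assms(3))

text \<open>The kernel is closed of codimension one. The component \<open>b\<close> of a vector
  outside it that is orthogonal to it spans the complement, and the representing vector is the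
  multiple of \<open>b\<close> that gives the right value at \<open>b\<close>.\<close>

lemma riesz_representation:
  fixes f :: "'h::chilbert_space \<Rightarrow> complex"
  assumes f: "bounded_linear f" and fC: "\<And>c x. f (c *\<^sub>C x) = c * f x"
  shows "\<exists>u. \<forall>x. f x = cinner x u"
proof (cases "\<forall>x. f x = 0")
  case True
  then show ?thesis by (intro exI[of _ 0]) simp
next
  case False
  then obtain a where a: "f a \<noteq> 0" by blast
  interpret bounded_linear f by fact
  have "closed {x. f x = 0}"
    by (intro closed_Collect_eq continuous_intros bounded_linear.continuous_on[OF f])
  then have N: "closed_csubspace {x. f x = 0}"
    by (auto simp: closed_csubspace_def add zero fC)
  define b where "b = a - cproj {x. f x = 0} a"
  have fb: "f b = f a" using cproj_mem[OF N, of a] by (simp add: b_def diff)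
  then have b0: "b \<noteq> 0" using a zero by auto
  have b_orth: "cinner b z = 0" if "f z = 0" for z
    unfolding b_def using cproj_orthogonal[OF N] that by blast
  show ?thesis
  proof (intro exI allI)
    fix x
    have "f (x - (f x / f b) *\<^sub>C b) = 0" using a fb by (simp add: diff fC)
    then have "cinner (x - (f x / f b) *\<^sub>C b) b = 0"
      using b_orth cinner_eq_0_sym by blast
    then have "cinner x b = f x / f b * cinner b b"
      by (simp add: cinner_diff_left cinner_scaleC_left)
    then show "f x = cinner x (cnj (f b / cinner b b) *\<^sub>C b)"
      using a fb b0 by (simp add: cinner_scaleC_right)
  qed
qed

text \<open>Polarization: norms of sums determine the real part of the inner product, and replacing
  \<open>y\<close> by \<open>\<i> *\<^sub>C y\<close> yields the imaginary part. Sums and multiples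
  stay in \<open>K\<close>, where norms are preserved.\<close>

lemma isometry_cinner:
  fixes T :: "'h::chilbert_space \<Rightarrow> 'h"
  assumes "closed_csubspace K" and add: "\<And>x y. T (x + y) = T x + T y"
    and scale: "\<And>c x. T (c *\<^sub>C x) = c *\<^sub>C T x" and norm: "\<And>x. x \<in> K \<Longrightarrow> norm (T x) = norm x"
    and "x \<in> K" "y \<in> K"
  shows "cinner (T x) (T y) = cinner x y"
proof -
  have Re: "Re (cinner (T x) (T y)) = Re (cinner x y)" if "x \<in> K" "y \<in> K" for x y
  proof -
    have "norm (T x + T y) = norm (x + y)"
      using norm[of "x + y"] that closed_csubspaceD(3)[OF assms(1)] by (simp add: add)
    then show ?thesis
      using norm_add_square[of "T x" "T y"] norm_add_square[of x y] that norm by simp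
  qed
  have "Re (cinner (T x) (T (\<i> *\<^sub>C y))) = Re (cinner x (\<i> *\<^sub>C y))"
    by (rule Re) (use assms closed_csubspaceD(4) in auto)
  then have "Im (cinner (T x) (T y)) = Im (cinner x y)"
    by (simp add: scale cinner_scaleC_right)
  with Re[OF assms(5,6)] show ?thesis by (rule complex_eqI)
qed

section \<open>Adjoints\<close>

text \<open>Separates complex homogeneity from the subspace conditions in \<open>ops\<close>;
  adjoints exist on the strength of homogeneity alone.\<close>

definition clin_op :: "('h::chilbert_space \<Rightarrow>\<^sub>L 'h) \<Rightarrow> bool" where
  "clin_op A \<longleftrightarrow> (\<forall>c x. blinfun_apply A (c *\<^sub>C x) = c *\<^sub>C blinfun_apply A x)"

lemma clin_opD: "clin_op A \<Longrightarrow> blinfun_apply A (c *\<^sub>C x) = c *\<^sub>C blinfun_apply A x"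
  by (simp add: clin_op_def)

lemma cscale_op_apply: "blinfun_apply (cscale_op c A) x = c *\<^sub>C blinfun_apply A x"
  unfolding cscale_op_def
  by (subst bounded_linear_Blinfun_apply)
     (auto intro: bounded_linear_compose[OF bounded_linear_scaleC blinfun.bounded_linear_right])

lemma cinner_eqI_right: "(\<And>x. cinner x y = cinner x z) \<Longrightarrow> y = (z::'h::chilbert_space)"
proof -
  assume "\<And>x. cinner x y = cinner x z"
  then have "cinner (y - z) (y - z) = 0" by (simp add: cinner_diff_right)
  then show ?thesis by simp
qed

lemma adj_eqI:
  assumes "\<And>x y. cinner (blinfun_apply A x) y = cinner x (blinfun_apply B y)"
  shows "adj A = (B :: 'h::chilbert_space \<Rightarrow>\<^sub>L 'h)"
  unfolding adj_def
proof (rule the_equality)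
  fix C assume "\<forall>x y. cinner (blinfun_apply A x) y = cinner x (blinfun_apply C y)"
  then show "C = B" using assms by (intro blinfun_eqI cinner_eqI_right) metis
qed (use assms in blast)

text \<open>Riesz, applied to \<open>x \<mapsto> cinner (A x) y\<close> for each \<open>y\<close>,
  builds the adjoint pointwise; its boundedness follows from Cauchy-Schwarz for
  \<open>cinner (A (B y)) y\<close>. Only now does the definite description in \<open>adj\<close>
  denote the intended operator.\<close>

lemma cinner_adj:
  fixes A :: "'h::chilbert_space \<Rightarrow>\<^sub>L 'h"
  assumes A: "clin_op A"
  shows "cinner (blinfun_apply A x) y = cinner x (blinfun_apply (adj A) y)"
proof -
  have "\<exists>u. \<forall>x. cinner (blinfun_apply A x) y = cinner x u" for y
  proof (rule riesz_representation)
    show "bounded_linear (\<lambda>x. cinner (blinfun_apply A x) y)"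
      by (rule bounded_linear_compose[OF bounded_bilinear.bounded_linear_left
            [OF bounded_bilinear_cinner] blinfun.bounded_linear_right])
  qed (simp add: clin_opD[OF A] cinner_scaleC_left)
  then obtain B where B: "\<And>x y. cinner (blinfun_apply A x) y = cinner x (B y)" by metis
  have "bounded_linear B"
  proof (rule bounded_linear_intro[where K = "norm A"])
    show "B (y + z) = B y + B z" for y z
      by (rule cinner_eqI_right) (simp add: B[symmetric] cinner_add_right)
    show "B (r *\<^sub>R y) = r *\<^sub>R B y" for r y
      by (rule cinner_eqI_right) (simp add: B[symmetric] cinner_scaleR_right)
    show "norm (B y) \<le> norm y * norm A" for y
    proof (cases "B y = 0")
      case False
      have "(norm (B y))\<^sup>2 = cmod (cinner (B y) (B y))" by (simp add: cinner_self norm_power)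
      also have "\<dots> = cmod (cinner (blinfun_apply A (B y)) y)" by (simp add: B)
      also have "\<dots> \<le> norm (blinfun_apply A (B y)) * norm y" by (rule cinner_Cauchy_Schwarz)
      also have "\<dots> \<le> (norm A * norm (B y)) * norm y"
        by (intro mult_right_mono norm_blinfun) auto
      finally have "norm (B y) * norm (B y) \<le> norm (B y) * (norm y * norm A)"
        by (simp add: power2_eq_square mult_ac)
      then show ?thesis using False by simp
    qed simp
  qed
  then have "adj A = Blinfun B"
    by (intro adj_eqI) (simp add: B bounded_linear_Blinfun_apply)
  then show ?thesis by (simp add: B bounded_linear_Blinfun_apply \<open>bounded_linear B\<close>)
qed

lemma cinner_adj': "clin_op A \<Longrightarrow> cinner (blinfun_apply (adj A) x) y = cinner x (blinfun_apply A y)"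
  using cinner_adj[of A y x] by (subst (1 2) cinner_commute) simp

lemma clin_op_adj: "clin_op A \<Longrightarrow> clin_op (adj A)"
  unfolding clin_op_def[of "adj A"]
  by (intro allI cinner_eqI_right) (simp add: cinner_adj[symmetric] cinner_scaleC_right)

lemma adj_adj: "clin_op A \<Longrightarrow> adj (adj A) = A"
  by (intro adj_eqI) (simp add: cinner_adj')

lemma norm_adj_le:
  assumes A: "clin_op (A :: 'h::chilbert_space \<Rightarrow>\<^sub>L 'h)"
  shows "norm (adj A) \<le> norm A"
proof (rule norm_blinfun_bound)
  fix y
  let ?b = "blinfun_apply (adj A) y"
  show "norm ?b \<le> norm A * norm y"
  proof (cases "?b = 0")
    case False
    have "(norm ?b)\<^sup>2 = cmod (cinner ?b ?b)" by (simp add: cinner_self norm_power)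
    also have "\<dots> = cmod (cinner (blinfun_apply A ?b) y)" by (simp add: cinner_adj[OF A])
    also have "\<dots> \<le> norm (blinfun_apply A ?b) * norm y" by (rule cinner_Cauchy_Schwarz)
    also have "\<dots> \<le> (norm A * norm ?b) * norm y"
      by (intro mult_right_mono norm_blinfun) auto
    finally have "norm ?b * norm ?b \<le> norm ?b * (norm A * norm y)"
      by (simp add: power2_eq_square mult_ac)
    then show ?thesis using False by simp
  qed (simp)
qed simp

lemma clin_op_diff: "clin_op A \<Longrightarrow> clin_op B \<Longrightarrow> clin_op (A - B)"
  and clin_op_cscale: "clin_op A \<Longrightarrow> clin_op (cscale_op c A)"
  by (simp_all add: clin_op_def blinfun.diff_left
      scaleC_diff_right cscale_op_apply scaleC_scaleC mult.commute)

lemma adj_add: "clin_op A \<Longrightarrow> clin_op B \<Longrightarrow> adj (A + B) = adj A + adj B"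
  and adj_diff: "clin_op A \<Longrightarrow> clin_op B \<Longrightarrow> adj (A - B) = adj A - adj B"
  and adj_compose: "clin_op A \<Longrightarrow> clin_op B \<Longrightarrow> adj (A o\<^sub>L B) = adj B o\<^sub>L adj A"
  and adj_cscale: "clin_op A \<Longrightarrow> adj (cscale_op c A) = cscale_op (cnj c) (adj A)"
  by (auto intro!: adj_eqI simp: cinner_adj blinfun.add_left blinfun.diff_left cinner_add_left
      cinner_add_right cinner_diff_left cinner_diff_right cscale_op_apply cinner_scaleC_left
      cinner_scaleC_right)

lemma adj_zero: "adj (0 :: 'h::chilbert_space \<Rightarrow>\<^sub>L 'h) = 0"
  by (rule adj_eqI) simp

section \<open>Operators carried by a closed subspace\<close>

lemma ops_clin_op: "A \<in> ops K \<Longrightarrow> clin_op A"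
  by (simp add: ops_def clin_op_def)

lemma ops_range: "A \<in> ops K \<Longrightarrow> blinfun_apply A x \<in> K"
  by (simp add: ops_def)

lemma ops_kernel: "A \<in> ops K \<Longrightarrow> (\<And>y. y \<in> K \<Longrightarrow> cinner x y = 0) \<Longrightarrow> blinfun_apply A x = 0"
  by (simp add: ops_def)

lemma ops_cproj:
  assumes "closed_csubspace K" "A \<in> ops K"
  shows "blinfun_apply A (cproj K x) = blinfun_apply A x"
  using ops_kernel[OF assms(2), of "x - cproj K x"] cproj_orthogonal[OF assms(1)]
  by (simp add: blinfun.diff_right)

lemma ops_eqI:
  assumes "closed_csubspace K" "A \<in> ops K" "B \<in> ops K"
    and "\<And>x. x \<in> K \<Longrightarrow> blinfun_apply A x = blinfun_apply B x"
  shows "A = B"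
  by (rule blinfun_eqI) (metis assms ops_cproj cproj_mem)

lemma adj_ops:
  assumes "closed_csubspace K" "A \<in> ops K"
  shows "adj A \<in> ops K"
proof -
  note A = ops_clin_op[OF assms(2)]
  have "blinfun_apply (adj A) x \<in> K" for x
  proof (rule mem_if_orthogonal_complement[OF assms(1)])
    fix z assume "\<And>y. y \<in> K \<Longrightarrow> cinner z y = 0"
    then show "cinner (blinfun_apply (adj A) x) z = 0"
      by (simp add: cinner_adj'[OF A] ops_kernel[OF assms(2)])
  qed
  moreover have "blinfun_apply (adj A) x = 0" if x: "\<forall>y\<in>K. cinner x y = 0" for x
    by (rule cinner_eqI_right)
       (use x ops_range[OF assms(2)] in \<open>simp add: cinner_adj[OF A, symmetric] cinner_eq_0_sym\<close>)
  ultimately show ?thesis using clin_op_adj[OF A] by (simp add: ops_def clin_op_def)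
qed

lemma ops_compose: "A \<in> ops K \<Longrightarrow> B \<in> ops K \<Longrightarrow> A o\<^sub>L B \<in> ops K"
  by (auto simp: ops_def)

lemma ops_zero: "closed_csubspace K \<Longrightarrow> 0 \<in> ops K"
  by (auto simp: ops_def closed_csubspaceD)

lemma ops_add: "closed_csubspace K \<Longrightarrow> A \<in> ops K \<Longrightarrow> B \<in> ops K \<Longrightarrow> A + B \<in> ops K"
  by (auto simp: ops_def closed_csubspaceD blinfun.add_left scaleC_add_right)

lemma ops_cscale: "closed_csubspace K \<Longrightarrow> A \<in> ops K \<Longrightarrow> cscale_op c A \<in> ops K"
  by (auto simp: ops_def closed_csubspaceD cscale_op_apply scaleC_scaleC mult.commute)

lemma tendsto_blinfun_apply_left:
  "A \<longlonglongrightarrow> L \<Longrightarrow> (\<lambda>n. blinfun_apply (A n) x) \<longlonglongrightarrow> blinfun_apply L x"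
  by (intro tendsto_intros)

lemma ops_limit:
  assumes K: "closed_csubspace K" and A: "\<And>n::nat. A n \<in> ops K" "A \<longlonglongrightarrow> L"
  shows "L \<in> ops K"
proof -
  note lim = tendsto_blinfun_apply_left[OF A(2)]
  have "blinfun_apply L (c *\<^sub>C x) = c *\<^sub>C blinfun_apply L x" for c x
  proof (rule LIMSEQ_unique[OF lim])
    show "(\<lambda>n. blinfun_apply (A n) (c *\<^sub>C x)) \<longlonglongrightarrow> c *\<^sub>C blinfun_apply L x"
      using tendsto_scaleC[OF lim[of x], of c] by (simp add: clin_opD[OF ops_clin_op[OF A(1)]])
  qed
  moreover have "blinfun_apply L x \<in> K" for x
    using closed_sequentially[OF closed_csubspaceD(1)[OF K] _ lim] ops_range[OF A(1)] by blast
  moreover have "blinfun_apply L x = 0" if "\<forall>y\<in>K. cinner x y = 0" for x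
    using lim[of x] ops_kernel[OF A(1), of x] that by (simp add: LIMSEQ_const_iff)
  ultimately show ?thesis by (simp add: ops_def)
qed

lemma tendsto_adj:
  assumes "\<And>n::nat. clin_op (A n)" "clin_op L" "A \<longlonglongrightarrow> L"
  shows "(\<lambda>n. adj (A n)) \<longlonglongrightarrow> adj L"
proof -
  have lim: "(\<lambda>n. norm (A n - L)) \<longlonglongrightarrow> 0" using assms(3) by (simp add: LIM_zero tendsto_norm_zero)
  have bound: "norm (adj (A n) - adj L) \<le> norm (A n - L)" for n
    using norm_adj_le[of "A n - L"] assms by (simp add: adj_diff clin_op_diff)
  have "(\<lambda>n. adj (A n) - adj L) \<longlonglongrightarrow> 0"
    using Lim_null_comparison[OF always_eventually[OF allI[OF bound]] lim] .
  then show ?thesis by (rule LIM_zero_cancel)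
qed

lemma tendsto_cscale_op:
  assumes "A \<longlonglongrightarrow> L"
  shows "(\<lambda>n. cscale_op c (A n)) \<longlonglongrightarrow> cscale_op c L"
proof -
  have lim: "(\<lambda>n. cmod c * norm (A n - L)) \<longlonglongrightarrow> cmod c * 0"
    using assms by (intro tendsto_intros) (simp add: LIM_zero tendsto_norm_zero)
  have bound: "norm (cscale_op c (A n) - cscale_op c L) \<le> cmod c * norm (A n - L)" for n
  proof (rule norm_blinfun_bound)
    fix x
    have "blinfun_apply (cscale_op c (A n) - cscale_op c L) x = c *\<^sub>C blinfun_apply (A n - L) x"
      by (simp add: blinfun.diff_left cscale_op_apply scaleC_diff_right)
    then show "norm (blinfun_apply (cscale_op c (A n) - cscale_op c L) x)
        \<le> cmod c * norm (A n - L) * norm x"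
      by (simp add: norm_scaleC mult.assoc mult_left_mono norm_blinfun)
  qed simp
  have "(\<lambda>n. cscale_op c (A n) - cscale_op c L) \<longlonglongrightarrow> 0"
    using Lim_null_comparison[OF always_eventually[OF allI[OF bound]], of "\<lambda>n. n"] lim by simp
  then show ?thesis by (rule LIM_zero_cancel)
qed

section \<open>Positive cones\<close>

lemma
  assumes "positive_cone P"
  shows positive_cone_add: "a \<in> P \<Longrightarrow> b \<in> P \<Longrightarrow> a + b \<in> P"
    and positive_cone_zero: "0 \<in> P"
    and positive_cone_total: "a \<in> P \<or> - a \<in> P"
    and positive_cone_antisym: "a \<in> P \<Longrightarrow> - a \<in> P \<Longrightarrow> a = 0"
proof -
  have *: "subsemigroup P" "P \<union> uminus ` P = UNIV" "P \<inter> uminus ` P = {0}"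
    using assms by (auto simp: positive_cone_def)
  show "a \<in> P \<Longrightarrow> b \<in> P \<Longrightarrow> a + b \<in> P" using *(1) by (simp add: subsemigroup_def)
  show "0 \<in> P" using *(3) by blast
  show "a \<in> P \<or> - a \<in> P"
  proof -
    have "a \<in> P \<union> uminus ` P" using *(2) by simp
    then show ?thesis by auto
  qed
  assume "a \<in> P" "- a \<in> P"
  then have "a \<in> P \<inter> uminus ` P" by (metis IntI image_eqI minus_minus)
  then show "a = 0" using *(3) by simp
qed

text \<open>The order need not be a well-order, so least elements are available for finite sets
  only. They select a smallest positive element, move Folner sets into the cone and order the bands
  below.\<close>

lemma positive_cone_minimum:
  assumes P: "positive_cone P" and "finite D" "D \<noteq> {}"
  shows "\<exists>c\<in>D. \<forall>d\<in>D. d - c \<in> P"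
  using assms(2,3)
proof (induction rule: finite_ne_induct)
  case (singleton x)
  then show ?case by (simp add: positive_cone_zero[OF P])
next
  case (insert x D)
  then obtain c where c: "c \<in> D" "\<And>d. d \<in> D \<Longrightarrow> d - c \<in> P" by blast
  show ?case
  proof (cases "x - c \<in> P")
    case True
    with c show ?thesis by blast
  next
    case False
    then have "c - x \<in> P" using positive_cone_total[OF P, of "x - c"] by simp
    then have "d - x \<in> P" if "d \<in> D" for d
      using positive_cone_add[OF P c(2)[OF that], of "c - x"] by simp
    then show ?thesis by (auto simp: positive_cone_zero[OF P])
  qed
qed

section \<open>Isometric representations\<close>

lemma blinfun_compose_assoc: "A o\<^sub>L B o\<^sub>L C = A o\<^sub>L (B o\<^sub>L C)"
  by (rule blinfun_eqI) simp

locale isorep =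
  fixes S :: "'g::ab_group_add set" and K :: "'h::chilbert_space set"
    and V :: "'g \<Rightarrow> 'h \<Rightarrow>\<^sub>L 'h"
  assumes rep: "isometric_rep S K V" and subsemigroup: "subsemigroup S" and zero_mem: "0 \<in> S"
begin

abbreviation v :: "'g \<Rightarrow> 'h \<Rightarrow> 'h" where "v a \<equiv> blinfun_apply (V a)"
abbreviation vs :: "'g \<Rightarrow> 'h \<Rightarrow> 'h" where "vs a \<equiv> blinfun_apply (adj (V a))"

lemma K: "closed_csubspace K"
  using rep by (simp add: isometric_rep_def)

lemma V_ops: "a \<in> S \<Longrightarrow> V a \<in> ops K"
  and norm_v: "a \<in> S \<Longrightarrow> x \<in> K \<Longrightarrow> norm (v a x) = norm x"
  using rep by (auto simp: isometric_rep_def isometry_on_def)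

lemma V_add: "a \<in> S \<Longrightarrow> b \<in> S \<Longrightarrow> V (a + b) = V a o\<^sub>L V b"
  using rep by (simp add: isometric_rep_def)

lemma clin_V: "a \<in> S \<Longrightarrow> clin_op (V a)"
  by (rule ops_clin_op[OF V_ops])

lemma adjV_ops: "a \<in> S \<Longrightarrow> adj (V a) \<in> ops K"
  by (rule adj_ops[OF K V_ops])

lemma v_mem: "a \<in> S \<Longrightarrow> v a x \<in> K"
  and vs_mem: "a \<in> S \<Longrightarrow> vs a x \<in> K"
  by (auto intro: ops_range V_ops adjV_ops)

lemma v_add: "a \<in> S \<Longrightarrow> b \<in> S \<Longrightarrow> v (a + b) x = v a (v b x)"
  by (simp add: V_add)

lemma adjV_add: "a \<in> S \<Longrightarrow> b \<in> S \<Longrightarrow> adj (V (a + b)) = adj (V b) o\<^sub>L adj (V a)"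
  by (simp add: V_add adj_compose clin_V)

lemma vs_add: "a \<in> S \<Longrightarrow> b \<in> S \<Longrightarrow> vs (a + b) x = vs b (vs a x)"
  by (simp add: adjV_add)

lemma cinner_v: "a \<in> S \<Longrightarrow> cinner (v a x) y = cinner x (vs a y)"
  by (simp add: cinner_adj clin_V)

lemma cinner_vs: "a \<in> S \<Longrightarrow> cinner (vs a x) y = cinner x (v a y)"
  by (simp add: cinner_adj' clin_V)

lemma cinner_v_v: "a \<in> S \<Longrightarrow> x \<in> K \<Longrightarrow> y \<in> K \<Longrightarrow> cinner (v a x) (v a y) = cinner x y"
  by (rule isometry_cinner[OF K]) (simp_all add: blinfun.add_right clin_opD[OF clin_V] norm_v)

lemma vs_v: "a \<in> S \<Longrightarrow> x \<in> K \<Longrightarrow> vs a (v a x) = x"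
proof -
  assume a: "a \<in> S" and x: "x \<in> K"
  let ?z = "vs a (v a x) - x"
  have z: "?z \<in> K" using closed_csubspace_diff[OF K] vs_mem[OF a] x by blast
  have "cinner ?z ?z = cinner (vs a (v a x)) ?z - cinner x ?z" by (simp add: cinner_diff_left)
  also have "\<dots> = 0" using cinner_v_v[OF a x z] by (simp add: cinner_vs[OF a])
  finally show ?thesis by simp
qed

text \<open>\<open>V 0\<close> is idempotent because 0 + 0 = 0, and an isometry is injective, so
  \<open>v 0 x - x\<close>, which \<open>V 0\<close> kills, must vanish.\<close>

lemma v_0: "x \<in> K \<Longrightarrow> v 0 x = x"
proof -
  assume x: "x \<in> K"
  have "v 0 (v 0 x - x) = 0"
    using v_add[OF zero_mem zero_mem, of x] by (simp add: blinfun.diff_right)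
  then have "norm (v 0 x - x) = 0"
    using norm_v[OF zero_mem, of "v 0 x - x"] v_mem[OF zero_mem] closed_csubspace_diff[OF K _ x]
    by simp
  then show ?thesis by simp
qed

lemma vs_0: "x \<in> K \<Longrightarrow> vs 0 x = x"
  using vs_v[OF zero_mem, of x] v_0 by simp

lemma adjV_0: "adj (V 0) = V 0"
  by (rule ops_eqI[OF K adjV_ops[OF zero_mem] V_ops[OF zero_mem]]) (simp add: vs_0 v_0)

lemma adjV_V: "a \<in> S \<Longrightarrow> adj (V a) o\<^sub>L V a = V 0"
  by (rule ops_eqI[OF K]) (auto intro: ops_compose V_ops adjV_ops zero_mem simp: vs_v v_0)

lemma V0_compose: "A \<in> ops K \<Longrightarrow> V 0 o\<^sub>L A = A"
  by (rule blinfun_eqI) (simp add: v_0 ops_range)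

lemma compose_V0: "A \<in> ops K \<Longrightarrow> A o\<^sub>L V 0 = A"
  by (rule ops_eqI[OF K]) (auto intro: ops_compose V_ops zero_mem simp: v_0)

text \<open>\<open>V_a^* V_a\<close> is always the identity on \<open>K\<close>, so non-unitarity
  means that \<open>V_a V_a^*\<close> moves some \<open>y\<close>; the difference is a nonzero
  vector killed by \<open>V_a^*\<close>, and it only has to be normalized.\<close>

lemma nonunitary_kernel:
  assumes a: "a \<in> S" and "\<not> unitary_on K (V a)"
  shows "\<exists>x\<in>K. norm x = 1 \<and> vs a x = 0"
proof -
  obtain y where y: "y \<in> K" "v a (vs a y) \<noteq> y"
    using assms V_ops[OF a] vs_v[OF a] by (auto simp: unitary_on_def)
  let ?z = "y - v a (vs a y)"
  have z: "?z \<in> K" "?z \<noteq> 0" "vs a ?z = 0"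
    using y closed_csubspace_diff[OF K y(1) v_mem[OF a]]
    by (auto simp: blinfun.diff_right vs_v[OF a vs_mem[OF a]])
  let ?x = "complex_of_real (1 / norm ?z) *\<^sub>C ?z"
  have "norm ?x = 1"
    using z(2) by (simp only: norm_scaleC norm_of_real) simp
  moreover have "vs a ?x = 0"
    by (simp add: clin_opD[OF clin_op_adj[OF clin_V[OF a]]] z(3) del: of_real_divide)
  ultimately show ?thesis using closed_csubspaceD(4)[OF K z(1)] by blast
qed

lemma unitary_V0: "unitary_on K (V 0)"
  by (simp add: unitary_on_def V_ops zero_mem v_0 vs_0)

end

section \<open>Representations of the positive cone\<close>

locale conerep = isorep P K V for P :: "'g::ab_group_add set" and K :: "'h::chilbert_space set" and V +
  assumes cone: "positive_cone P"
begin

lemma diff_mem: "a - b \<notin> P \<Longrightarrow> b - a \<in> P"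
  using positive_cone_total[OF cone, of "a - b"] by simp

lemma V_diff: "b \<in> P \<Longrightarrow> a - b \<in> P \<Longrightarrow> V a = V b o\<^sub>L V (a - b)"
  by (simp add: V_add[symmetric])

lemma adjV_compose_V_ge:
  assumes "b \<in> P" "a - b \<in> P"
  shows "adj (V b) o\<^sub>L V a = V (a - b)"
  unfolding V_diff[OF assms] blinfun_compose_assoc[symmetric] adjV_V[OF assms(1)]
  by (rule V0_compose[OF V_ops[OF assms(2)]])

lemma adjV_compose_V_le:
  assumes "a \<in> P" "b - a \<in> P"
  shows "adj (V b) o\<^sub>L V a = adj (V (b - a))"
  using arg_cong[OF adjV_compose_V_ge[OF assms], of adj] assms positive_cone_add[OF cone assms]
  by (simp add: adj_compose clin_V clin_op_adj adj_adj)

definition E :: "'g \<Rightarrow> 'g \<Rightarrow> 'h \<Rightarrow>\<^sub>L 'h" where "E a b = V a o\<^sub>L adj (V b)"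

lemma E_ops: "a \<in> P \<Longrightarrow> b \<in> P \<Longrightarrow> E a b \<in> ops K"
  unfolding E_def by (intro ops_compose V_ops adjV_ops)

lemma E_apply: "blinfun_apply (E a b) x = v a (vs b x)"
  by (simp add: E_def)

text \<open>With \<open>E_compose_le\<close> these are the relations of the bicyclic monoid, with
  \<open>P\<close> in place of the natural numbers: the inner factor \<open>V_b^* V_c\<close>
  cancels to a single generator or its adjoint.\<close>

lemma E_compose_ge:
  assumes "a \<in> P" "b \<in> P" "d \<in> P" "c - b \<in> P"
  shows "E a b o\<^sub>L E c d = E (a + (c - b)) d"
proof -
  have "E a b o\<^sub>L E c d = V a o\<^sub>L (adj (V b) o\<^sub>L V c) o\<^sub>L adj (V d)"
    by (simp add: E_def blinfun_compose_assoc)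
  then show ?thesis using assms by (simp add: adjV_compose_V_ge E_def V_add)
qed

lemma E_compose_le:
  assumes "a \<in> P" "c \<in> P" "d \<in> P" "b - c \<in> P"
  shows "E a b o\<^sub>L E c d = E a (d + (b - c))"
proof -
  have "E a b o\<^sub>L E c d = V a o\<^sub>L (adj (V b) o\<^sub>L V c) o\<^sub>L adj (V d)"
    by (simp add: E_def blinfun_compose_assoc)
  then show ?thesis using assms by (simp add: adjV_compose_V_le E_def adjV_add blinfun_compose_assoc)
qed

lemma E_compose_ex:
  assumes "a \<in> P" "b \<in> P" "c \<in> P" "d \<in> P"
  shows "\<exists>m\<in>P. \<exists>n\<in>P. E a b o\<^sub>L E c d = E m n"
  using E_compose_ge[of a b d c] E_compose_le[of a c d b] assms diff_mem[of c b]
    positive_cone_add[OF cone] by metis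

lemma adj_E: "a \<in> P \<Longrightarrow> b \<in> P \<Longrightarrow> adj (E a b) = E b a"
  by (simp add: E_def adj_compose clin_V clin_op_adj adj_adj)

lemma V_eq_E: "a \<in> P \<Longrightarrow> V a = E a 0"
  by (simp add: E_def adjV_0 compose_V0 V_ops)

lemma rep_semigroup_eq: "rep_semigroup P V = {E a b | a b. a \<in> P \<and> b \<in> P}"
proof (intro equalityI subsetI)
  fix A assume "A \<in> rep_semigroup P V"
  then show "A \<in> {E a b | a b. a \<in> P \<and> b \<in> P}"
  proof induction
    case (gen a)
    then show ?case using V_eq_E zero_mem by blast
  next
    case (gen_adj a)
    then have "adj (V a) = E 0 a" using V_eq_E adj_E zero_mem by simp
    with gen_adj show ?case using zero_mem by blast
  next
    case (mult A B)
    then show ?case using E_compose_ex by blast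
  qed
next
  fix A assume "A \<in> {E a b | a b. a \<in> P \<and> b \<in> P}"
  then show "A \<in> rep_semigroup P V"
    unfolding E_def by (auto intro: rep_semigroup.intros)
qed

lemma range_proj_commute_aux:
  assumes "a \<in> P" "b - a \<in> P"
  shows "E a a o\<^sub>L E b b = E b b" "E b b o\<^sub>L E a a = E b b"
proof -
  have b: "b \<in> P" using positive_cone_add[OF cone assms] by simp
  show "E a a o\<^sub>L E b b = E b b" using E_compose_ge[OF assms(1,1) b assms(2)] by simp
  show "E b b o\<^sub>L E a a = E b b" using E_compose_le[OF b assms(1,1,2)] by simp
qed

lemma range_proj_commute: "a \<in> P \<Longrightarrow> b \<in> P \<Longrightarrow> E a a o\<^sub>L E b b = E b b o\<^sub>L E a a"
  using range_proj_commute_aux diff_mem[of b a] by metis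

text \<open>Multiplication by \<open>V_m^*\<close> from the left and by \<open>V_n\<close> from the
  right strips the equation to \<open>V_n^* V_m = V_0\<close>. The left side is
  \<open>V_(m - n)\<close> or the adjoint of \<open>V_(n - m)\<close>, so injectivity gives
  equality.\<close>

lemma E_idempotent:
  assumes inj: "inj_on V P" and "m \<in> P" "n \<in> P" "E m n o\<^sub>L E m n = E m n"
  shows "m = n"
proof -
  have V: "V 0 o\<^sub>L A = A" "A o\<^sub>L V 0 = A" if "A \<in> ops K" for A
    using that V0_compose compose_V0 by auto
  have "adj (V m) o\<^sub>L (E m n o\<^sub>L E m n) o\<^sub>L V n =
      (adj (V m) o\<^sub>L V m) o\<^sub>L (adj (V n) o\<^sub>L V m) o\<^sub>L (adj (V n) o\<^sub>L V n)"
    by (simp add: E_def blinfun_compose_assoc)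
  also have "\<dots> = adj (V n) o\<^sub>L V m"
    using assms by (simp add: adjV_V V ops_compose V_ops adjV_ops)
  also have "adj (V m) o\<^sub>L (E m n o\<^sub>L E m n) o\<^sub>L V n = (adj (V m) o\<^sub>L V m) o\<^sub>L (adj (V n) o\<^sub>L V n)"
    unfolding assms(4) by (simp add: E_def blinfun_compose_assoc)
  also have "\<dots> = V 0" using assms by (simp add: adjV_V V V_ops zero_mem)
  finally have *: "adj (V n) o\<^sub>L V m = V 0" by simp
  show ?thesis
  proof (cases "m - n \<in> P")
    case True
    then have "V (m - n) = V 0" using adjV_compose_V_ge assms * by metis
    then show ?thesis using inj_onD[OF inj _ True zero_mem] by simp
  next
    case False
    then have P: "n - m \<in> P" by (rule diff_mem)
    then have "adj (V (n - m)) = V 0" using adjV_compose_V_le assms * by metis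
    then have "V (n - m) = V 0" using adj_adj[OF clin_V[OF P]] adjV_0 by metis
    then show ?thesis using inj_onD[OF inj _ P zero_mem] by simp
  qed
qed

text \<open>\<open>E b a\<close> inverts \<open>E a b\<close>. Uniqueness is the usual consequence
  of commuting idempotents: by \<open>E_idempotent\<close> every idempotent has the form
  \<open>E a a\<close>, and these form a chain.\<close>

lemma inverse_rep:
  assumes inj: "inj_on V P"
  shows "inverse_rep P V"
  unfolding inverse_rep_def inverse_semigroup_def
proof (intro conjI ballI)
  let ?R = "rep_semigroup P V"
  show "A o\<^sub>L B \<in> ?R" if "A \<in> ?R" "B \<in> ?R" for A B
    using that by (rule rep_semigroup.mult)
  show "A o\<^sub>L B o\<^sub>L C = A o\<^sub>L (B o\<^sub>L C)" for A B C :: "'h \<Rightarrow>\<^sub>L 'h"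
    by (rule blinfun_compose_assoc)
  have commute: "A o\<^sub>L B = B o\<^sub>L A"
    if R: "A \<in> ?R" "B \<in> ?R" and idem: "A o\<^sub>L A = A" "B o\<^sub>L B = B" for A B
  proof -
    obtain a b c d where "A = E a b" "B = E c d" "a \<in> P" "b \<in> P" "c \<in> P" "d \<in> P"
      using R unfolding rep_semigroup_eq by blast
    moreover from this idem have "a = b" "c = d" using E_idempotent[OF inj] by blast+
    ultimately show ?thesis using range_proj_commute by simp
  qed
  fix A assume A: "A \<in> ?R"
  then obtain a b where ab: "A = E a b" "a \<in> P" "b \<in> P" unfolding rep_semigroup_eq by blast
  show "\<exists>!B. B \<in> ?R \<and> A o\<^sub>L B o\<^sub>L A = A \<and> B o\<^sub>L A o\<^sub>L B = B"
  proof (rule ex1I[where a = "E b a"], intro conjI)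
    show "E b a \<in> ?R" using ab unfolding rep_semigroup_eq by blast
    show "A o\<^sub>L E b a o\<^sub>L A = A" "E b a o\<^sub>L A o\<^sub>L E b a = E b a"
      using ab E_compose_ge[of a b a b] E_compose_ge[of b a b a] E_compose_ge[of a a b a]
        E_compose_ge[of b b a b] zero_mem by simp_all
    \<comment> \<open>\<open>AB\<close>, \<open>AC\<close>, \<open>BA\<close>, \<open>CA\<close> are
      idempotents. Inserting \<open>ACA = A\<close> into \<open>BAB\<close> and commuting
      \<open>BA\<close> with \<open>CA\<close> turns \<open>B\<close> into \<open>CAB\<close>; the
      same trick with \<open>AB\<close> and \<open>AC\<close> turns \<open>CAB\<close> into
      \<open>C\<close>.\<close>
    have unique: "B = C" if "B \<in> ?R" "A o\<^sub>L B o\<^sub>L A = A" "B o\<^sub>L A o\<^sub>L B = B"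
      and "C \<in> ?R" "A o\<^sub>L C o\<^sub>L A = A" "C o\<^sub>L A o\<^sub>L C = C" for B C
    proof -
      note assoc = blinfun_compose_assoc
      have 1: "(A o\<^sub>L B) o\<^sub>L (A o\<^sub>L C) = (A o\<^sub>L C) o\<^sub>L (A o\<^sub>L B)"
        using that A by (intro commute rep_semigroup.mult) (metis assoc)+
      have 2: "(B o\<^sub>L A) o\<^sub>L (C o\<^sub>L A) = (C o\<^sub>L A) o\<^sub>L (B o\<^sub>L A)"
        using that A by (intro commute rep_semigroup.mult) (metis assoc)+
      have "B = (B o\<^sub>L A) o\<^sub>L (C o\<^sub>L A) o\<^sub>L B" using that by (metis assoc)
      also have "\<dots> = C o\<^sub>L (A o\<^sub>L B)" unfolding 2 using that by (metis assoc)
      also have "\<dots> = C o\<^sub>L ((A o\<^sub>L C) o\<^sub>L (A o\<^sub>L B))" using that by (metis assoc)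
      also have "\<dots> = C" unfolding 1[symmetric] using that by (metis assoc)
      finally show ?thesis .
    qed
    fix B assume "B \<in> ?R \<and> A o\<^sub>L B o\<^sub>L A = A \<and> B o\<^sub>L A o\<^sub>L B = B"
    then show "B = E b a"
      using unique \<open>E b a \<in> ?R\<close> \<open>A o\<^sub>L E b a o\<^sub>L A = A\<close> \<open>E b a o\<^sub>L A o\<^sub>L E b a = E b a\<close> by blast
  qed
qed

end

text \<open>Once products of idempotents are known to be idempotent, \<open>e f\<close> and
  \<open>f e\<close> are both inverses of \<open>e f\<close>, and inverses are unique.\<close>

lemma inverse_semigroup_idempotents_commute:
  fixes m :: "'a \<Rightarrow> 'a \<Rightarrow> 'a" (infixl "\<cdot>" 70)
  assumes inv: "inverse_semigroup P (\<cdot>)"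
    and e: "e \<in> P" "e \<cdot> e = e" and f: "f \<in> P" "f \<cdot> f = f"
  shows "e \<cdot> f = f \<cdot> e"
proof -
  have cl: "x \<cdot> y \<in> P" if "x \<in> P" "y \<in> P" for x y
    using inv that by (simp add: inverse_semigroup_def)
  have assoc: "(x \<cdot> y) \<cdot> z = x \<cdot> (y \<cdot> z)" if "x \<in> P" "y \<in> P" "z \<in> P" for x y z
    using inv that by (simp add: inverse_semigroup_def)
  have ex: "\<exists>y. y \<in> P \<and> x \<cdot> y \<cdot> x = x \<and> y \<cdot> x \<cdot> y = y" if "x \<in> P" for x
    using inv that unfolding inverse_semigroup_def by blast
  have uniq: "y = z" if "x \<in> P" "y \<in> P" "x \<cdot> y \<cdot> x = x" "y \<cdot> x \<cdot> y = y"
    "z \<in> P" "x \<cdot> z \<cdot> x = x" "z \<cdot> x \<cdot> z = z" for x y z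
    using inv that unfolding inverse_semigroup_def by blast
  have idem: "(e \<cdot> f) \<cdot> (e \<cdot> f) = e \<cdot> f"
    if e: "e \<in> P" "e \<cdot> e = e" and f: "f \<in> P" "f \<cdot> f = f" for e f
  proof -
    note ef = cl[OF e(1) f(1)]
    obtain x where x: "x \<in> P" "e \<cdot> f \<cdot> x \<cdot> (e \<cdot> f) = e \<cdot> f" "x \<cdot> (e \<cdot> f) \<cdot> x = x"
      using ex[OF ef] by blast
    \<comment> \<open>If \<open>x\<close> inverts \<open>e f\<close>, then so does
      \<open>f x e\<close>. Hence they coincide, and \<open>f x e\<close> is visibly
      idempotent.\<close>
    let ?y = "f \<cdot> (x \<cdot> e)"
    have y: "?y \<in> P" using cl e f x by simp
    have ee: "e \<cdot> (e \<cdot> z) = e \<cdot> z" and ff: "f \<cdot> (f \<cdot> z) = f \<cdot> z" if "z \<in> P" for z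
      using assoc[OF e(1) e(1) that] assoc[OF f(1) f(1) that] e f by simp_all
    have x': "e \<cdot> (f \<cdot> (x \<cdot> (e \<cdot> f))) = e \<cdot> f" "x \<cdot> (e \<cdot> (f \<cdot> x)) = x"
      using x e f cl by (simp_all add: assoc)
    have x'': "x \<cdot> (e \<cdot> (f \<cdot> (x \<cdot> z))) = x \<cdot> z" if "z \<in> P" for z
      using arg_cong[OF x'(2), of "\<lambda>t. t \<cdot> z"] x e f cl that by (simp add: assoc)
    have yy: "?y \<cdot> ?y = ?y" using x e f cl by (simp add: assoc x'')
    have "x = ?y"
      by (rule uniq[OF ef]) (use x e f cl y in \<open>simp_all add: assoc x' x'' ee ff\<close>)
    then have xx: "x \<cdot> x = x" using yy by simp
    \<comment> \<open>The idempotent \<open>x\<close> is its own inverse, and \<open>e f\<close> is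
      an inverse of \<open>x\<close> as well.\<close>
    have "e \<cdot> f = x"
      by (rule uniq[OF x(1)]) (use x xx e f cl in \<open>simp_all add: assoc\<close>)
    then show ?thesis using xx by simp
  qed
  have ee: "e \<cdot> (e \<cdot> z) = e \<cdot> z" and ff: "f \<cdot> (f \<cdot> z) = f \<cdot> z" if "z \<in> P" for z
    using assoc[OF e(1) e(1) that] assoc[OF f(1) f(1) that] e f by simp_all
  have *: "e \<cdot> (f \<cdot> (e \<cdot> f)) = e \<cdot> f" "f \<cdot> (e \<cdot> (f \<cdot> e)) = f \<cdot> e"
    using idem[OF e f] idem[OF f e] e f cl by (simp_all add: assoc)
  show ?thesis
    by (rule uniq[of "e \<cdot> f"]) (use e f cl in \<open>simp_all add: assoc * ee ff\<close>)
qed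

section \<open>Folner sets\<close>

text \<open>Boxes generated by \<open>\<Delta>\<close> grow polynomially, so their successive ratios cannot all exceed
  \<open>1 + \<epsilon>\<close>.\<close>

lemma abelian_Folner:
  fixes \<Delta> :: "'g::ab_group_add set" and \<epsilon> :: real
  assumes fin: "finite \<Delta>" and "\<epsilon> > 0"
  shows "\<exists>A B. finite B \<and> A \<noteq> {} \<and> A \<subseteq> B \<and> (\<forall>x\<in>A. \<forall>d\<in>\<Delta>. x + d \<in> B) \<and>
    real (card B) \<le> (1 + \<epsilon>) * real (card A)"
proof -
  \<comment> \<open>The inner sum is the \<open>k d\<close>-fold multiple of \<open>d\<close>, so
    \<open>B n\<close> is the image of a box with side length \<open>n\<close>.\<close>
  define f :: "('g \<Rightarrow> nat) \<Rightarrow> 'g" where "f k = (\<Sum>d\<in>\<Delta>. \<Sum>j<k d. d)" for k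
  define B where "B n = f ` (\<Delta> \<rightarrow>\<^sub>E {..n})" for n
  have finB: "finite (B n)" for n
    unfolding B_def using fin by (intro finite_imageI finite_PiE) auto
  have "f (\<lambda>d\<in>\<Delta>. 0) \<in> B n" for n by (auto simp: B_def)
  then have ne: "B n \<noteq> {}" for n by blast
  have mono: "B n \<subseteq> B (Suc n)" for n
    unfolding B_def by (intro image_mono PiE_mono) auto
  have step: "x + d \<in> B (Suc n)" if x: "x \<in> B n" and d: "d \<in> \<Delta>" for x d n
  proof -
    obtain k where k: "k \<in> \<Delta> \<rightarrow>\<^sub>E {..n}" "x = f k" using x by (auto simp: B_def)
    have "k(d := Suc (k d)) \<in> \<Delta> \<rightarrow>\<^sub>E {..Suc n}"
      using k(1) d by (fastforce simp: PiE_iff extensional_def)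
    moreover have "f (k(d := Suc (k d))) = x + d"
      using k(2) sum.remove[OF fin d, of "\<lambda>d. \<Sum>j<k d. d"]
        sum.remove[OF fin d, of "\<lambda>e. \<Sum>j<(k(d := Suc (k d))) e. e"]
      by (simp add: f_def algebra_simps)
    ultimately show ?thesis unfolding B_def by (metis image_eqI)
  qed
  have card_le: "real (card (B n)) \<le> (real n + 1) ^ card \<Delta>" for n
  proof -
    have "card (B n) \<le> card (\<Delta> \<rightarrow>\<^sub>E {..n})"
      unfolding B_def using fin by (intro card_image_le finite_PiE) auto
    also have "\<dots> = Suc n ^ card \<Delta>" using fin by (simp add: card_PiE)
    finally have "real (card (B n)) \<le> real (Suc n ^ card \<Delta>)" by (rule of_nat_mono)
    then show ?thesis by (simp add: add.commute)
  qed
  have "\<exists>n. real (card (B (Suc n))) \<le> (1 + \<epsilon>) * real (card (B n))"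
  proof (rule ccontr)
    assume "\<nexists>n. real (card (B (Suc n))) \<le> (1 + \<epsilon>) * real (card (B n))"
    then have grow: "(1 + \<epsilon>) * real (card (B n)) \<le> real (card (B (Suc n)))" for n
      by (meson linear)
    have "(1 + \<epsilon>) ^ n \<le> real (card (B n))" for n
    proof (induction n)
      case 0
      show ?case using ne finB by (simp add: Suc_leI card_gt_0_iff)
    next
      case (Suc n)
      then have "(1 + \<epsilon>) * (1 + \<epsilon>) ^ n \<le> (1 + \<epsilon>) * real (card (B n))"
        using \<open>\<epsilon> > 0\<close> by (intro mult_left_mono) auto
      with grow[of n] show ?case by simp
    qed
    then have exp_le_poly: "(1 + \<epsilon>) ^ n \<le> (real n + 1) ^ card \<Delta>" for n
      using card_le order_trans by blast
    \<comment> \<open>The root reduces exponential against polynomial growth to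
      \<open>s ^ n \<le> real n + 1\<close> with \<open>s > 1\<close>. The degree is one more than
      \<open>card \<Delta>\<close> so that it stays positive for empty
      \<open>\<Delta>\<close>.\<close>
    define s where "s = root (Suc (card \<Delta>)) (1 + \<epsilon>)"
    have s: "s > 1" "s ^ Suc (card \<Delta>) = 1 + \<epsilon>"
      using \<open>\<epsilon> > 0\<close> unfolding s_def by (simp_all only: real_root_gt_1_iff real_root_pow_pos2)
    have "s ^ n \<le> real n + 1" for n
    proof -
      have "(s ^ n) ^ Suc (card \<Delta>) = (1 + \<epsilon>) ^ n"
        using s(2) by (metis power_mult mult.commute)
      also have "\<dots> \<le> (real n + 1) ^ Suc (card \<Delta>)"
        by (rule order_trans[OF exp_le_poly power_increasing]) auto
      finally show ?thesis by (rule power_le_imp_le_base) simp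
    qed
    then have ge: "1 \<le> real n * (1 / s) ^ n + (1 / s) ^ n" for n
      using s(1) by (simp add: field_simps)
    have lim: "(\<lambda>n. real n * (1 / s) ^ n + (1 / s) ^ n) \<longlonglongrightarrow> 0 + 0"
      using s(1) by (intro tendsto_add powser_times_n_limit_0 LIMSEQ_power_zero) auto
    then show False using LIMSEQ_le_const[OF lim, of 1] ge by auto
  qed
  then obtain n where "real (card (B (Suc n))) \<le> (1 + \<epsilon>) * real (card (B n))" by blast
  with finB ne mono step show ?thesis
    by (intro exI[of _ "B n"] exI[of _ "B (Suc n)"]) simp
qed

section \<open>Gram--Schmidt\<close>

text \<open>Gives finitely many vectors coordinates in a common orthonormal system;
  \<open>toeplitz_vector_bound\<close> uses it to pass from scalar functions to functions with
  values in a Hilbert space.\<close>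

lemma gram_schmidt:
  fixes X :: "'h::chilbert_space set"
  assumes "finite X"
  shows "\<exists>B. finite B \<and> (\<forall>e\<in>B. \<forall>f\<in>B. cinner e f = (if e = f then 1 else 0)) \<and>
    (\<forall>x\<in>X. x = (\<Sum>e\<in>B. cinner x e *\<^sub>C e))"
  using assms
proof induction
  case empty
  show ?case by (intro exI[of _ "{}"]) simp
next
  case (insert x X)
  then obtain B where B: "finite B" "\<And>e f. e \<in> B \<Longrightarrow> f \<in> B \<Longrightarrow> cinner e f = (if e = f then 1 else 0)"
    and X: "\<And>z. z \<in> X \<Longrightarrow> z = (\<Sum>e\<in>B. cinner z e *\<^sub>C e)" by metis
  define r where "r = x - (\<Sum>e\<in>B. cinner x e *\<^sub>C e)"
  have r: "cinner r f = 0" if "f \<in> B" for f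
  proof -
    have "(\<Sum>e\<in>B. cinner x e * cinner e f) = (\<Sum>e\<in>B. if e = f then cinner x e else 0)"
      using B that by (intro sum.cong) auto
    then show ?thesis
      using B that by (simp add: r_def cinner_diff_left cinner_sum_left cinner_scaleC_left)
  qed
  show ?case
  proof (cases "r = 0")
    case True
    with B X show ?thesis by (intro exI[of _ B]) (simp add: r_def)
  next
    case False
    define g where "g = complex_of_real (1 / norm r) *\<^sub>C r"
    have "cinner g g = complex_of_real ((1 / norm r * norm r)\<^sup>2)"
      unfolding cinner_self g_def norm_scaleC norm_of_real by simp
    then have gg: "cinner g g = 1" using False by simp
    have gB: "cinner g f = 0" "cinner f g = 0" if "f \<in> B" for f
      using r[OF that] by (simp_all add: g_def cinner_scaleC_left cinner_scaleC_right cinner_eq_0_sym)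
    have gnB: "g \<notin> B" using gg gB(1) by force
    \<comment> \<open>The new vector \<open>g\<close> is orthogonal to everything expanded over
      \<open>B\<close>, so earlier expansions survive the enlargement of \<open>B\<close>.\<close>
    have perp: "cinner z g = 0" if "z = (\<Sum>e\<in>B. cinner z e *\<^sub>C e)" for z
    proof -
      have "cinner z g = (\<Sum>e\<in>B. cinner z e * cinner e g)"
        by (subst that) (simp only: cinner_sum_left cinner_scaleC_left)
      then show ?thesis using gB by simp
    qed
    have "cinner (\<Sum>e\<in>B. cinner x e *\<^sub>C e) g = 0"
      using gB by (simp add: cinner_sum_left cinner_scaleC_left)
    then have "cinner x g = cinner r g"
      by (simp add: r_def cinner_diff_left)
    moreover have r_eq: "r = complex_of_real (norm r) *\<^sub>C g"
      using False by (simp add: g_def scaleC_scaleC flip: of_real_mult del: of_real_divide)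
    then have "cinner r g = complex_of_real (norm r)"
      by (metis cinner_scaleC_left gg mult.right_neutral)
    ultimately have "cinner x g *\<^sub>C g = r" using r_eq by simp
    then have "x = (\<Sum>e\<in>insert g B. cinner x e *\<^sub>C e)"
      using B(1) gnB by (simp add: r_def)
    moreover have "z = (\<Sum>e\<in>insert g B. cinner z e *\<^sub>C e)" if "z \<in> X" for z
      using B(1) gnB X[OF that] perp[OF X[OF that]] by simp
    ultimately show ?thesis
      using B gg gB gnB by (intro exI[of _ "insert g B"]) auto
  qed
qed

lemma parseval_finite:
  fixes x :: "'h::chilbert_space"
  assumes "finite B" "\<And>e f. e \<in> B \<Longrightarrow> f \<in> B \<Longrightarrow> cinner e f = (if e = f then 1 else 0)"
    and x: "x = (\<Sum>e\<in>B. cinner x e *\<^sub>C e)"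
  shows "(norm x)\<^sup>2 = (\<Sum>e\<in>B. (cmod (cinner x e))\<^sup>2)"
proof -
  have "(norm e)\<^sup>2 = 1" if "e \<in> B" for e
    using assms(2)[OF that that] cinner_self[of e] by (metis of_real_eq_1_iff)
  moreover have "(norm x)\<^sup>2 = (\<Sum>e\<in>B. (norm (cinner x e *\<^sub>C e))\<^sup>2)"
    by (subst x, rule pythagoras_sum[OF assms(1)])
       (use assms(2) in \<open>simp add: cinner_scaleC_left cinner_scaleC_right\<close>)
  ultimately show ?thesis by (simp add: norm_scaleC power_mult_distrib)
qed

section \<open>Norm comparison\<close>

context conerep
begin

text \<open>For the least nonzero element \<open>c\<close> in question, \<open>V_d^*\<close> factors
  through \<open>V_c^*\<close> whenever \<open>d - c \<in> P\<close>. A single defect vector of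
  \<open>V_c\<close> is therefore killed by all of them.\<close>

lemma common_kernel_vector:
  assumes nu: "\<And>a. a \<in> P \<Longrightarrow> a \<noteq> 0 \<Longrightarrow> \<not> unitary_on K (V a)"
    and a: "a \<in> P" "a \<noteq> 0" and D: "finite D" "D \<subseteq> P"
  shows "\<exists>\<eta>\<in>K. norm \<eta> = 1 \<and> (\<forall>d\<in>D. d \<noteq> 0 \<longrightarrow> vs d \<eta> = 0)"
proof -
  \<comment> \<open>The element \<open>a\<close> keeps the set nonempty even if \<open>D\<close>
    contains nothing but 0.\<close>
  have "finite (insert a (D - {0}))" using D by simp
  then obtain c where c: "c \<in> insert a (D - {0})" "\<And>d. d \<in> insert a (D - {0}) \<Longrightarrow> d - c \<in> P"
    using positive_cone_minimum[OF cone, of "insert a (D - {0})"] by blast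
  have cP: "c \<in> P" "c \<noteq> 0" using c(1) a D by auto
  obtain \<eta> where \<eta>: "\<eta> \<in> K" "norm \<eta> = 1" "vs c \<eta> = 0"
    using nonunitary_kernel[OF cP(1) nu[OF cP]] by blast
  have "vs d \<eta> = 0" if "d \<in> D" "d \<noteq> 0" for d
    using vs_add[OF cP(1) c(2), of d \<eta>] that \<eta>(3) by (simp add: blinfun.zero_right)
  with \<eta> show ?thesis by blast
qed

text \<open>A vector killed by \<open>V_d\<^sup>*\<close> for finitely many \<open>d > 0\<close> behaves like the vacuum: it carries
  a copy of a finite piece of the regular (Toeplitz) representation.\<close>

lemma toeplitz_scalar_bound:
  fixes c h :: "_ \<Rightarrow> complex"
  assumes nu: "\<And>a. a \<in> P \<Longrightarrow> a \<noteq> 0 \<Longrightarrow> \<not> unitary_on K (V a)"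
    and nontrivial: "u \<in> P" "u \<noteq> 0"
    and I: "finite I" "\<And>i. i \<in> I \<Longrightarrow> a i \<in> P" "\<And>i. i \<in> I \<Longrightarrow> b i \<in> P"
    and bound: "\<And>x. x \<in> K \<Longrightarrow> norm (\<Sum>i\<in>I. c i *\<^sub>C v (a i) (vs (b i) x)) \<le> C * norm x"
    and F: "finite F" "\<And>y. y \<in> F \<Longrightarrow> t - y \<in> P" "\<And>y. y \<notin> F \<Longrightarrow> h y = 0"
    and M: "finite M" "\<And>y. y \<in> M \<Longrightarrow> t - y \<in> P"
  shows "(\<Sum>y\<in>M. (cmod (\<Sum>i\<in>I. if t - y - a i \<in> P then c i * h (y + a i - b i) else 0))\<^sup>2)
    \<le> C\<^sup>2 * (\<Sum>y\<in>F. (cmod (h y))\<^sup>2)"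
proof -
  define k where "k y = (\<Sum>i\<in>I. if t - y - a i \<in> P then c i * h (y + a i - b i) else 0)" for y
  \<comment> \<open>\<open>M\<close> together with all indices that images of the vectors
    \<open>X y\<close>, \<open>y \<in> F\<close>, can reach; the image of \<open>x\<close> is
    expanded over all of \<open>Y\<close> and restricted to \<open>M\<close> only at the
    end.\<close>
  define Y where "Y = M \<union> (\<Union>i\<in>I. (\<lambda>y. y + b i - a i) ` {y\<in>F. t - y - b i \<in> P})"
  have finY: "finite Y" unfolding Y_def using I(1) F(1) M(1) by auto
  have tY: "t - y \<in> P" if "y \<in> Y" for y
  proof -
    have "t - (y + b i - a i) \<in> P" if "i \<in> I" "t - y - b i \<in> P" for i y
      using positive_cone_add[OF cone that(2) I(2)[OF that(1)]] by (simp add: algebra_simps)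
    then show ?thesis using that M(2) by (auto simp: Y_def)
  qed
  \<comment> \<open>Differences of indices make the vectors \<open>X y\<close> orthogonal to each
    other; the elements \<open>b i - (t - y)\<close> make \<open>V_(b i)^* X y\<close> vanish as
    soon as \<open>b i\<close> exceeds \<open>t - y\<close>.\<close>
  define D where "D = ((\<lambda>(y, z). y - z) ` ((Y \<union> F) \<times> (Y \<union> F)) \<union> (\<lambda>(i, y). b i - (t - y)) ` (I \<times> F)) \<inter> P"
  have "finite D" "D \<subseteq> P" unfolding D_def using finY F(1) I(1) by auto
  then obtain \<eta> where \<eta>: "\<eta> \<in> K" "norm \<eta> = 1" and kill: "\<And>d. d \<in> D \<Longrightarrow> d \<noteq> 0 \<Longrightarrow> vs d \<eta> = 0"
    using common_kernel_vector[OF nu nontrivial] by metis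
  \<comment> \<open>\<open>X y\<close> plays the basis vector of the regular representation at
    \<open>t - y\<close>. With this reversed indexing \<open>V_a V_b^*\<close> moves
    \<open>X y\<close> to \<open>X (y + b - a)\<close>, and the cut-off for the result takes the
    form \<open>t - y - a \<in> P\<close>, as it will appear in a band with index
    \<open>t\<close>.\<close>
  define X where "X y = v (t - y) \<eta>" for y
  have normX: "norm (X y) = 1" if "y \<in> Y \<union> F" for y
    using that tY F(2) by (auto simp: X_def norm_v \<eta>)
  have orth_aux: "cinner (X y) (X z) = 0" if "y \<in> Y \<union> F" "z \<in> Y \<union> F" "y \<noteq> z" "z - y \<in> P" for y z
  proof -
    have tz: "t - z \<in> P" using that tY F(2) by blast
    have "(z, y) \<in> (Y \<union> F) \<times> (Y \<union> F)" using that by blast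
    then have "z - y \<in> (\<lambda>(y, z). y - z) ` ((Y \<union> F) \<times> (Y \<union> F))" by (rule rev_image_eqI) simp
    then have "z - y \<in> D" using that(4) unfolding D_def by blast
    then have "vs (z - y) \<eta> = 0" using kill that(3) by simp
    moreover have "X y = v (t - z) (v (z - y) \<eta>)"
      using v_add[OF tz that(4), of \<eta>] by (simp add: X_def)
    ultimately show ?thesis
      using cinner_v_v[OF tz v_mem[OF that(4)] \<eta>(1)] by (simp add: X_def cinner_v[OF that(4)])
  qed
  have orth: "cinner (X y) (X z) = 0" if "y \<in> Y \<union> F" "z \<in> Y \<union> F" "y \<noteq> z" for y z
  proof (cases "z - y \<in> P")
    case True
    with that show ?thesis by (rule orth_aux)
  next
    case False
    then have "cinner (X z) (X y) = 0" using orth_aux[of z y] that diff_mem[of z y] by simp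
    then show ?thesis by (rule cinner_eq_0_sym)
  qed
  have norm_comb: "(norm (\<Sum>y\<in>Z. g y *\<^sub>C X y))\<^sup>2 = (\<Sum>y\<in>Z. (cmod (g y))\<^sup>2)"
    if "finite Z" "Z \<subseteq> Y \<union> F" for g Z
  proof -
    have "(norm (\<Sum>y\<in>Z. g y *\<^sub>C X y))\<^sup>2 = (\<Sum>y\<in>Z. (norm (g y *\<^sub>C X y))\<^sup>2)"
      by (rule pythagoras_sum)
         (use that orth in \<open>simp_all add: cinner_scaleC_left cinner_scaleC_right subset_iff\<close>)
    also have "\<dots> = (\<Sum>y\<in>Z. (cmod (g y))\<^sup>2)"
      using that by (intro sum.cong) (auto simp: norm_scaleC normX subset_iff)
    finally show ?thesis .
  qed
  define x where "x = (\<Sum>y\<in>F. h y *\<^sub>C X y)"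
  have vX: "v (a i) (vs (b i) (X y)) = (if t - y - b i \<in> P then X (y + b i - a i) else 0)"
    if "i \<in> I" "y \<in> F" for i y
  proof (cases "t - y - b i \<in> P")
    case True
    have "X y = v (b i) (v (t - y - b i) \<eta>)"
      using v_add[OF I(3)[OF that(1)] True, of \<eta>] by (simp add: X_def)
    moreover have "X (y + b i - a i) = v (a i) (v (t - y - b i) \<eta>)"
      using v_add[OF I(2)[OF that(1)] True, of \<eta>] by (simp add: X_def algebra_simps)
    ultimately show ?thesis using True by (simp add: vs_v I(3)[OF that(1)] v_mem)
  next
    case False
    then have P: "b i - (t - y) \<in> P" using diff_mem by blast
    have ne: "b i - (t - y) \<noteq> 0" using False positive_cone_zero[OF cone] by auto
    have "(i, y) \<in> I \<times> F" using that by blast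
    then have "b i - (t - y) \<in> (\<lambda>(i, y). b i - (t - y)) ` (I \<times> F)" by (rule rev_image_eqI) simp
    then have "b i - (t - y) \<in> D" using P unfolding D_def by blast
    then have "vs (b i - (t - y)) \<eta> = 0" using kill ne by blast
    then have "vs (b i) (X y) = 0"
      using vs_add[OF F(2)[OF that(2)] P, of "X y"] by (simp add: X_def vs_v[OF F(2)[OF that(2)] \<eta>(1)])
    with False show ?thesis by (simp add: blinfun.zero_right)
  qed
  have "(\<Sum>i\<in>I. c i *\<^sub>C v (a i) (vs (b i) x)) =
      (\<Sum>i\<in>I. \<Sum>y\<in>F. (c i * h y) *\<^sub>C v (a i) (vs (b i) (X y)))"
    using I unfolding x_def
    by (intro sum.cong) (simp_all add: blinfun.sum_right clin_opD[OF clin_V]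
        clin_opD[OF clin_op_adj[OF clin_V]] scaleC_sum_right scaleC_scaleC)
  also have "\<dots> = (\<Sum>i\<in>I. \<Sum>y\<in>F. if t - y - b i \<in> P then (c i * h y) *\<^sub>C X (y + b i - a i) else 0)"
    by (intro sum.cong) (auto simp: vX)
  also have "\<dots> = (\<Sum>i\<in>I. \<Sum>y\<in>Y. if t - y - a i \<in> P then (c i * h (y + a i - b i)) *\<^sub>C X y else 0)"
  proof (rule sum.cong[OF refl])
    fix i assume i: "i \<in> I"
    \<comment> \<open>Substitution \<open>y \<mapsto> y + b i - a i\<close>. The discarded terms are
      zero: the cut-off fails, or the preimage lies outside \<open>F\<close>, where \<open>h\<close>
      vanishes.\<close>
    show "(\<Sum>y\<in>F. if t - y - b i \<in> P then (c i * h y) *\<^sub>C X (y + b i - a i) else 0) =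
        (\<Sum>y\<in>Y. if t - y - a i \<in> P then (c i * h (y + a i - b i)) *\<^sub>C X y else 0)"
    proof (rule sum.reindex_bij_witness_not_neutral[where i = "\<lambda>y. y + a i - b i"
          and j = "\<lambda>y. y + b i - a i" and S' = "{y\<in>F. t - y - b i \<notin> P}"
          and T' = "{y\<in>Y. t - y - a i \<notin> P \<or> y + a i - b i \<notin> F}"])
      have shift: "t - (y + b i - a i) - a i = t - y - b i" "t - (y + a i - b i) - b i = t - y - a i" for y
        by (simp_all add: algebra_simps)
      show "y + b i - a i \<in> Y - {y \<in> Y. t - y - a i \<notin> P \<or> y + a i - b i \<notin> F}"
        if "y \<in> F - {y \<in> F. t - y - b i \<notin> P}" for y
        using that i unfolding Y_def by (auto simp: shift)
      show "y + a i - b i \<in> F - {y \<in> F. t - y - b i \<notin> P}"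
        if "y \<in> Y - {y \<in> Y. t - y - a i \<notin> P \<or> y + a i - b i \<notin> F}" for y
        using that by (auto simp: shift)
      show "(if t - (y + b i - a i) - a i \<in> P then (c i * h (y + b i - a i + a i - b i)) *\<^sub>C X (y + b i - a i) else 0)
        = (if t - y - b i \<in> P then (c i * h y) *\<^sub>C X (y + b i - a i) else 0)" for y
        by (simp add: shift)
    qed (use finY F in auto)
  qed
  also have "\<dots> = (\<Sum>y\<in>Y. k y *\<^sub>C X y)"
    unfolding k_def scaleC_sum_left by (subst sum.swap) (intro sum.cong; auto)
  finally have img: "(\<Sum>i\<in>I. c i *\<^sub>C v (a i) (vs (b i) x)) = (\<Sum>y\<in>Y. k y *\<^sub>C X y)" .
  have "x \<in> K"
  proof -
    have "(\<Sum>y\<in>Z. h y *\<^sub>C X y) \<in> K" if "finite Z" "Z \<subseteq> F" for Z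
      using that by (induction Z) (auto simp: X_def closed_csubspaceD[OF K] v_mem F)
    then show ?thesis using F(1) by (simp add: x_def)
  qed
  have "(\<Sum>y\<in>M. (cmod (k y))\<^sup>2) \<le> (\<Sum>y\<in>Y. (cmod (k y))\<^sup>2)"
    using finY by (intro sum_mono2) (auto simp: Y_def)
  also have "\<dots> = (norm (\<Sum>y\<in>Y. k y *\<^sub>C X y))\<^sup>2"
    using finY by (simp add: norm_comb)
  also have "\<dots> \<le> (C * norm x)\<^sup>2"
    unfolding img[symmetric] using bound[OF \<open>x \<in> K\<close>] by (intro power_mono) auto
  also have "\<dots> = C\<^sup>2 * (\<Sum>y\<in>F. (cmod (h y))\<^sup>2)"
    unfolding power_mult_distrib x_def using F(1) by (simp add: norm_comb)
  finally show ?thesis by (simp add: k_def)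
qed

text \<open>The scalar bound is applied to each coordinate of \<open>h\<close> in a finite
  orthonormal system. Both sides split as sums over coordinates, so the constant \<open>C\<close> is
  unchanged, whatever Hilbert space \<open>h\<close> takes its values in.\<close>

lemma toeplitz_vector_bound:
  fixes h :: "'g \<Rightarrow> 'k::chilbert_space" and c :: "'i \<Rightarrow> complex"
  assumes nu: "\<And>a. a \<in> P \<Longrightarrow> a \<noteq> 0 \<Longrightarrow> \<not> unitary_on K (V a)"
    and nontrivial: "u \<in> P" "u \<noteq> 0"
    and I: "finite I" "\<And>i. i \<in> I \<Longrightarrow> a i \<in> P" "\<And>i. i \<in> I \<Longrightarrow> b i \<in> P"
    and bound: "\<And>x. x \<in> K \<Longrightarrow> norm (\<Sum>i\<in>I. c i *\<^sub>C v (a i) (vs (b i) x)) \<le> C * norm x"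
    and F: "finite F" "\<And>y. y \<in> F \<Longrightarrow> t - y \<in> P" "\<And>y. y \<notin> F \<Longrightarrow> h y = 0"
    and M: "finite M" "\<And>y. y \<in> M \<Longrightarrow> t - y \<in> P"
  shows "(\<Sum>y\<in>M. (norm (\<Sum>i\<in>I. if t - y - a i \<in> P then c i *\<^sub>C h (y + a i - b i) else 0))\<^sup>2)
    \<le> C\<^sup>2 * (\<Sum>y\<in>F. (norm (h y))\<^sup>2)"
proof -
  obtain B where B: "finite B" "\<And>e f. e \<in> B \<Longrightarrow> f \<in> B \<Longrightarrow> cinner e f = (if e = f then 1 else 0)"
    and hF: "\<And>x. x \<in> h ` F \<Longrightarrow> x = (\<Sum>e\<in>B. cinner x e *\<^sub>C e)"
    using gram_schmidt[OF finite_imageI[OF F(1)], of h] by metis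
  have h: "h y = (\<Sum>e\<in>B. cinner (h y) e *\<^sub>C e)" for y
    using hF[of "h y"] F(3)[of y] by (cases "y \<in> F") auto
  define k where "k y = (\<Sum>i\<in>I. if t - y - a i \<in> P then c i *\<^sub>C h (y + a i - b i) else 0)" for y
  have ck: "cinner (k y) e = (\<Sum>i\<in>I. if t - y - a i \<in> P then c i * cinner (h (y + a i - b i)) e else 0)"
    for y e
    unfolding k_def cinner_sum_left by (intro sum.cong) (auto simp: cinner_scaleC_left)
  have k: "k y = (\<Sum>e\<in>B. cinner (k y) e *\<^sub>C e)" for y
  proof -
    have "(\<Sum>e\<in>B. cinner (k y) e *\<^sub>C e) = (\<Sum>i\<in>I. \<Sum>e\<in>B.
        (if t - y - a i \<in> P then c i * cinner (h (y + a i - b i)) e else 0) *\<^sub>C e)"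
      unfolding ck scaleC_sum_left by (rule sum.swap)
    also have "\<dots> = k y"
      unfolding k_def
    proof (intro sum.cong refl)
      fix i
      show "(\<Sum>e\<in>B. (if t - y - a i \<in> P then c i * cinner (h (y + a i - b i)) e else 0) *\<^sub>C e) =
          (if t - y - a i \<in> P then c i *\<^sub>C h (y + a i - b i) else 0)"
        by (subst (2) h) (simp add: scaleC_sum_right scaleC_scaleC)
    qed
    finally show ?thesis by simp
  qed
  have "(\<Sum>y\<in>M. (norm (k y))\<^sup>2) = (\<Sum>y\<in>M. \<Sum>e\<in>B. (cmod (cinner (k y) e))\<^sup>2)"
    using parseval_finite[OF B(1) B(2) k] by simp
  also have "\<dots> = (\<Sum>e\<in>B. \<Sum>y\<in>M. (cmod (cinner (k y) e))\<^sup>2)" by (rule sum.swap)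
  also have "\<dots> \<le> (\<Sum>e\<in>B. C\<^sup>2 * (\<Sum>y\<in>F. (cmod (cinner (h y) e))\<^sup>2))"
    unfolding ck
    by (intro sum_mono toeplitz_scalar_bound[OF nu nontrivial I bound])
       (use F M in auto)
  also have "\<dots> = C\<^sup>2 * (\<Sum>y\<in>F. \<Sum>e\<in>B. (cmod (cinner (h y) e))\<^sup>2)"
    unfolding sum_distrib_left[symmetric] by (subst sum.swap) (rule refl)
  also have "\<dots> = C\<^sup>2 * (\<Sum>y\<in>F. (norm (h y))\<^sup>2)"
    using parseval_finite[OF B(1) B(2) h] by simp
  finally show ?thesis by (simp add: k_def)
qed

abbreviation Q :: "'g \<Rightarrow> 'h \<Rightarrow> 'h" where "Q y \<equiv> blinfun_apply (E y y)"

lemma Q_Q_ge: "y \<in> P \<Longrightarrow> z - y \<in> P \<Longrightarrow> Q y (Q z x) = Q z x"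
  and Q_Q_le: "y \<in> P \<Longrightarrow> z - y \<in> P \<Longrightarrow> Q z (Q y x) = Q z x"
  using range_proj_commute_aux by (metis blinfun_apply_blinfun_compose)+

lemma cinner_Q: "y \<in> P \<Longrightarrow> cinner (Q y x) z = cinner x (Q y z)"
  by (simp add: E_apply cinner_v cinner_vs)

text \<open>The projections \<open>D y\<close> cut out the bands of the decreasing chain \<open>Q\<close> over \<open>F\<close>.\<close>

lemma band_projections:
  assumes "finite F" "F \<subseteq> P"
  shows "\<exists>D :: 'g \<Rightarrow> 'h \<Rightarrow>\<^sub>L 'h. (\<forall>y. clin_op (D y)) \<and>
    (\<forall>y\<in>F. \<forall>z\<in>F. \<forall>x. blinfun_apply (D y) (Q z x) = (if y - z \<in> P then blinfun_apply (D y) x else 0)) \<and>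
    (\<forall>z\<in>F. \<forall>x. (norm (Q z x))\<^sup>2 = (\<Sum>y\<in>F. (norm (blinfun_apply (D y) (Q z x)))\<^sup>2))"
  using assms
proof (induction "card F" arbitrary: F)
  case 0
  then have "F = {}" by simp
  moreover have "clin_op (0 :: 'h \<Rightarrow>\<^sub>L 'h)" by (simp add: clin_op_def)
  ultimately show ?case by (intro exI[of _ "\<lambda>_. 0"]) simp
next
  case (Suc n)
  then have "F \<noteq> {}" by auto
  then obtain m where m: "m \<in> F" "\<And>z. z \<in> F \<Longrightarrow> z - m \<in> P"
    using positive_cone_minimum[OF cone Suc.prems(1)] by blast
  have mP: "m \<in> P" using m Suc.prems by blast
  define F' where "F' = F - {m}"
  have F: "F = insert m F'" "m \<notin> F'" "finite F'" "F' \<subseteq> P" "card F' = n"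
    using m Suc by (auto simp: F'_def)
  from Suc(1)[OF F(5)[symmetric] F(3,4)] obtain D :: "'g \<Rightarrow> 'h \<Rightarrow>\<^sub>L 'h" where clin: "\<And>y. clin_op (D y)"
    and DQ: "\<And>y z x. y \<in> F' \<Longrightarrow> z \<in> F' \<Longrightarrow>
        blinfun_apply (D y) (Q z x) = (if y - z \<in> P then blinfun_apply (D y) x else 0)"
    and nD: "\<And>z x. z \<in> F' \<Longrightarrow> (norm (Q z x))\<^sup>2 = (\<Sum>y\<in>F'. (norm (blinfun_apply (D y) (Q z x)))\<^sup>2)"
    by metis
  have P0: "0 \<in> P" by (rule positive_cone_zero[OF cone])
  \<comment> \<open>The band of the least element \<open>m\<close>: what remains of the range of
    \<open>Q m\<close> after removing the range of \<open>Q l\<close>, where \<open>l\<close> is the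
    next element of \<open>F\<close>; if there is none, all of the range of
    \<open>Q m\<close>.\<close>
  obtain R where R: "clin_op R" "\<And>x. R (Q m x) = R x" "\<And>z x. z \<in> F' \<Longrightarrow> R (Q z x) = 0"
    "\<And>x. (norm (Q m x))\<^sup>2 = (norm (R x))\<^sup>2 + (\<Sum>y\<in>F'. (norm (blinfun_apply (D y) x))\<^sup>2)"
  proof (cases "F' = {}")
    case True
    show thesis
      by (rule that[of "E m m"])
         (use True mP P0 in \<open>auto simp: Q_Q_ge ops_clin_op[OF E_ops]\<close>)
  next
    case False
    then obtain l where l: "l \<in> F'" "\<And>z. z \<in> F' \<Longrightarrow> z - l \<in> P"
      using positive_cone_minimum[OF cone F(3)] by blast
    have lP: "l \<in> P" "l - m \<in> P" using l F m by auto
    show thesis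
    proof (rule that[of "E m m - E l l"])
      show "clin_op (E m m - E l l)" by (intro clin_op_diff ops_clin_op[OF E_ops] mP lP)
      show "blinfun_apply (E m m - E l l) (Q m x) = blinfun_apply (E m m - E l l) x" for x
        using mP lP P0 by (simp add: blinfun.diff_left Q_Q_ge Q_Q_le)
      show "blinfun_apply (E m m - E l l) (Q z x) = 0" if "z \<in> F'" for z x
        using mP lP l(2)[OF that] m(2)[of z] F(1) that by (simp add: blinfun.diff_left Q_Q_ge)
      show "(norm (Q m x))\<^sup>2 = (norm (blinfun_apply (E m m - E l l) x))\<^sup>2
          + (\<Sum>y\<in>F'. (norm (blinfun_apply (D y) x))\<^sup>2)" for x
      proof -
        have "cinner (Q m x - Q l x) (Q l x) = 0"
          using mP lP P0 by (simp add: cinner_diff_left cinner_Q Q_Q_ge)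
        from pythagoras[OF this] have "(norm (Q m x))\<^sup>2 = (norm (Q m x - Q l x))\<^sup>2 + (norm (Q l x))\<^sup>2"
          by simp
        also have "(norm (Q l x))\<^sup>2 = (\<Sum>y\<in>F'. (norm (blinfun_apply (D y) x))\<^sup>2)"
          unfolding nD[OF l(1)] using l by (intro sum.cong) (auto simp: DQ)
        finally show ?thesis by (simp add: blinfun.diff_left)
      qed
    qed
  qed
  \<comment> \<open>The old bands lie inside the range of \<open>Q m\<close>: \<open>D y\<close>
    absorbs \<open>Q y\<close>, and \<open>Q y\<close> absorbs \<open>Q m\<close>.\<close>
  have DQm: "blinfun_apply (D y) (Q m x) = blinfun_apply (D y) x" if "y \<in> F'" for y x
  proof -
    have "blinfun_apply (D y) (Q m x) = blinfun_apply (D y) (Q y (Q m x))"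
      using DQ[OF that that] P0 by simp
    also have "\<dots> = blinfun_apply (D y) (Q y x)"
      using Q_Q_le[OF mP m(2)] that F(1) by simp
    finally show ?thesis using DQ[OF that that] P0 by simp
  qed
  have notP: "m - z \<notin> P" if "z \<in> F'" for z
    using positive_cone_antisym[OF cone, of "m - z"] m(2)[of z] F(1,2) that by auto
  show ?case
  proof (rule exI[of _ "D(m := R)"], intro conjI ballI allI)
    show "clin_op ((D(m := R)) y)" for y using clin R(1) by simp
    show "blinfun_apply ((D(m := R)) y) (Q z x) =
        (if y - z \<in> P then blinfun_apply ((D(m := R)) y) x else 0)" if "y \<in> F" "z \<in> F" for y z x
      using that F(1,2) R(2,3) DQ DQm notP P0 m(2) by auto
    show "(norm (Q z x))\<^sup>2 = (\<Sum>y\<in>F. (norm (blinfun_apply ((D(m := R)) y) (Q z x)))\<^sup>2)"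
      if "z \<in> F" for z x
    proof -
      have "(\<Sum>y\<in>F. (norm (blinfun_apply ((D(m := R)) y) (Q z x)))\<^sup>2) =
          (norm (R (Q z x)))\<^sup>2 + (\<Sum>y\<in>F'. (norm (blinfun_apply (D y) (Q z x)))\<^sup>2)"
        using F(1-3) by (auto intro!: arg_cong2[where f = plus] sum.cong)
      moreover have "Q m (Q m x) = Q m x" using Q_Q_ge[OF mP] P0 by simp
      ultimately show ?thesis
        using that F(1,2) R(3) R(4)[of "Q m x"] nD[of z x] by auto
    qed
  qed
qed

end

text \<open>The dilated vectors \<open>V_y x\<close>, spread over a Folner set of \<open>y\<close> and cut into bands, turn
  the action on \<open>K\<close> into a direct sum of finite pieces of the regular representation.\<close>

lemma norm_comparison:
  fixes V W :: "'g::ab_group_add \<Rightarrow> 'h::chilbert_space \<Rightarrow>\<^sub>L 'h" and c :: "'i \<Rightarrow> complex"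
  assumes V: "conerep P K V" and W: "conerep P L W"
    and nu: "\<And>a. a \<in> P \<Longrightarrow> a \<noteq> 0 \<Longrightarrow> \<not> unitary_on L (W a)"
    and nontrivial: "u \<in> P" "u \<noteq> 0"
    and I: "finite I" "\<And>i. i \<in> I \<Longrightarrow> a i \<in> P" "\<And>i. i \<in> I \<Longrightarrow> b i \<in> P"
    and bound: "\<And>x. x \<in> L \<Longrightarrow> norm (\<Sum>i\<in>I. c i *\<^sub>C W (a i) (adj (W (b i)) x)) \<le> C * norm x"
    and C: "0 \<le> C" and x: "x \<in> K"
  shows "norm (\<Sum>i\<in>I. c i *\<^sub>C V (a i) (adj (V (b i)) x)) \<le> C * norm x"
proof -
  interpret V: conerep P K V by fact
  interpret W: conerep P L W by fact
  note P_add = positive_cone_add[OF V.cone] and P0 = positive_cone_zero[OF V.cone]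
  define p where "p = (\<Sum>i\<in>I. c i *\<^sub>C V.v (a i) (V.vs (b i) x))"
  have pK: "p \<in> K"
  proof -
    have "(\<Sum>i\<in>J. c i *\<^sub>C V.v (a i) (V.vs (b i) x)) \<in> K" if "finite J" "J \<subseteq> I" for J
      using that by (induction J) (auto simp: closed_csubspaceD[OF V.K] V.v_mem I)
    then show ?thesis using I(1) by (simp add: p_def)
  qed
  have main: "(norm p)\<^sup>2 \<le> (1 + \<epsilon>) * (C\<^sup>2 * (norm x)\<^sup>2)" if \<epsilon>: "\<epsilon> > 0" for \<epsilon> :: real
  proof -
    obtain A0 B0 where AB0: "finite B0" "A0 \<noteq> {}" "A0 \<subseteq> B0"
      "\<And>y d. y \<in> A0 \<Longrightarrow> d \<in> (\<lambda>i. a i - b i) ` I \<Longrightarrow> y + d \<in> B0"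
      "real (card B0) \<le> (1 + \<epsilon>) * real (card A0)"
      using abelian_Folner[OF finite_imageI[OF I(1)] \<epsilon>, of "\<lambda>i. a i - b i"] by metis
    \<comment> \<open>Subtracting the least element moves the Folner pair into \<open>P\<close>,
      where \<open>V y\<close> is an isometry; cardinalities and the step condition are translation
      invariant.\<close>
    obtain m where m: "\<And>y. y \<in> B0 \<Longrightarrow> y - m \<in> P"
      using positive_cone_minimum[OF V.cone AB0(1)] AB0(2,3) by blast
    define A B where "A = (\<lambda>y. y - m) ` A0" and "B = (\<lambda>y. y - m) ` B0"
    have card: "card A = card A0" "card B = card B0"
      unfolding A_def B_def by (auto intro!: card_image inj_onI)
    have AB: "finite B" "A \<subseteq> B" "finite A" "B \<subseteq> P"
      using AB0 m finite_subset[OF AB0(3,1)] by (auto simp: A_def B_def)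
    have step: "y + a i - b i \<in> B" if y: "y \<in> A" and i: "i \<in> I" for y i
    proof -
      obtain z where z: "z \<in> A0" "y = z - m" using y by (auto simp: A_def)
      have "z + (a i - b i) - m \<in> B" using AB0(4)[OF z(1) imageI[OF i]] by (simp add: B_def)
      then show ?thesis by (simp add: z algebra_simps)
    qed
    \<comment> \<open>Bands must resolve two kinds of range projections: those of \<open>V y\<close>
      with \<open>y \<in> B\<close>, to recover norms, and those at \<open>y + a i\<close>, which
      appear in \<open>vp\<close>.\<close>
    define F where "F = B \<union> (\<lambda>(y, i). y + a i) ` (A \<times> I)"
    have F: "finite F" "F \<subseteq> P" "B \<subseteq> F" "\<And>y i. y \<in> A \<Longrightarrow> i \<in> I \<Longrightarrow> y + a i \<in> F"
      using AB I P_add by (auto simp: F_def)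
    obtain D :: "'g \<Rightarrow> 'h \<Rightarrow>\<^sub>L 'h" where clin: "\<And>y. clin_op (D y)"
      and DQ: "\<And>y z x. y \<in> F \<Longrightarrow> z \<in> F \<Longrightarrow>
          D y (V.Q z x) = (if y - z \<in> P then blinfun_apply (D y) x else 0)"
      and nD: "\<And>z x. z \<in> F \<Longrightarrow> (norm (V.Q z x))\<^sup>2 = (\<Sum>y\<in>F. (norm (blinfun_apply (D y) (V.Q z x)))\<^sup>2)"
      using V.band_projections[OF F(1,2)] by metis
    have Qv: "V.Q y (V.v y z) = V.v y z" if "y \<in> P" "z \<in> K" for y z
      using that by (simp add: V.E_apply V.vs_v)
    have normv: "(norm z)\<^sup>2 = (\<Sum>j\<in>F. (norm (D j (V.v y z)))\<^sup>2)" if "y \<in> B" "z \<in> K" for y z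
    proof -
      have "y \<in> P" "y \<in> F" using that AB F by auto
      then show ?thesis using nD[of y "V.v y z"] that V.norm_v[of y z] Qv[of y z] by simp
    qed
    have D0: "D j (V.v y z) = 0" if "j \<in> F" "y \<in> B" "z \<in> K" "j - y \<notin> P" for j y z
    proof -
      have "y \<in> P" "y \<in> F" using that AB F by auto
      then show ?thesis using DQ[of j y "V.v y z"] that Qv[of y z] by simp
    qed
    \<comment> \<open>Key identity: \<open>V_(y+a)^* V_(y+a-b) = V_b^*\<close>, hence
      \<open>V_y V_a V_b^* x = Q_(y+a) V_(y+a-b) x\<close>. The adjoints disappear; what is left is
      a translation in \<open>y\<close> followed by a cut-off projection.\<close>
    have vp: "V.v y p = (\<Sum>i\<in>I. c i *\<^sub>C V.Q (y + a i) (V.v (y + a i - b i) x))" if y: "y \<in> A" for y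
    proof -
      have yP: "y \<in> P" using y AB by blast
      have "V.v y (V.v (a i) (V.vs (b i) x)) = V.Q (y + a i) (V.v (y + a i - b i) x)" if i: "i \<in> I" for i
      proof -
        have d: "y + a i - b i \<in> P" using step[OF y i] AB by blast
        have "V.vs (y + a i) (V.v (y + a i - b i) x) = V.vs (b i) x"
          using V.vs_add[OF d I(3)[OF i], of "V.v (y + a i - b i) x"] by (simp add: V.vs_v[OF d x])
        then show ?thesis using V.v_add[OF yP I(2)[OF i]] by (simp add: V.E_apply)
      qed
      then show ?thesis
        by (simp add: p_def blinfun.sum_right clin_opD[OF V.clin_V[OF yP]])
    qed
    define h where "h j y = (if y \<in> B \<and> j - y \<in> P then D j (V.v y x) else 0)" for j y
    \<comment> \<open>Inside band \<open>j\<close> the projection \<open>Q (y + a i)\<close> acts as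
      1 or 0 according to whether \<open>y + a i\<close> is at most \<open>j\<close>. This is the
      pattern of \<open>toeplitz_vector_bound\<close> with \<open>t = j\<close>.\<close>
    have Dp: "D j (V.v y p) = (\<Sum>i\<in>I. if j - y - a i \<in> P then c i *\<^sub>C h j (y + a i - b i) else 0)"
      if "j \<in> F" "y \<in> A" for j y
    proof -
      have "D j (V.Q (y + a i) (V.v (y + a i - b i) x)) =
          (if j - y - a i \<in> P then h j (y + a i - b i) else 0)" if i: "i \<in> I" for i
        using DQ[OF \<open>j \<in> F\<close> F(4)[OF \<open>y \<in> A\<close> i], of "V.v (y + a i - b i) x"]
          step[OF \<open>y \<in> A\<close> i] D0[OF \<open>j \<in> F\<close> step[OF \<open>y \<in> A\<close> i] x]
        by (simp add: h_def diff_diff_eq)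
      then show ?thesis
        unfolding vp[OF \<open>y \<in> A\<close>]
        unfolding blinfun.sum_right clin_opD[OF clin] by (intro sum.cong[OF refl]) simp
    qed
    \<comment> \<open>Each \<open>V y\<close> is isometric, so every \<open>y \<in> A\<close>
      contributes the same amount. Summing over bands, bounding each band and summing back leaves
      \<open>card B\<close> copies of the norm of \<open>x\<close>; the ratio of the two
      cardinalities is the only loss.\<close>
    have "real (card A) * (norm p)\<^sup>2 = (\<Sum>y\<in>A. \<Sum>j\<in>F. (norm (D j (V.v y p)))\<^sup>2)"
    proof -
      have "(\<Sum>j\<in>F. (norm (D j (V.v y p)))\<^sup>2) = (norm p)\<^sup>2" if "y \<in> A" for y
        using normv[OF _ pK, of y] that AB(2) by auto
      then show ?thesis by simp
    qed
    also have "\<dots> = (\<Sum>j\<in>F. \<Sum>y\<in>A. (norm (D j (V.v y p)))\<^sup>2)" by (rule sum.swap)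
    also have "\<dots> \<le> (\<Sum>j\<in>F. C\<^sup>2 * (\<Sum>y\<in>B. (norm (D j (V.v y x)))\<^sup>2))"
    proof (rule sum_mono)
      fix j assume j: "j \<in> F"
      have "(\<Sum>y\<in>A. (norm (D j (V.v y p)))\<^sup>2) = (\<Sum>y\<in>{y\<in>A. j - y \<in> P}. (norm (D j (V.v y p)))\<^sup>2)"
        using AB D0[OF j _ pK] by (intro sum.mono_neutral_right) auto
      also have "\<dots> = (\<Sum>y\<in>{y\<in>A. j - y \<in> P}.
          (norm (\<Sum>i\<in>I. if j - y - a i \<in> P then c i *\<^sub>C h j (y + a i - b i) else 0))\<^sup>2)"
        by (intro sum.cong) (auto simp: Dp j)
      also have "\<dots> \<le> C\<^sup>2 * (\<Sum>y\<in>{y\<in>B. j - y \<in> P}. (norm (h j y))\<^sup>2)"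
        by (rule W.toeplitz_vector_bound[OF nu nontrivial I bound])
           (use AB in \<open>auto simp: h_def\<close>)
      also have "(\<Sum>y\<in>{y\<in>B. j - y \<in> P}. (norm (h j y))\<^sup>2) = (\<Sum>y\<in>B. (norm (D j (V.v y x)))\<^sup>2)"
        using AB D0[OF j _ x] by (intro sum.mono_neutral_cong_left) (auto simp: h_def)
      finally show "(\<Sum>y\<in>A. (norm (D j (V.v y p)))\<^sup>2) \<le> C\<^sup>2 * (\<Sum>y\<in>B. (norm (D j (V.v y x)))\<^sup>2)" .
    qed
    also have "\<dots> = C\<^sup>2 * (\<Sum>y\<in>B. \<Sum>j\<in>F. (norm (D j (V.v y x)))\<^sup>2)"
      unfolding sum_distrib_left[symmetric] by (subst sum.swap) (rule refl)
    also have "\<dots> = C\<^sup>2 * (real (card B) * (norm x)\<^sup>2)"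
    proof -
      have "(\<Sum>j\<in>F. (norm (D j (V.v y x)))\<^sup>2) = (norm x)\<^sup>2" if "y \<in> B" for y
        using normv[OF that x] by simp
      then show ?thesis by simp
    qed
    also have "\<dots> \<le> C\<^sup>2 * (((1 + \<epsilon>) * real (card A)) * (norm x)\<^sup>2)"
      using AB0(5) card by (intro mult_left_mono mult_right_mono) auto
    finally have "real (card A) * (norm p)\<^sup>2 \<le> real (card A) * ((1 + \<epsilon>) * (C\<^sup>2 * (norm x)\<^sup>2))"
      by (simp add: mult_ac)
    moreover have "card A > 0" using AB AB0(2) by (simp add: card_gt_0_iff A_def)
    ultimately show ?thesis by simp
  qed
  have "(norm p)\<^sup>2 \<le> (C * norm x)\<^sup>2"
  proof (rule field_le_epsilon)
    fix e :: real assume e: "0 < e"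
    let ?M = "(C * norm x)\<^sup>2"
    \<comment> \<open>Dividing by \<open>?M + 1\<close> rather than \<open>?M\<close> covers
      \<open>?M = 0\<close> and keeps the error at most \<open>e\<close>.\<close>
    have "(norm p)\<^sup>2 \<le> (1 + e / (?M + 1)) * ?M"
      using main[of "e / (?M + 1)"] e by (simp add: power_mult_distrib add_nonneg_pos)
    also have "\<dots> = ?M + e * (?M / (?M + 1))" by (simp add: algebra_simps)
    also have "\<dots> \<le> ?M + e * 1"
      using e by (intro add_left_mono mult_left_mono) (auto simp: divide_le_eq_1 add_nonneg_pos)
    finally show "(norm p)\<^sup>2 \<le> ?M + e" by simp
  qed
  then have "norm p \<le> C * norm x" using C by (simp add: power2_le_iff_abs_le)
  then show ?thesis by (simp add: p_def)
qed

section \<open>The generated C*-algebras\<close>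

context isorep
begin

lemma star_subalgebra_contains_poly:
  assumes A: "star_subalgebra K \<A>" "V ` S \<subseteq> \<A>"
    and ps: "set ps \<subseteq> UNIV \<times> S \<times> S"
  shows "(\<Sum>(c, a, b)\<leftarrow>ps. cscale_op c (V a o\<^sub>L adj (V b))) \<in> \<A>"
  using ps
proof (induction ps)
  case Nil
  then show ?case using A by (simp add: star_subalgebra_def)
next
  case (Cons t ps)
  obtain c a b where t: "t = (c, a, b)" by (cases t) auto
  then have "V a \<in> \<A>" "adj (V b) \<in> \<A>" using Cons.prems A by (auto simp: star_subalgebra_def)
  then have "cscale_op c (V a o\<^sub>L adj (V b)) \<in> \<A>" using A(1) by (simp add: star_subalgebra_def)
  then show ?case using Cons A(1) t by (simp add: star_subalgebra_def)
qed

end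

section \<open>Formal polynomials and their closure\<close>

lemma list_triple_induct [case_names Nil Cons]:
  fixes ps :: "('a \<times> 'b \<times> 'c) list"
  assumes "\<Phi> []" "\<And>c a b ps. \<Phi> ps \<Longrightarrow> \<Phi> ((c, a, b) # ps)"
  shows "\<Phi> ps"
  by (induction ps) (use assms in auto)

context conerep
begin

text \<open>Polynomials are kept as lists of terms \<open>(c, a, b)\<close>, standing for
  \<open>c V_a V_b^*\<close>, so that one list can be evaluated in two representations. Validity and
  the list operations depend on \<open>P\<close> but not on the representation.\<close>

definition valid :: "(complex \<times> 'g \<times> 'g) list \<Rightarrow> bool" where
  "valid ps \<longleftrightarrow> set ps \<subseteq> UNIV \<times> P \<times> P"

definition poly :: "(complex \<times> 'g \<times> 'g) list \<Rightarrow> 'h \<Rightarrow>\<^sub>L 'h" where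
  "poly ps = (\<Sum>(c, a, b)\<leftarrow>ps. cscale_op c (E a b))"

definition pscale :: "complex \<Rightarrow> (complex \<times> 'g \<times> 'g) list \<Rightarrow> (complex \<times> 'g \<times> 'g) list" where
  "pscale d ps = map (\<lambda>(c, a, b). (d * c, a, b)) ps"

definition padj :: "(complex \<times> 'g \<times> 'g) list \<Rightarrow> (complex \<times> 'g \<times> 'g) list" where
  "padj ps = map (\<lambda>(c, a, b). (cnj c, b, a)) ps"

definition tmul :: "complex \<times> 'g \<times> 'g \<Rightarrow> complex \<times> 'g \<times> 'g \<Rightarrow> complex \<times> 'g \<times> 'g" where
  "tmul = (\<lambda>(c, a, b) (c', a', b').
     if a' - b \<in> P then (c * c', a + (a' - b), b') else (c * c', a, b' + (b - a')))"

definition pmul :: "(complex \<times> 'g \<times> 'g) list \<Rightarrow> (complex \<times> 'g \<times> 'g) list \<Rightarrow> (complex \<times> 'g \<times> 'g) list"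
  where "pmul ps qs = concat (map (\<lambda>s. map (tmul s) qs) ps)"

lemma poly_simps [simp]:
  "poly [] = 0" "poly ((c, a, b) # ps) = cscale_op c (E a b) + poly ps"
  "poly (ps @ qs) = poly ps + poly qs"
  by (simp_all add: poly_def)

lemma valid_simps [simp]:
  "valid []" "valid ((c, a, b) # ps) \<longleftrightarrow> a \<in> P \<and> b \<in> P \<and> valid ps"
  "valid (ps @ qs) \<longleftrightarrow> valid ps \<and> valid qs"
  by (auto simp: valid_def)

lemma poly_ops: "valid ps \<Longrightarrow> poly ps \<in> ops K"
  by (induction ps rule: list_triple_induct)
     (auto intro: ops_zero[OF K] ops_add[OF K] ops_cscale[OF K] E_ops)

lemma cscale_op_simps:
  "cscale_op c (A + B) = cscale_op c A + cscale_op c B"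
  "cscale_op c (cscale_op d A) = cscale_op (c * d) A"
  "cscale_op c (0 :: 'h \<Rightarrow>\<^sub>L 'h) = 0"
  "cscale_op c A o\<^sub>L B = cscale_op c (A o\<^sub>L B)"
  by (auto intro!: blinfun_eqI simp: cscale_op_apply blinfun.add_left scaleC_add_right scaleC_scaleC)

lemma compose_cscale_op: "clin_op A \<Longrightarrow> A o\<^sub>L cscale_op c B = cscale_op c (A o\<^sub>L B)"
  by (auto intro!: blinfun_eqI simp: cscale_op_apply clin_opD)

lemma poly_pscale: "poly (pscale d ps) = cscale_op d (poly ps)"
  by (induction ps rule: list_triple_induct) (simp_all add: pscale_def cscale_op_simps)

lemma valid_pscale: "valid ps \<Longrightarrow> valid (pscale d ps)"
  by (induction ps rule: list_triple_induct) (simp_all add: pscale_def)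

lemma poly_padj: "valid ps \<Longrightarrow> poly (padj ps) = adj (poly ps)"
proof (induction ps rule: list_triple_induct)
  case (Cons c a b ps)
  then have "a \<in> P" "b \<in> P" "valid ps" by simp_all
  moreover from this have "clin_op (cscale_op c (E a b))" "clin_op (poly ps)"
    by (auto intro: clin_op_cscale ops_clin_op E_ops poly_ops)
  ultimately show ?case
    using Cons.IH by (simp add: padj_def adj_add adj_cscale adj_E ops_clin_op[OF E_ops])
qed (simp add: padj_def adj_zero)

lemma valid_padj: "valid ps \<Longrightarrow> valid (padj ps)"
  by (induction ps rule: list_triple_induct) (simp_all add: padj_def)

lemma tmul:
  assumes "a \<in> P" "b \<in> P" "a' \<in> P" "b' \<in> P"
  shows "valid [tmul (c, a, b) (c', a', b')]"
    and "poly [tmul (c, a, b) (c', a', b')] = cscale_op c (E a b) o\<^sub>L cscale_op c' (E a' b')"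
  using assms positive_cone_add[OF cone] diff_mem[of a' b]
  by (auto simp: tmul_def cscale_op_simps compose_cscale_op ops_clin_op[OF E_ops]
      E_compose_ge E_compose_le mult.commute)

lemma pmul_aux:
  assumes "valid qs" "a \<in> P" "b \<in> P"
  shows "valid (map (tmul (c, a, b)) qs)"
    and "poly (map (tmul (c, a, b)) qs) = cscale_op c (E a b) o\<^sub>L poly qs"
proof -
  have "valid (map (tmul (c, a, b)) qs) \<and>
      poly (map (tmul (c, a, b)) qs) = cscale_op c (E a b) o\<^sub>L poly qs"
    using assms(1)
  proof (induction qs rule: list_triple_induct)
    case (Cons c' a' b' qs)
    then have qs: "a' \<in> P" "b' \<in> P" "valid qs" by simp_all
    note t = tmul[OF assms(2,3) qs(1,2), of c c']
    have "valid ([tmul (c, a, b) (c', a', b')] @ map (tmul (c, a, b)) qs)"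
      unfolding valid_simps(3) using t(1) Cons.IH qs(3) by blast
    moreover have "poly ([tmul (c, a, b) (c', a', b')] @ map (tmul (c, a, b)) qs) =
        cscale_op c (E a b) o\<^sub>L (cscale_op c' (E a' b') + poly qs)"
      unfolding poly_simps(3) t(2) bounded_bilinear.add_right[OF bounded_bilinear_blinfun_compose]
      using Cons.IH qs(3) by simp
    ultimately show ?case by simp
  qed (simp add: bounded_bilinear.zero_right[OF bounded_bilinear_blinfun_compose])
  then show "valid (map (tmul (c, a, b)) qs)"
    "poly (map (tmul (c, a, b)) qs) = cscale_op c (E a b) o\<^sub>L poly qs" by auto
qed

lemma valid_pmul: "valid ps \<Longrightarrow> valid qs \<Longrightarrow> valid (pmul ps qs)"
  by (induction ps rule: list_triple_induct) (simp_all add: pmul_def pmul_aux)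

lemma poly_pmul: "valid ps \<Longrightarrow> valid qs \<Longrightarrow> poly (pmul ps qs) = poly ps o\<^sub>L poly qs"
  by (induction ps rule: list_triple_induct)
     (simp_all add: pmul_def pmul_aux bounded_bilinear.zero_left[OF bounded_bilinear_blinfun_compose]
       bounded_bilinear.add_left[OF bounded_bilinear_blinfun_compose])

lemma poly_diff: "poly ps - poly qs = poly (ps @ pscale (-1) qs)"
proof -
  have "cscale_op (-1) A = - A" for A :: "'h \<Rightarrow>\<^sub>L 'h"
    by (rule blinfun_eqI) (simp add: cscale_op_apply scaleC_minus1 blinfun.minus_left)
  then show ?thesis by (simp add: poly_pscale)
qed

lemma poly_generator: "a \<in> P \<Longrightarrow> poly [(1, a, 0)] = V a" "a \<in> P \<Longrightarrow> valid [(1, a, 0)]"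
proof -
  have "cscale_op 1 A = A" for A :: "'h \<Rightarrow>\<^sub>L 'h"
    by (rule blinfun_eqI) (simp add: cscale_op_apply)
  then show "a \<in> P \<Longrightarrow> poly [(1, a, 0)] = V a" "a \<in> P \<Longrightarrow> valid [(1, a, 0)]"
    using zero_mem by (simp_all add: V_eq_E)
qed

lemma poly_apply:
  "blinfun_apply (poly ps) x =
    (\<Sum>i<length ps. fst (ps ! i) *\<^sub>C v (fst (snd (ps ! i))) (vs (snd (snd (ps ! i))) x))"
proof (induction ps rule: list_triple_induct)
  case (Cons c a b ps)
  then show ?case
    by (simp add: sum.lessThan_Suc_shift blinfun.add_left cscale_op_apply E_apply del: sum.lessThan_Suc)
qed simp

lemma closure_poly_iff:
  "A \<in> closure (poly ` Collect valid) \<longleftrightarrow>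
    (\<exists>s. (\<forall>n::nat. valid (s n)) \<and> (\<lambda>n. poly (s n)) \<longlonglongrightarrow> A)"
proof
  assume "A \<in> closure (poly ` Collect valid)"
  then obtain f where f: "\<And>n. f n \<in> poly ` Collect valid" "f \<longlonglongrightarrow> A"
    unfolding closure_sequential by blast
  then have "\<forall>n. \<exists>ps. valid ps \<and> f n = poly ps" by blast
  then obtain s where s: "\<And>n. valid (s n)" "\<And>n. f n = poly (s n)" by metis
  then have "f = (\<lambda>n. poly (s n))" by auto
  with f(2) s(1) show "\<exists>s. (\<forall>n. valid (s n)) \<and> (\<lambda>n. poly (s n)) \<longlonglongrightarrow> A" by blast
next
  assume "\<exists>s. (\<forall>n::nat. valid (s n)) \<and> (\<lambda>n. poly (s n)) \<longlonglongrightarrow> A"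
  then obtain s where "\<And>n::nat. valid (s n)" "(\<lambda>n. poly (s n)) \<longlonglongrightarrow> A" by blast
  then show "A \<in> closure (poly ` Collect valid)"
    unfolding closure_sequential by (intro exI[of _ "\<lambda>n. poly (s n)"]) auto
qed

text \<open>By the bicyclic relations the evaluated polynomials already form a *-algebra, so a
  single norm closure reaches the generated C*-algebra; the operations pass to limits by
  continuity.\<close>

lemma cstar_gen_eq: "cstar_gen K (V ` P) = closure (poly ` Collect valid)"
proof
  let ?A = "closure (poly ` Collect valid)"
  note seq = closure_poly_iff
  have opsA: "A \<in> ops K" if "A \<in> ?A" for A
    using that unfolding seq by (blast intro: ops_limit[OF K poly_ops])
  have "star_subalgebra K ?A"
    unfolding star_subalgebra_def
  proof (intro conjI ballI allI)
    show "?A \<subseteq> ops K" using opsA by blast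
    have "0 \<in> poly ` Collect valid" by (rule image_eqI[of _ _ "[]"]) simp_all
    then show "0 \<in> ?A" by (rule subsetD[OF closure_subset])
    fix A assume A: "A \<in> ?A"
    then obtain s where s: "\<And>n::nat. valid (s n)" "(\<lambda>n. poly (s n)) \<longlonglongrightarrow> A" unfolding seq by blast
    show "adj A \<in> ?A"
      unfolding seq
    proof (intro exI[of _ "\<lambda>n. padj (s n)"] conjI allI)
      show "(\<lambda>n. poly (padj (s n))) \<longlonglongrightarrow> adj A"
        using tendsto_adj[OF ops_clin_op[OF poly_ops] ops_clin_op[OF opsA[OF A]] s(2)] s(1)
        by (simp add: poly_padj)
    qed (simp add: valid_padj s)
    show "cscale_op c A \<in> ?A" for c
      unfolding seq
    proof (intro exI[of _ "\<lambda>n. pscale c (s n)"] conjI allI)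
      show "(\<lambda>n. poly (pscale c (s n))) \<longlonglongrightarrow> cscale_op c A"
        using tendsto_cscale_op[OF s(2)] by (simp add: poly_pscale)
    qed (simp add: valid_pscale s)
    fix B assume B: "B \<in> ?A"
    then obtain r where r: "\<And>n::nat. valid (r n)" "(\<lambda>n. poly (r n)) \<longlonglongrightarrow> B" unfolding seq by blast
    show "A + B \<in> ?A"
      unfolding seq
    proof (intro exI[of _ "\<lambda>n. s n @ r n"] conjI allI)
      show "(\<lambda>n. poly (s n @ r n)) \<longlonglongrightarrow> A + B" using tendsto_add[OF s(2) r(2)] by simp
    qed (simp add: s r)
    show "A o\<^sub>L B \<in> ?A"
      unfolding seq
    proof (intro exI[of _ "\<lambda>n. pmul (s n) (r n)"] conjI allI)
      show "(\<lambda>n. poly (pmul (s n) (r n))) \<longlonglongrightarrow> (A o\<^sub>L B)"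
        using bounded_bilinear.tendsto[OF bounded_bilinear_blinfun_compose s(2) r(2)] s(1) r(1)
        by (simp add: poly_pmul)
    qed (simp add: valid_pmul s r)
  qed
  moreover have "V ` P \<subseteq> ?A"
  proof
    fix A assume "A \<in> V ` P"
    then obtain a where "a \<in> P" "A = V a" by blast
    then have "A \<in> poly ` Collect valid"
      using poly_generator by (intro image_eqI[of _ _ "[(1, a, 0)]"]) simp_all
    then show "A \<in> ?A" by (rule subsetD[OF closure_subset])
  qed
  ultimately show "cstar_gen K (V ` P) \<subseteq> ?A" unfolding cstar_gen_def by blast
  show "?A \<subseteq> cstar_gen K (V ` P)"
    unfolding cstar_gen_def
  proof (rule Inter_greatest)
    fix \<A> assume "\<A> \<in> {\<A>. star_subalgebra K \<A> \<and> closed \<A> \<and> V ` P \<subseteq> \<A>}"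
    then have A: "star_subalgebra K \<A>" "closed \<A>" "V ` P \<subseteq> \<A>" by auto
    have "poly ` Collect valid \<subseteq> \<A>"
      using star_subalgebra_contains_poly[OF A(1,3)] by (auto simp: poly_def E_def valid_def)
    then show "?A \<subseteq> \<A>" using A(2) by (rule closure_minimal)
  qed
qed

lemma cstar_gen_iff:
  "A \<in> cstar_gen K (V ` P) \<longleftrightarrow> (\<exists>s. (\<forall>n::nat. valid (s n)) \<and> (\<lambda>n. poly (s n)) \<longlonglongrightarrow> A)"
  unfolding cstar_gen_eq by (rule closure_poly_iff)

end

section \<open>The canonical isomorphism between two representations of the cone\<close>

locale conerep_pair = V: conerep P K V + W: conerep P L W
  for P :: "'g::ab_group_add set" and K :: "'h::chilbert_space set" and V
    and L :: "'h set" and W +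
  fixes u :: 'g
  assumes nuV: "\<And>a. a \<in> P \<Longrightarrow> a \<noteq> 0 \<Longrightarrow> \<not> unitary_on K (V a)"
    and nuW: "\<And>a. a \<in> P \<Longrightarrow> a \<noteq> 0 \<Longrightarrow> \<not> unitary_on L (W a)"
    and nontrivial: "u \<in> P" "u \<noteq> 0"
begin

text \<open>\<open>norm_comparison\<close> with the operator norm of \<open>W.poly ps\<close> as
  constant. Non-unitarity of \<open>W\<close> drives this inequality, that of \<open>V\<close> the
  reverse one obtained through \<open>swap\<close>.\<close>

lemma norm_poly_le:
  assumes ps: "V.valid ps"
  shows "norm (V.poly ps) \<le> norm (W.poly ps)"
proof (rule norm_blinfun_bound)
  fix x
  have mem: "fst (snd (ps ! i)) \<in> P" "snd (snd (ps ! i)) \<in> P" if "i \<in> {..<length ps}" for i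
  proof -
    have "ps ! i \<in> UNIV \<times> P \<times> P" using ps nth_mem[of i ps] that unfolding V.valid_def by blast
    then show "fst (snd (ps ! i)) \<in> P" "snd (snd (ps ! i)) \<in> P" by auto
  qed
  have "norm (blinfun_apply (V.poly ps) x) = norm (blinfun_apply (V.poly ps) (cproj K x))"
    by (simp add: ops_cproj[OF V.K V.poly_ops[OF ps]])
  also have "\<dots> \<le> norm (W.poly ps) * norm (cproj K x)"
    unfolding V.poly_apply
    by (rule norm_comparison[OF V.conerep_axioms W.conerep_axioms nuW nontrivial finite_lessThan
          mem _ norm_ge_zero cproj_mem[OF V.K]])
       (simp_all add: W.poly_apply[symmetric] norm_blinfun)
  also have "\<dots> \<le> norm (W.poly ps) * norm x"
    by (intro mult_left_mono norm_cproj_le[OF V.K] norm_ge_zero)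
  finally show "norm (blinfun_apply (V.poly ps) x) \<le> norm (W.poly ps) * norm x" .
qed simp

lemma swap: "conerep_pair P L W K V u"
  by unfold_locales (use nuV nuW nontrivial in auto)

lemma norm_poly_eq:
  assumes "V.valid ps"
  shows "norm (W.poly ps) = norm (V.poly ps)"
  using norm_poly_le[OF assms] conerep_pair.norm_poly_le[OF swap assms] by (rule antisym[rotated])

text \<open>The graph of the isomorphism: pairs of limits of the same sequence of lists. It becomes
  a function once \<open>R_unique\<close> shows that the sequence does not matter.\<close>

definition R :: "('h \<Rightarrow>\<^sub>L 'h) \<Rightarrow> ('h \<Rightarrow>\<^sub>L 'h) \<Rightarrow> bool" where
  "R A B \<longleftrightarrow> (\<exists>s. (\<forall>n::nat. V.valid (s n)) \<and> (\<lambda>n. V.poly (s n)) \<longlonglongrightarrow> A \<and> (\<lambda>n. W.poly (s n)) \<longlonglongrightarrow> B)"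

text \<open>Equality of polynomial norms transfers the Cauchy property from \<open>V\<close> to
  \<open>W\<close>.\<close>

lemma R_ex:
  assumes "A \<in> cstar_gen K (V ` P)"
  shows "\<exists>B. R A B"
proof -
  obtain s where s: "\<And>n::nat. V.valid (s n)" "(\<lambda>n. V.poly (s n)) \<longlonglongrightarrow> A"
    using assms unfolding V.cstar_gen_iff by blast
  have "norm (W.poly (s m) - W.poly (s n)) = norm (V.poly (s m) - V.poly (s n))" for m n
    unfolding V.poly_diff W.poly_diff
    by (rule norm_poly_eq) (simp add: s V.valid_pscale)
  then have "Cauchy (\<lambda>n. W.poly (s n))"
    using LIMSEQ_imp_Cauchy[OF s(2)] by (simp add: Cauchy_def dist_norm)
  then obtain B where "(\<lambda>n. W.poly (s n)) \<longlonglongrightarrow> B" using Cauchy_convergent_iff convergent_def by blast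
  with s show ?thesis unfolding R_def by blast
qed

lemma R_mem: "R A B \<Longrightarrow> A \<in> cstar_gen K (V ` P)" "R A B \<Longrightarrow> B \<in> cstar_gen L (W ` P)"
  unfolding R_def V.cstar_gen_iff W.cstar_gen_iff by blast+

lemma R_unique:
  assumes "R A B" "R A B'"
  shows "B = B'"
proof -
  obtain s where s: "\<And>n::nat. V.valid (s n)" "(\<lambda>n. V.poly (s n)) \<longlonglongrightarrow> A" "(\<lambda>n. W.poly (s n)) \<longlonglongrightarrow> B"
    using assms(1) unfolding R_def by blast
  obtain r where r: "\<And>n::nat. V.valid (r n)" "(\<lambda>n. V.poly (r n)) \<longlonglongrightarrow> A" "(\<lambda>n. W.poly (r n)) \<longlonglongrightarrow> B'"
    using assms(2) unfolding R_def by blast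
  have eq: "norm (W.poly (s n) - W.poly (r n)) = norm (V.poly (s n) - V.poly (r n))" for n
    unfolding V.poly_diff W.poly_diff
    by (rule norm_poly_eq) (simp add: s r V.valid_pscale)
  have "(\<lambda>n. norm (V.poly (s n) - V.poly (r n))) \<longlonglongrightarrow> norm (A - A)"
    by (intro tendsto_norm tendsto_diff s r)
  moreover have "(\<lambda>n. norm (W.poly (s n) - W.poly (r n))) \<longlonglongrightarrow> norm (B - B')"
    by (intro tendsto_norm tendsto_diff s r)
  ultimately have "norm (B - B') = norm (A - A)" unfolding eq by (rule LIMSEQ_unique[rotated])
  then show ?thesis by simp
qed

lemma R_swap: "R A B = conerep_pair.R P W V B A"
  unfolding R_def conerep_pair.R_def[OF swap] by blast

text \<open>\<open>R\<close> is symmetric under exchanging the representations, so uniqueness and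
  existence on the other side give injectivity and surjectivity. For the algebraic laws, the
  operation is carried out on lists and both limits are taken along the same lists.\<close>

lemma canonically_isomorphic: "canonically_isomorphic P (K, V) (L, W)"
proof -
  define \<phi> where "\<phi> A = (THE B. R A B)" for A
  have \<phi>I: "\<phi> A = B" if "R A B" for A B
    unfolding \<phi>_def using that R_unique by blast
  have R\<phi>: "R A (\<phi> A)" if "A \<in> cstar_gen K (V ` P)" for A
    using R_ex[OF that] \<phi>I by metis
  have "star_isomorphism (cstar_gen K (V ` P)) (cstar_gen L (W ` P)) \<phi>"
    unfolding star_isomorphism_def
  proof (intro conjI ballI allI)
    show "bij_betw \<phi> (cstar_gen K (V ` P)) (cstar_gen L (W ` P))"
      unfolding bij_betw_def
    proof
      show "inj_on \<phi> (cstar_gen K (V ` P))"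
      proof (rule inj_onI)
        fix A B assume AB: "A \<in> cstar_gen K (V ` P)" "B \<in> cstar_gen K (V ` P)" "\<phi> A = \<phi> B"
        then have "R A (\<phi> A)" "R B (\<phi> A)" using R\<phi>[OF AB(1)] R\<phi>[OF AB(2)] by auto
        then show "A = B" using conerep_pair.R_unique[OF swap] unfolding R_swap by blast
      qed
      have "B \<in> \<phi> ` cstar_gen K (V ` P)" if B: "B \<in> cstar_gen L (W ` P)" for B
      proof -
        obtain A where "R A B" using conerep_pair.R_ex[OF swap B] R_swap by blast
        then show ?thesis using R_mem(1) \<phi>I by blast
      qed
      moreover have "\<phi> A \<in> cstar_gen L (W ` P)" if "A \<in> cstar_gen K (V ` P)" for A
        using R_mem(2)[OF R\<phi>[OF that]] .
      ultimately show "\<phi> ` cstar_gen K (V ` P) = cstar_gen L (W ` P)" by blast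
    qed
    fix A assume A: "A \<in> cstar_gen K (V ` P)"
    from R\<phi>[OF A] obtain s where s: "\<And>n::nat. V.valid (s n)" "(\<lambda>n. V.poly (s n)) \<longlonglongrightarrow> A"
      "(\<lambda>n. W.poly (s n)) \<longlonglongrightarrow> \<phi> A" unfolding R_def by blast
    have clin: "clin_op A" "clin_op (\<phi> A)"
      using ops_limit[OF V.K V.poly_ops[OF s(1)] s(2)] ops_limit[OF W.K W.poly_ops[OF s(1)] s(3)]
      by (simp_all add: ops_clin_op)
    show "\<phi> (adj A) = adj (\<phi> A)"
    proof (rule \<phi>I, unfold R_def, intro exI[of _ "\<lambda>n. V.padj (s n)"] conjI allI)
      show "(\<lambda>n. V.poly (V.padj (s n))) \<longlonglongrightarrow> adj A"
        using tendsto_adj[OF ops_clin_op[OF V.poly_ops] clin(1) s(2)] s(1) by (simp add: V.poly_padj)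
      show "(\<lambda>n. W.poly (V.padj (s n))) \<longlonglongrightarrow> adj (\<phi> A)"
        using tendsto_adj[OF ops_clin_op[OF W.poly_ops] clin(2) s(3)] s(1) by (simp add: W.poly_padj)
    qed (simp add: V.valid_padj s)
    show "\<phi> (cscale_op c A) = cscale_op c (\<phi> A)" for c
    proof (rule \<phi>I, unfold R_def, intro exI[of _ "\<lambda>n. V.pscale c (s n)"] conjI allI)
      show "(\<lambda>n. V.poly (V.pscale c (s n))) \<longlonglongrightarrow> cscale_op c A"
        using tendsto_cscale_op[OF s(2)] by (simp add: V.poly_pscale)
      show "(\<lambda>n. W.poly (V.pscale c (s n))) \<longlonglongrightarrow> cscale_op c (\<phi> A)"
        using tendsto_cscale_op[OF s(3)] by (simp add: W.poly_pscale)
    qed (simp add: V.valid_pscale s)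
    fix B assume B: "B \<in> cstar_gen K (V ` P)"
    from R\<phi>[OF B] obtain r where r: "\<And>n::nat. V.valid (r n)" "(\<lambda>n. V.poly (r n)) \<longlonglongrightarrow> B"
      "(\<lambda>n. W.poly (r n)) \<longlonglongrightarrow> \<phi> B" unfolding R_def by blast
    show "\<phi> (A + B) = \<phi> A + \<phi> B"
    proof (rule \<phi>I, unfold R_def, intro exI[of _ "\<lambda>n. s n @ r n"] conjI allI)
      show "(\<lambda>n. V.poly (s n @ r n)) \<longlonglongrightarrow> A + B" using tendsto_add[OF s(2) r(2)] by simp
      show "(\<lambda>n. W.poly (s n @ r n)) \<longlonglongrightarrow> \<phi> A + \<phi> B" using tendsto_add[OF s(3) r(3)] by simp
    qed (simp add: s r)
    note lim = bounded_bilinear.tendsto[OF bounded_bilinear_blinfun_compose]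
    show "\<phi> (A o\<^sub>L B) = \<phi> A o\<^sub>L \<phi> B"
    proof (rule \<phi>I, unfold R_def, intro exI[of _ "\<lambda>n. V.pmul (s n) (r n)"] conjI allI)
      show "(\<lambda>n. V.poly (V.pmul (s n) (r n))) \<longlonglongrightarrow> (A o\<^sub>L B)"
        using lim[OF s(2) r(2)] s(1) r(1) by (simp add: V.poly_pmul)
      show "(\<lambda>n. W.poly (V.pmul (s n) (r n))) \<longlonglongrightarrow> (\<phi> A o\<^sub>L \<phi> B)"
        using lim[OF s(3) r(3)] s(1) r(1) by (simp add: W.poly_pmul)
    qed (simp add: V.valid_pmul s r)
  qed
  moreover have "\<phi> (V a) = W a" if "a \<in> P" for a
  proof (rule \<phi>I, unfold R_def, intro exI[of _ "\<lambda>n. [(1, a, 0)]"] conjI allI)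
    show "V.valid [(1, a, 0)]" by (rule V.poly_generator(2)[OF that])
    show "(\<lambda>n. V.poly [(1, a, 0)]) \<longlonglongrightarrow> V a" by (simp only: V.poly_generator(1)[OF that] tendsto_const)
    show "(\<lambda>n. W.poly [(1, a, 0)]) \<longlonglongrightarrow> W a" by (simp only: W.poly_generator(1)[OF that] tendsto_const)
  qed
  ultimately show ?thesis unfolding canonically_isomorphic_def by blast
qed

end

section \<open>Shifts on \<open>\<ell>\<^sup>2(G)\<close>\<close>

locale shift =
  fixes e :: "'g::ab_group_add \<Rightarrow> 'h::chilbert_space"
  assumes on: "orthonormal_family e"
begin

lemma cinner_e: "cinner (e g) (e h) = (if g = h then 1 else 0)"
  using on by (simp add: orthonormal_family_def)

definition coord :: "'h \<Rightarrow> 'g \<Rightarrow> complex" where "coord x g = cinner x (e g)"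

text \<open>The closed span of the vectors \<open>e g\<close>, a copy of l2(G), written as a double
  orthogonal complement: it is visibly closed, and its vectors are determined by their
  coordinates.\<close>

definition H0 :: "'h set" where
  "H0 = {x. \<forall>y\<in>{y. \<forall>g. coord y g = 0}. cinner x y = 0}"

lemma H0: "closed_csubspace H0"
  unfolding H0_def by (rule closed_csubspace_orthogonal)

lemma coord_simps:
  "coord (x + y) g = coord x g + coord y g" "coord (x - y) g = coord x g - coord y g"
  "coord (c *\<^sub>C x) g = c * coord x g" "coord (e h) g = (if h = g then 1 else 0)" "coord 0 g = 0"
  by (simp_all add: coord_def cinner_add_left cinner_diff_left cinner_scaleC_left cinner_e)

lemma e_H0: "e g \<in> H0"
  by (auto simp: H0_def coord_def intro: cinner_eq_0_sym)

lemma H0_eqI: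
  assumes "x \<in> H0" "y \<in> H0" "\<And>g. coord x g = coord y g"
  shows "x = y"
proof -
  have "x - y \<in> H0" using assms closed_csubspace_diff[OF H0] by blast
  moreover have "\<forall>g. coord (x - y) g = 0" using assms(3) by (simp add: coord_simps)
  ultimately have "cinner (x - y) (x - y) = 0" unfolding H0_def by blast
  then show ?thesis by simp
qed

lemma norm_sum_e:
  assumes "finite F"
  shows "(norm (\<Sum>g\<in>F. c g *\<^sub>C e g))\<^sup>2 = (\<Sum>g\<in>F. (cmod (c g))\<^sup>2)"
proof -
  have "(norm (e g))\<^sup>2 = 1" for g
    using cinner_self[of "e g"] cinner_e[of g g] by (metis of_real_eq_1_iff)
  moreover have "(norm (\<Sum>g\<in>F. c g *\<^sub>C e g))\<^sup>2 = (\<Sum>g\<in>F. (norm (c g *\<^sub>C e g))\<^sup>2)"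
    using assms by (rule pythagoras_sum) (simp add: cinner_scaleC_left cinner_scaleC_right cinner_e)
  ultimately show ?thesis by (simp add: norm_scaleC power_mult_distrib)
qed

lemma bessel:
  assumes "finite F"
  shows "(\<Sum>g\<in>F. (cmod (coord x g))\<^sup>2) \<le> (norm x)\<^sup>2"
proof -
  let ?s = "\<Sum>g\<in>F. coord x g *\<^sub>C e g"
  have 1: "cinner x ?s = complex_of_real (\<Sum>g\<in>F. (cmod (coord x g))\<^sup>2)"
    by (simp add: cinner_sum_right cinner_scaleC_right coord_def
        complex_norm_square[unfolded of_real_power] mult.commute)
  have "(norm ?s)\<^sup>2 = cmod (cinner x ?s)"
    unfolding norm_sum_e[OF assms] 1 norm_of_real by (simp add: sum_nonneg)
  also have "\<dots> \<le> norm x * norm ?s" by (rule cinner_Cauchy_Schwarz)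
  finally have "norm ?s * norm ?s \<le> norm x * norm ?s" by (simp add: power2_eq_square)
  then have "norm ?s \<le> norm x" by (cases "norm ?s = 0") simp_all
  then have "(norm ?s)\<^sup>2 \<le> (norm x)\<^sup>2" by (intro power_mono) auto
  then show ?thesis by (simp add: norm_sum_e[OF assms])
qed

text \<open>The series of \<open>coord y g * cnj (c g)\<close> converges absolutely by Bessel and
  defines a functional of norm at most \<open>B\<close>; its Riesz vector has the prescribed
  coordinates and inherits the bound.\<close>

lemma riesz_fischer:
  assumes c: "\<And>F. finite F \<Longrightarrow> (\<Sum>g\<in>F. (cmod (c g))\<^sup>2) \<le> B\<^sup>2" and B: "0 \<le> B"
  shows "\<exists>v\<in>H0. (\<forall>g. coord v g = c g) \<and> norm v \<le> B"
proof -
  define f where "f y g = coord y g * cnj (c g)" for y g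
  have summable: "f y summable_on UNIV" for y
  proof (rule abs_summable_summable, rule nonneg_bdd_above_summable_on)
    show "bdd_above (sum (\<lambda>g. norm (f y g)) ` {F. F \<subseteq> UNIV \<and> finite F})"
    proof (rule bdd_aboveI2)
      fix F :: "'g set" assume "F \<in> {F. F \<subseteq> UNIV \<and> finite F}"
      then have F: "finite F" by simp
      have "norm (f y g) \<le> (cmod (coord y g))\<^sup>2 + (cmod (c g))\<^sup>2" for g
      proof -
        have "2 * (cmod (coord y g) * cmod (c g)) \<le> (cmod (coord y g))\<^sup>2 + (cmod (c g))\<^sup>2"
          using sum_squares_bound[of "cmod (coord y g)" "cmod (c g)"] by (simp add: mult.assoc)
        then show ?thesis
          using mult_nonneg_nonneg[of "cmod (coord y g)" "cmod (c g)"]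
          unfolding f_def norm_mult complex_mod_cnj by (smt (verit) norm_ge_zero)
      qed
      then have "(\<Sum>g\<in>F. norm (f y g)) \<le> (\<Sum>g\<in>F. (cmod (coord y g))\<^sup>2 + (cmod (c g))\<^sup>2)"
        by (rule sum_mono)
      also have "\<dots> \<le> (norm y)\<^sup>2 + B\<^sup>2"
        unfolding sum.distrib by (intro add_mono bessel c F)
      finally show "(\<Sum>g\<in>F. norm (f y g)) \<le> (norm y)\<^sup>2 + B\<^sup>2" .
    qed
  qed simp
  have bound: "norm (infsum (f y) UNIV) \<le> norm y * B" for y
  proof (rule tendsto_upperbound)
    show "((\<lambda>F. norm (sum (f y) F)) \<longlongrightarrow> norm (infsum (f y) UNIV)) (finite_subsets_at_top UNIV)"
      by (intro tendsto_norm infsum_tendsto summable)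
    show "\<forall>\<^sub>F F in finite_subsets_at_top UNIV. norm (sum (f y) F) \<le> norm y * B"
    proof (rule eventually_finite_subsets_at_top_weakI)
      fix F :: "'g set" assume F: "finite F"
      have "(norm (\<Sum>g\<in>F. c g *\<^sub>C e g))\<^sup>2 \<le> B\<^sup>2"
        using c[OF F] by (simp add: norm_sum_e[OF F])
      then have le: "norm (\<Sum>g\<in>F. c g *\<^sub>C e g) \<le> B" using B by (rule power2_le_imp_le)
      have "sum (f y) F = cinner y (\<Sum>g\<in>F. c g *\<^sub>C e g)"
        by (simp add: f_def cinner_sum_right cinner_scaleC_right coord_def mult.commute)
      then have "norm (sum (f y) F) \<le> norm y * norm (\<Sum>g\<in>F. c g *\<^sub>C e g)"
        using cinner_Cauchy_Schwarz by metis
      also have "\<dots> \<le> norm y * B" using le by (rule mult_left_mono) simp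
      finally show "norm (sum (f y) F) \<le> norm y * B" .
    qed
  qed (rule finite_subsets_at_top_neq_bot)
  have homog: "infsum (f (d *\<^sub>C y)) UNIV = d * infsum (f y) UNIV" for d y
  proof -
    have "f (d *\<^sub>C y) = (\<lambda>g. d * f y g)" by (auto simp: f_def coord_simps)
    then show ?thesis by (simp add: infsum_cmult_right' )
  qed
  have "bounded_linear (\<lambda>y. infsum (f y) UNIV)"
  proof (rule bounded_linear_intro[where K = B])
    fix y z r
    have "f (y + z) = (\<lambda>g. f y g + f z g)" by (auto simp: f_def coord_simps algebra_simps)
    then show "infsum (f (y + z)) UNIV = infsum (f y) UNIV + infsum (f z) UNIV"
      by (simp add: infsum_add summable)
    show "infsum (f (r *\<^sub>R y)) UNIV = r *\<^sub>R infsum (f y) UNIV"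
      using homog[of "complex_of_real r" y] by (simp add: scaleC_of_real scaleR_conv_of_real)
  qed (rule bound)
  then obtain v where v: "\<And>y. infsum (f y) UNIV = cinner y v"
    using riesz_representation[of "\<lambda>y. infsum (f y) UNIV"] homog by blast
  have "cinner v y = 0" if "\<forall>g. coord y g = 0" for y
  proof -
    have "f y = (\<lambda>_. 0)" using that by (auto simp: f_def)
    then have "cinner y v = 0" using v[of y] by simp
    then show ?thesis by (rule cinner_eq_0_sym)
  qed
  then have "v \<in> H0" by (simp add: H0_def)
  moreover have "coord v g = c g" for g
  proof -
    have "infsum (f (e g)) UNIV = infsum (f (e g)) {g}"
      by (rule infsum_cong_neutral) (auto simp: f_def coord_simps)
    then have "cinner (e g) v = cnj (c g)" using v[of "e g"] by (simp add: f_def coord_simps)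
    then show ?thesis unfolding coord_def by (subst cinner_commute) simp
  qed
  moreover have "norm v \<le> B"
  proof -
    have "norm v * norm v = norm (infsum (f v) UNIV)"
      unfolding v cinner_self norm_of_real by (simp add: power2_eq_square)
    also have "\<dots> \<le> norm v * B" by (rule bound)
    finally show ?thesis using B by (cases "norm v = 0") auto
  qed
  ultimately show ?thesis by blast
qed

text \<open>The bilateral shift \<open>e g \<mapsto> e (g + d)\<close>, extended by 0 to the
  complement of \<open>H0\<close>. Coordinates determine the chosen vector; the norm bound inside
  the choice makes contractivity immediate.\<close>

definition sh :: "'g \<Rightarrow> 'h \<Rightarrow> 'h" where
  "sh d x = (SOME v. v \<in> H0 \<and> (\<forall>g. coord v g = coord x (g - d)) \<and> norm v \<le> norm x)"

lemma
  shows sh_H0: "sh d x \<in> H0" and coord_sh: "coord (sh d x) g = coord x (g - d)"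
    and norm_sh_le: "norm (sh d x) \<le> norm x"
proof -
  have "\<exists>v\<in>H0. (\<forall>g. coord v g = coord x (g - d)) \<and> norm v \<le> norm x"
  proof (rule riesz_fischer)
    fix F :: "'g set" assume F: "finite F"
    have "(\<Sum>g\<in>F. (cmod (coord x (g - d)))\<^sup>2) = (\<Sum>g\<in>(\<lambda>g. g - d) ` F. (cmod (coord x g))\<^sup>2)"
      by (subst sum.reindex) (auto intro: inj_onI)
    also have "\<dots> \<le> (norm x)\<^sup>2" using F by (intro bessel) simp
    finally show "(\<Sum>g\<in>F. (cmod (coord x (g - d)))\<^sup>2) \<le> (norm x)\<^sup>2" .
  qed simp
  then have "\<exists>v. v \<in> H0 \<and> (\<forall>g. coord v g = coord x (g - d)) \<and> norm v \<le> norm x" by blast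
  from someI_ex[OF this] show "sh d x \<in> H0" "coord (sh d x) g = coord x (g - d)" "norm (sh d x) \<le> norm x"
    by (auto simp: sh_def)
qed

lemma sh_eqI: "y \<in> H0 \<Longrightarrow> (\<And>g. coord y g = coord x (g - d)) \<Longrightarrow> sh d x = y"
  by (rule H0_eqI) (simp_all add: sh_H0 coord_sh)

lemma sh_add: "sh d (x + y) = sh d x + sh d y"
  by (rule sh_eqI) (auto intro: closed_csubspaceD[OF H0] sh_H0 simp: coord_simps coord_sh)

lemma sh_scaleC: "sh d (c *\<^sub>C x) = c *\<^sub>C sh d x"
  by (rule sh_eqI) (auto intro: closed_csubspaceD[OF H0] sh_H0 simp: coord_simps coord_sh)

lemma sh_diff: "sh d (x - y) = sh d x - sh d y"
  by (rule sh_eqI) (auto intro: closed_csubspace_diff[OF H0] sh_H0 simp: coord_simps coord_sh)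

lemma sh_sh: "sh a (sh b x) = sh (a + b) x"
  by (rule sh_eqI[symmetric]) (auto simp: sh_H0 coord_sh diff_diff_eq add.commute)

lemma sh_0: "x \<in> H0 \<Longrightarrow> sh 0 x = x"
  by (rule sh_eqI) auto

lemma sh_e: "sh d (e g) = e (g + d)"
  by (rule sh_eqI) (auto simp: e_H0 coord_simps)

text \<open>On \<open>H0\<close> both \<open>sh d\<close> and its inverse \<open>sh (- d)\<close>
  are contractions.\<close>

lemma norm_sh: "x \<in> H0 \<Longrightarrow> norm (sh d x) = norm x"
  using norm_sh_le[of d x] norm_sh_le[of "-d" "sh d x"] by (simp add: sh_sh sh_0)

lemma cinner_sh:
  assumes "x \<in> H0" "y \<in> H0"
  shows "cinner (sh d x) y = cinner x (sh (- d) y)"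
proof -
  have "cinner (sh d x) (sh d (sh (- d) y)) = cinner x (sh (- d) y)"
    by (rule isometry_cinner[OF H0 sh_add sh_scaleC norm_sh assms(1) sh_H0])
  then show ?thesis by (simp add: sh_sh sh_0 assms(2))
qed

lemma bounded_linear_sh: "bounded_linear (sh d)"
  by (rule bounded_linear_intro[where K = 1])
     (auto simp: sh_add norm_sh_le scaleC_of_real[symmetric] sh_scaleC)

end

text \<open>Compressions \<open>x \<mapsto> cproj M (sh d x)\<close> with \<open>d = a - b\<close> are the products \<open>V_b\<^sup>* V_a\<close>, so a
  subspace reducing the restricted shifts is invariant under all of them.\<close>

locale shift_subspace = shift e for e :: "'g::ab_group_add \<Rightarrow> 'h::chilbert_space" +
  fixes P S :: "'g set" and M :: "'h set" and u :: 'h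
  assumes cone: "positive_cone P" and S: "subsemigroup S" "S \<subseteq> P" "0 \<in> S"
    and nontrivial: "\<exists>a\<in>S. a \<noteq> 0"
    and generates: "\<And>g. \<exists>a\<in>S. \<exists>b\<in>S. g = a - b"
    and M: "closed_csubspace M" "M \<subseteq> H0"
    and support: "\<And>x g. x \<in> M \<Longrightarrow> coord x g \<noteq> 0 \<Longrightarrow> g \<in> P"
    and invariant: "\<And>a x. a \<in> S \<Longrightarrow> x \<in> M \<Longrightarrow> sh a x \<in> M"
    and u: "u \<in> M" "coord u 0 = 1"
    and cyclic: "\<And>N m. closed_csubspace N \<Longrightarrow> N \<subseteq> M \<Longrightarrow>
      (\<And>d x. x \<in> N \<Longrightarrow> cproj M (sh d x) \<in> N) \<Longrightarrow> m \<in> N \<Longrightarrow> cinner m u \<noteq> 0 \<Longrightarrow> N = M"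
begin

definition rep :: "'g \<Rightarrow> 'h \<Rightarrow>\<^sub>L 'h" where "rep a = Blinfun (\<lambda>x. sh a (cproj M x))"

lemma rep_apply: "blinfun_apply (rep a) x = sh a (cproj M x)"
  unfolding rep_def
  by (subst bounded_linear_Blinfun_apply)
     (auto intro: bounded_linear_compose[OF bounded_linear_sh bounded_linear_cproj[OF M(1)]])

lemma rep_M: "x \<in> M \<Longrightarrow> blinfun_apply (rep a) x = sh a x"
  by (simp add: rep_apply cproj_ident[OF M(1)])

lemma adj_rep_apply:
  assumes a: "a \<in> S"
  shows "blinfun_apply (adj (rep a)) x = cproj M (sh (- a) (cproj M x))"
proof -
  let ?B = "\<lambda>x. cproj M (sh (- a) (cproj M x))"
  have "bounded_linear ?B"
    by (intro bounded_linear_compose[OF bounded_linear_cproj[OF M(1)]]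
        bounded_linear_compose[OF bounded_linear_sh] bounded_linear_cproj[OF M(1)])
  note B = bounded_linear_Blinfun_apply[OF this]
  have "adj (rep a) = Blinfun ?B"
  proof (rule adj_eqI)
    fix x y
    note m = cproj_mem[OF M(1)]
    have "cinner (sh a (cproj M x)) y = cinner (sh a (cproj M x)) (cproj M y)"
      by (simp add: cinner_cproj_right[OF M(1)] invariant[OF a m])
    also have "\<dots> = cinner (cproj M x) (sh (- a) (cproj M y))"
      using m M(2) by (intro cinner_sh) auto
    also have "\<dots> = cinner (cproj M x) (?B y)" by (simp add: cinner_cproj_right[OF M(1)] m)
    also have "\<dots> = cinner x (?B y)" by (simp add: cinner_cproj_left[OF M(1)] m)
    finally show "cinner (blinfun_apply (rep a) x) y = cinner x (blinfun_apply (Blinfun ?B) y)"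
      by (simp add: rep_apply B)
  qed
  then show ?thesis by (simp add: B)
qed

lemma adj_rep_M: "a \<in> S \<Longrightarrow> x \<in> M \<Longrightarrow> blinfun_apply (adj (rep a)) x = cproj M (sh (- a) x)"
  by (simp add: adj_rep_apply cproj_ident[OF M(1)])

lemma isometric_rep: "isometric_rep S M rep"
  unfolding isometric_rep_def isometry_on_def
proof (intro conjI ballI)
  fix a assume a: "a \<in> S"
  show "rep a \<in> ops M"
    unfolding ops_def
    using invariant[OF a cproj_mem[OF M(1)]] cproj_perp[OF M(1)] sh_scaleC[of a 0 0]
    by (auto simp: rep_apply cproj_scaleC[OF M(1)] sh_scaleC)
  show "norm (blinfun_apply (rep a) x) = norm x" if "x \<in> M" for x
    using that M(2) by (auto simp: rep_M norm_sh)
  show "rep (a + b) = rep a o\<^sub>L rep b" if b: "b \<in> S" for b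
    by (rule blinfun_eqI)
       (simp add: rep_apply cproj_ident[OF M(1) invariant[OF b cproj_mem[OF M(1)]]] sh_sh)
qed (rule M(1))

text \<open>If two shifts of \<open>u\<close> agree, the coordinate of \<open>u\<close> at 0
  reappears at \<open>a - b\<close> and at \<open>b - a\<close>; both then lie in
  \<open>P\<close>.\<close>

lemma faithful_rep: "faithful_rep S rep"
  unfolding faithful_rep_def
proof (rule inj_onI)
  fix a b assume "rep a = rep b"
  then have *: "sh a u = sh b u" using rep_M[OF u(1)] by metis
  have "coord u (b - a) = 1" "coord u (a - b) = 1"
    using arg_cong[OF *, of "\<lambda>x. coord x b"] arg_cong[OF *, of "\<lambda>x. coord x a"] u(2)
    by (simp_all add: coord_sh)
  then have "a - b \<in> P" "- (a - b) \<in> P" using support[OF u(1)] by force+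
  then show "a = b" using positive_cone_antisym[OF cone, of "a - b"] by simp
qed

text \<open>Vectors of \<open>M\<close> are supported in \<open>P\<close>, so a shift by
  \<open>a > 0\<close> has no coordinate at 0, whereas \<open>u\<close> does.\<close>

lemma not_unitary:
  assumes a: "a \<in> S" "a \<noteq> 0"
  shows "\<not> unitary_on M (rep a)"
proof
  assume "unitary_on M (rep a)"
  then have "sh a (cproj M (sh (- a) u)) = u"
    using u(1) by (simp add: unitary_on_def rep_M adj_rep_M[OF a(1)] cproj_mem[OF M(1)])
  then have "coord (sh a (cproj M (sh (- a) u))) 0 = 1" using u(2) by simp
  then have "- a \<in> P" using support[OF cproj_mem[OF M(1)], of "sh (- a) u" "- a"] by (simp add: coord_sh)
  then show False using positive_cone_antisym[OF cone, of a] a S(2) by blast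
qed

text \<open>Either the subspace contains a vector not orthogonal to \<open>u\<close>, and
  \<open>cyclic\<close> applies, or \<open>u\<close> lies in its complement within \<open>M\<close>.
  The complement is invariant too, because the adjoint of the compression by \<open>d\<close> is the
  compression by \<open>- d\<close>; so \<open>cyclic\<close> makes the complement everything and
  the subspace 0.\<close>

lemma irreducible_rep: "irreducible_rep S M rep"
  unfolding irreducible_rep_def
proof (intro allI impI)
  fix N assume "closed_csubspace N \<and> N \<subseteq> M \<and>
    (\<forall>a\<in>S. \<forall>x\<in>N. blinfun_apply (rep a) x \<in> N \<and> blinfun_apply (adj (rep a)) x \<in> N)"
  then have N: "closed_csubspace N" "N \<subseteq> M"
    and inv: "\<And>a x. a \<in> S \<Longrightarrow> x \<in> N \<Longrightarrow> blinfun_apply (rep a) x \<in> N"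
    and inv': "\<And>a x. a \<in> S \<Longrightarrow> x \<in> N \<Longrightarrow> blinfun_apply (adj (rep a)) x \<in> N" by auto
  have R: "cproj M (sh d x) \<in> N" if x: "x \<in> N" for d x
  proof -
    obtain a b where ab: "a \<in> S" "b \<in> S" "d = a - b" using generates by blast
    have xM: "x \<in> M" using x N(2) by blast
    have "blinfun_apply (adj (rep b)) (blinfun_apply (rep a) x) = cproj M (sh d x)"
      by (simp add: rep_M[OF xM] adj_rep_M[OF ab(2) invariant[OF ab(1) xM]] sh_sh ab(3))
    then show ?thesis using inv'[OF ab(2) inv[OF ab(1) x]] by simp
  qed
  show "N = {0} \<or> N = M"
  proof (cases "\<exists>m\<in>N. cinner m u \<noteq> 0")
    case True
    then show ?thesis using cyclic[OF N R] by blast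
  next
    case False
    define N' where "N' = M \<inter> {x. \<forall>y\<in>N. cinner x y = 0}"
    have "N' = M"
    proof (rule cyclic)
      show "closed_csubspace N'"
        unfolding N'_def by (intro closed_csubspace_Int M(1) closed_csubspace_orthogonal)
      show "N' \<subseteq> M" by (simp add: N'_def)
      show "cproj M (sh d x) \<in> N'" if x: "x \<in> N'" for d x
      proof -
        have "cinner (cproj M (sh d x)) y = 0" if y: "y \<in> N" for y
        proof -
          have H: "x \<in> H0" "y \<in> H0" "y \<in> M" "x \<in> M" using x y N(2) M(2) by (auto simp: N'_def)
          have "cinner (cproj M (sh d x)) y = cinner x (sh (- d) y)"
            by (simp add: cinner_cproj_left[OF M(1)] H cinner_sh)
          also have "\<dots> = cinner x (cproj M (sh (- d) y))" by (simp add: cinner_cproj_right[OF M(1)] H)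
          also have "\<dots> = 0" using x R[OF y] by (simp add: N'_def)
          finally show ?thesis .
        qed
        then show ?thesis by (simp add: N'_def cproj_mem[OF M(1)])
      qed
      show "u \<in> N'" using u(1) False by (auto simp: N'_def intro: cinner_eq_0_sym)
      show "cinner u u \<noteq> 0" using u(2) by (auto simp: coord_simps)
    qed
    have "cinner x x = 0" if "x \<in> N" for x
    proof -
      have "x \<in> N'" using that N(2) \<open>N' = M\<close> by blast
      then show ?thesis using that unfolding N'_def by blast
    qed
    then have "N = {0}" using closed_csubspaceD(2)[OF N(1)] by auto
    then show ?thesis ..
  qed
qed

lemma rep_in_Delta: "(M, rep) \<in> Delta S"
  using isometric_rep faithful_rep irreducible_rep not_unitary nontrivial
  by (auto simp: Delta_def nonunitary_rep_def)

end

section \<open>Two representations of a proper subsemigroup\<close>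

locale proper_subsemigroup = shift e for e :: "'g::ab_group_add \<Rightarrow> 'h::chilbert_space" +
  fixes P S :: "'g set"
  assumes cone: "positive_cone P" and S: "subsemigroup S" "S \<subseteq> P" "0 \<in> S"
    and generates: "\<And>g. \<exists>a\<in>S. \<exists>b\<in>S. g = a - b" and proper: "S \<noteq> P"
begin

lemma S_add: "a \<in> S \<Longrightarrow> b \<in> S \<Longrightarrow> a + b \<in> S"
  using S(1) by (simp add: subsemigroup_def)

lemma nontrivial: "\<exists>a\<in>S. a \<noteq> 0"
proof (rule ccontr)
  assume *: "\<not> (\<exists>a\<in>S. a \<noteq> 0)"
  have "g = 0" for g :: 'g
  proof -
    obtain a b where ab: "a \<in> S" "b \<in> S" "g = a - b" using generates by blast
    then have "a = 0" "b = 0" using * by blast+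
    with ab show ?thesis by simp
  qed
  then have "P \<subseteq> {0}" by auto
  then show False using S(2,3) proper by blast
qed

lemma P_add: "a \<in> P \<Longrightarrow> b \<in> P \<Longrightarrow> a + b \<in> P"
  by (rule positive_cone_add[OF cone])

lemma P_antisym: "a \<in> P \<Longrightarrow> - a \<in> P \<Longrightarrow> a = 0"
  by (rule positive_cone_antisym[OF cone])

lemma P_add_eq_0: "a \<in> P \<Longrightarrow> b \<in> P \<Longrightarrow> a + b = 0 \<Longrightarrow> a = 0"
  using P_antisym[of a] by (simp add: add_eq_0_iff)

text \<open>The copy of l2(S): orthogonality to the other basis vectors says that coordinates are
  supported in \<open>S\<close>.\<close>

definition reg :: "'h set" where "reg = H0 \<inter> {x. \<forall>y\<in>e ` (- S). cinner x y = 0}"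

lemma reg: "closed_csubspace reg"
  unfolding reg_def by (intro closed_csubspace_Int H0 closed_csubspace_orthogonal)

lemma reg_iff: "x \<in> reg \<longleftrightarrow> x \<in> H0 \<and> (\<forall>g. coord x g \<noteq> 0 \<longrightarrow> g \<in> S)"
  by (auto simp: reg_def coord_def)

lemma e_reg: "g \<in> S \<Longrightarrow> e g \<in> reg"
  by (auto simp: reg_iff e_H0 coord_simps split: if_splits)

lemma sh_reg: "a \<in> S \<Longrightarrow> x \<in> reg \<Longrightarrow> sh a x \<in> reg"
  using S_add by (fastforce simp: reg_iff sh_H0 coord_sh)

lemma coord_cproj_reg: "coord (cproj reg x) g = (if g \<in> S then coord x g else 0)"
proof (cases "g \<in> S")
  case True
  then show ?thesis unfolding coord_def by (simp add: cinner_cproj_left[OF reg e_reg])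
next
  case False
  then show ?thesis using cproj_mem[OF reg, of x] by (auto simp: reg_iff)
qed

lemma neg_notin_S: "a \<in> S \<Longrightarrow> a \<noteq> 0 \<Longrightarrow> - a \<notin> S"
  using P_antisym S(2) by blast

text \<open>Let \<open>n\<close> be the projection of \<open>e 0\<close> to \<open>N\<close>. For
  nonzero \<open>g \<in> S\<close> and \<open>y = V_g^* n\<close> one finds
  \<open>cinner y y = cinner n (V_g y) = cinner (e 0) (V_g y) = 0\<close>, so \<open>n\<close> has
  no coordinate at \<open>g\<close>. Thus \<open>n\<close> is a multiple of \<open>e 0\<close>,
  nonzero because of \<open>m\<close>; hence \<open>e 0\<close> and all its shifts lie in
  \<open>N\<close>.\<close>

lemma reg_cyclic:
  assumes N: "closed_csubspace N" "N \<subseteq> reg" "\<And>d x. x \<in> N \<Longrightarrow> cproj reg (sh d x) \<in> N"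
    and m: "m \<in> N" "cinner m (e 0) \<noteq> 0"
  shows "N = reg"
proof -
  define n where "n = cproj N (e 0)"
  have n: "n \<in> N" "n \<in> reg" "n \<in> H0"
    using cproj_mem[OF N(1), of "e 0"] N(2) by (auto simp: n_def reg_iff)
  have sh_N: "sh a x \<in> N" if "a \<in> S" "x \<in> N" for a x
    using N(3)[OF that(2), of a] cproj_ident[OF reg sh_reg[OF that(1)]] that(2) N(2) by auto
  have "coord n g = 0" if g: "g \<noteq> 0" for g
  proof (cases "g \<in> S")
    case True
    define y where "y = cproj reg (sh (- g) n)"
    have y: "y \<in> N" using N(3)[OF n(1)] by (simp add: y_def)
    then have yreg: "y \<in> reg" using N(2) by blast
    then have yH0: "y \<in> H0" by (simp add: reg_iff)
    have "cinner y y = cinner (sh (- g) n) y"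
      unfolding y_def by (rule cinner_cproj_left[OF reg cproj_mem[OF reg]])
    also have "\<dots> = cinner n (sh g y)" using cinner_sh[OF n(3) yH0, of "- g"] by simp
    also have "\<dots> = cinner (e 0) (sh g y)"
      unfolding n_def by (rule cinner_cproj_left[OF N(1) sh_N[OF True y]])
    also have "\<dots> = 0"
    proof (rule cinner_eq_0_sym)
      have "coord (sh g y) 0 = 0"
        using yreg neg_notin_S[OF True g] by (auto simp: coord_sh reg_iff)
      then show "cinner (sh g y) (e 0) = 0" by (simp add: coord_def)
    qed
    finally have "coord y 0 = 0" by (simp add: coord_simps)
    then show ?thesis using S(3) by (simp add: y_def coord_cproj_reg coord_sh)
  next
    case False
    then show ?thesis using n(2) by (auto simp: reg_iff)
  qed
  then have n_eq: "n = coord n 0 *\<^sub>C e 0"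
    by (intro H0_eqI n closed_csubspaceD[OF H0] e_H0) (auto simp: coord_simps)
  have "cinner m n \<noteq> 0" using m by (simp add: n_def cinner_cproj_right[OF N(1)])
  then have "coord n 0 \<noteq> 0" using n_eq by (metis cinner_zero_right scaleC_0_left)
  then have "e 0 = (1 / coord n 0) *\<^sub>C n"
    by (subst n_eq) (simp add: scaleC_scaleC)
  then have e0: "e 0 \<in> N" using closed_csubspaceD(4)[OF N(1) n(1)] by metis
  show ?thesis
  proof (rule closed_csubspace_eqI[OF N(1) reg N(2)])
    fix y assume y: "y \<in> reg" "\<And>z. z \<in> N \<Longrightarrow> cinner y z = 0"
    have "coord y g = 0" for g
    proof (cases "g \<in> S")
      case True
      then have "e g \<in> N" using sh_N[OF True e0] by (simp add: sh_e)
      then show ?thesis using y(2) by (simp add: coord_def)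
    qed (use y in \<open>auto simp: reg_iff\<close>)
    then show "y = 0" using y(1) by (intro H0_eqI) (auto simp: reg_iff coord_simps closed_csubspaceD[OF H0])
  qed
qed

lemma shift_subspace_reg: "shift_subspace e P S reg (e 0)"
proof unfold_locales
  show "reg \<subseteq> H0" by (auto simp: reg_iff)
  show "\<And>x g. x \<in> reg \<Longrightarrow> coord x g \<noteq> 0 \<Longrightarrow> g \<in> P" using S(2) by (auto simp: reg_iff)
qed (use cone S generates nontrivial reg sh_reg e_reg reg_cyclic in \<open>auto simp: coord_simps\<close>)

text \<open>Range projections are diagonal for the basis: that of \<open>T a\<close> keeps the
  coordinates in \<open>S\<close> whose index \<open>g\<close> satisfies
  \<open>g - a \<in> S\<close>.\<close>

lemma reg_commute:
  assumes "a \<in> S" "b \<in> S"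
  defines "T \<equiv> shift_subspace.rep e reg"
  shows "T a o\<^sub>L adj (T a) o\<^sub>L T b o\<^sub>L adj (T b) = T b o\<^sub>L adj (T b) o\<^sub>L T a o\<^sub>L adj (T a)"
proof -
  interpret reg: shift_subspace e P S reg "e 0" by (rule shift_subspace_reg)
  have *: "coord (blinfun_apply (T a) (blinfun_apply (adj (T a)) y)) g =
      (if g - a \<in> S then coord (cproj reg y) g else 0)" if "a \<in> S" for a y g
    using that by (simp add: T_def reg.rep_apply reg.adj_rep_apply coord_sh coord_cproj_reg)
  show ?thesis
  proof (rule blinfun_eqI, rule H0_eqI)
    fix x g
    have "coord (cproj reg z) g = coord z g" if "z \<in> reg" for z
      using that by (simp add: cproj_ident[OF reg])
    have mem: "blinfun_apply (T a) y \<in> reg" if "a \<in> S" for a y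
      using that by (simp add: T_def reg.rep_apply sh_reg cproj_mem[OF reg])
    show "coord (blinfun_apply (T a o\<^sub>L adj (T a) o\<^sub>L T b o\<^sub>L adj (T b)) x) g =
        coord (blinfun_apply (T b o\<^sub>L adj (T b) o\<^sub>L T a o\<^sub>L adj (T a)) x) g"
      using assms(1,2) by (simp add: * cproj_ident[OF reg mem])
  qed (simp_all add: T_def reg.rep_apply sh_H0)
qed

end

text \<open>The second representation acts on the span of \<open>e 0 + e g\<close> and of all \<open>e x\<close> with
  \<open>x \<in> I\<close>, where \<open>g \<in> P - S\<close>; the gap \<open>g\<close> of \<open>S\<close> entangles the range projections.\<close>

locale gap = proper_subsemigroup e P S for e :: "'g::ab_group_add \<Rightarrow> 'h::chilbert_space" and P S +
  fixes g :: 'g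
  assumes g: "g \<in> P" "g \<notin> S"
begin

text \<open>The points strictly above \<open>g\<close> make room for \<open>g + a\<close> with
  nonzero \<open>a \<in> S\<close>, and they let every shift by more than \<open>g\<close> map
  \<open>M\<close> into itself.\<close>

definition I :: "'g set" where "I = {x. x \<in> S \<and> x \<noteq> 0} \<union> {x. x - g \<in> P \<and> x \<noteq> g}"

definition u :: 'h where "u = e 0 + e g"

text \<open>Orthogonality to \<open>e 0 - e g\<close> glues the coordinates at 0 and
  \<open>g\<close>, so that these two basis vectors enter only through \<open>u\<close>.\<close>

definition M :: "'h set" where
  "M = H0 \<inter> {x. \<forall>y\<in>insert (e 0 - e g) (e ` (- (I \<union> {0, g}))). cinner x y = 0}"

lemma g_ne: "g \<noteq> 0" using g S(3) by auto

lemma g_shift_ne: "g + g \<noteq> 0" "g + g + g \<noteq> 0" "g + g + g + g \<noteq> 0"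
  using P_add_eq_0 P_add g(1) g_ne by metis+

lemma I_subset_P: "I \<subseteq> P"
proof
  fix x assume "x \<in> I"
  then consider "x \<in> S" | "x - g \<in> P" unfolding I_def by blast
  then show "x \<in> P"
  proof cases
    case 2
    then show ?thesis using P_add[OF 2 g(1)] by simp
  qed (use S in blast)
qed

lemma I_0_g: "0 \<notin> I" "g \<notin> I"
  using P_antisym[OF g(1)] g g_ne by (auto simp: I_def)

lemma I_above: "x \<in> I \<union> {0, g} \<Longrightarrow> d - g \<in> P \<Longrightarrow> d \<noteq> g \<Longrightarrow> x + d \<in> I"
proof -
  assume x: "x \<in> I \<union> {0, g}" and d: "d - g \<in> P" "d \<noteq> g"
  have "x \<in> P" using x I_subset_P g(1) positive_cone_zero[OF cone] by auto
  then have "d - g + x \<in> P" using P_add d(1) by blast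
  then have "x + d - g \<in> P" by (simp add: algebra_simps)
  moreover have "x + d \<noteq> g"
  proof
    assume "x + d = g"
    then have "(d - g) + x = 0" by (simp add: algebra_simps)
    then have "d - g = 0" using P_add_eq_0[OF d(1) \<open>x \<in> P\<close>] by blast
    then show False using d(2) by simp
  qed
  ultimately show ?thesis by (simp add: I_def)
qed

lemma gg_I: "g + g \<in> I"
  using g g_ne by (simp add: I_def)

lemma M: "closed_csubspace M"
  unfolding M_def by (intro closed_csubspace_Int H0 closed_csubspace_orthogonal)

lemma M_iff: "x \<in> M \<longleftrightarrow> x \<in> H0 \<and> coord x 0 = coord x g \<and> (\<forall>y. coord x y \<noteq> 0 \<longrightarrow> y \<in> I \<union> {0, g})"
  by (auto simp: M_def coord_def cinner_diff_right)

lemma M_H0: "x \<in> M \<Longrightarrow> x \<in> H0" by (simp add: M_iff)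

lemma coord_M_out: "x \<in> M \<Longrightarrow> y \<notin> I \<Longrightarrow> y \<noteq> 0 \<Longrightarrow> y \<noteq> g \<Longrightarrow> coord x y = 0"
  by (auto simp: M_iff)

lemma u_M: "u \<in> M"
  using g_ne by (auto simp: M_iff u_def coord_simps intro!: closed_csubspaceD[OF H0] e_H0 split: if_splits)

lemma e_M: "x \<in> I \<Longrightarrow> e x \<in> M"
  using I_0_g by (auto simp: M_iff coord_simps e_H0 split: if_splits)

lemma coord_neg: "x \<in> M \<Longrightarrow> - y \<in> P \<Longrightarrow> y \<noteq> 0 \<Longrightarrow> coord x y = 0"
proof (rule ccontr)
  assume "x \<in> M" "- y \<in> P" "y \<noteq> 0" "coord x y \<noteq> 0"
  then have "y \<in> P" using I_subset_P g(1) positive_cone_zero[OF cone] by (auto simp: M_iff)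
  then show False using P_antisym \<open>- y \<in> P\<close> \<open>y \<noteq> 0\<close> by blast
qed

text \<open>This is where \<open>g \<notin> S\<close> enters. A nonzero shift has coordinate 0 at
  \<open>g\<close>, since \<open>g - a \<in> S\<close> would put \<open>g\<close> into
  \<open>S\<close> and \<open>- a \<in> P\<close> contradicts \<open>a > 0\<close>; the coordinate
  at 0 vanishes by positivity. Both glued coordinates being 0, they agree.\<close>

lemma sh_M:
  assumes a: "a \<in> S" and x: "x \<in> M"
  shows "sh a x \<in> M"
proof (cases "a = 0")
  case True
  then show ?thesis using x by (simp add: sh_0 M_H0)
next
  case False
  have "coord x (- a) = 0" using coord_neg[OF x, of "- a"] a False S(2) by auto
  moreover have "coord x (g - a) = 0"
  proof (rule coord_M_out[OF x])
    show "g - a \<noteq> 0" "g - a \<noteq> g" using a g False by auto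
    show "g - a \<notin> I"
    proof
      assume "g - a \<in> I"
      then consider "g - a \<in> S" | "- a \<in> P" unfolding I_def by auto
      then show False
      proof cases
        case 1
        then show False using S_add[OF a] g(2) by fastforce
      next
        case 2
        then show False using P_antisym[of a] a False S(2) by auto
      qed
    qed
  qed
  moreover have "y \<in> I" if "coord x (y - a) \<noteq> 0" for y
  proof -
    have "y - a \<in> I \<union> {0, g}" using that x by (auto simp: M_iff)
    then consider "y - a \<in> S" "y - a \<noteq> 0" | "y = a" | "y = g + a" | "y - a - g \<in> P" "y - a \<noteq> g"
      unfolding I_def by (auto simp: algebra_simps)
    then show "y \<in> I"
    proof cases
      case 1
      then have "y \<in> S" using S_add[OF 1(1) a] by simp
      moreover have "y \<noteq> 0"
      proof -
        have "y - a \<in> P" "a \<in> P" using 1 a S(2) by blast+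
        then show ?thesis using P_add_eq_0[of "y - a" a] 1(2) by auto
      qed
      ultimately show ?thesis by (simp add: I_def)
    next
      case 2
      then show ?thesis using a False by (simp add: I_def)
    next
      case 3
      then show ?thesis using a False S(2) by (auto simp: I_def)
    next
      case 4
      then have "y - g \<in> P" using P_add[OF 4(1), of a] a S(2) by (auto simp: algebra_simps)
      moreover have "y \<noteq> g"
      proof
        assume "y = g"
        then have "- a \<in> P" using 4 by simp
        then show False using P_antisym[of a] a False S(2) by auto
      qed
      ultimately show ?thesis by (simp add: I_def)
    qed
  qed
  ultimately show ?thesis by (auto simp: M_iff coord_sh sh_H0)
qed

lemma sh_above_M:
  assumes "x \<in> M" "d - g \<in> P" "d \<noteq> g"
  shows "sh d x \<in> M"
proof -
  have "y \<in> I" if "coord x (y - d) \<noteq> 0" for y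
    using I_above[of "y - d" d] assms that by (auto simp: M_iff)
  moreover from this have "coord x (0 - d) = 0" "coord x (g - d) = 0" using I_0_g by blast+
  ultimately show ?thesis by (auto simp: M_iff coord_sh sh_H0)
qed

text \<open>The factor is 1/2 because \<open>e 0\<close> and \<open>e g\<close> have the same inner
  products with \<open>M\<close>, while their sum \<open>u\<close> already lies in
  \<open>M\<close>.\<close>

lemma cproj_M_e0: "cproj M (e 0) = (1 / 2) *\<^sub>C u" and cproj_M_eg: "cproj M (e g) = (1 / 2) *\<^sub>C u"
proof -
  have u2: "(1 / 2) *\<^sub>C u \<in> M" by (rule closed_csubspaceD(4)[OF M u_M])
  have *: "cinner (e h) z - 1 / 2 * cinner u z = 0" if "z \<in> M" "h = 0 \<or> h = g" for z h
  proof -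
    have "cinner (e 0) z = cinner (e g) z"
      using that(1) unfolding M_iff coord_def by (subst (1 2) cinner_commute) simp
    then show ?thesis using that(2) by (auto simp: u_def cinner_add_left)
  qed
  show "cproj M (e 0) = (1 / 2) *\<^sub>C u" "cproj M (e g) = (1 / 2) *\<^sub>C u"
    by (rule cproj_eqI[OF M u2]; use * in \<open>simp add: cinner_diff_left cinner_scaleC_left\<close>)+
qed

lemma cproj_M_e_out: "x \<notin> I \<Longrightarrow> x \<noteq> 0 \<Longrightarrow> x \<noteq> g \<Longrightarrow> cproj M (e x) = 0"
  using coord_M_out by (intro cproj_perp[OF M], rule_tac cinner_eq_0_sym) (simp add: coord_def)

lemma half_u: "(1 / 2) *\<^sub>C u + (1 / 2) *\<^sub>C u = u"
  by (simp add: scaleC_add_left[symmetric])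

text \<open>Shifting by \<open>g\<close> leaves \<open>M\<close> only through the \<open>u\<close>-component, which therefore can be
  isolated.\<close>

lemma M_cyclic:
  assumes N: "closed_csubspace N" "N \<subseteq> M" "\<And>d x. x \<in> N \<Longrightarrow> cproj M (sh d x) \<in> N"
    and m: "m \<in> N" "cinner m u \<noteq> 0"
  shows "N = M"
proof -
  note N_simps = closed_csubspaceD(3,4)[OF N(1)] closed_csubspace_diff[OF N(1)]
  have mM: "m \<in> M" using m N by blast
  define l where "l = coord m 0"
  have l: "coord m 0 = l" "coord m g = l" using mM by (auto simp: M_iff l_def)
  have "cinner m u = 2 * l" using l by (simp add: u_def cinner_add_right coord_def)
  then have l0: "l \<noteq> 0" using m(2) by simp
  have shN: "sh d x \<in> N" if "x \<in> N" "d - g \<in> P" "d \<noteq> g" for d x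
    using N(3)[OF that(1), of d] cproj_ident[OF M sh_above_M[of x d]] that N(2) by auto
  \<comment> \<open>\<open>sh g m\<close> has coordinate 0 at \<open>0\<close> and \<open>l\<close>
    at \<open>g\<close>; projecting to \<open>M\<close> replaces both by their mean
    \<open>l / 2\<close>.\<close>
  define q where "q = sh g m - (l / 2) *\<^sub>C (e g - e 0)"
  have qM: "q \<in> M"
  proof -
    have "q \<in> H0" unfolding q_def
      by (intro closed_csubspace_diff[OF H0] closed_csubspaceD(4)[OF H0] sh_H0 e_H0)
    moreover have "coord q 0 = coord q g"
      using coord_neg[OF mM, of "- g"] g g_ne l by (simp add: q_def coord_simps coord_sh)
    moreover have "y \<in> I \<union> {0, g}" if "coord q y \<noteq> 0" for y
    proof (cases "y = 0 \<or> y = g")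
      case False
      then have "coord m (y - g) \<noteq> 0" using that by (auto simp: q_def coord_simps coord_sh)
      then have "y - g \<in> I \<union> {0, g}" using mM by (auto simp: M_iff)
      then have "y - g \<in> P" using I_subset_P g(1) positive_cone_zero[OF cone] by auto
      with False show ?thesis by (simp add: I_def)
    qed auto
    ultimately show ?thesis by (simp add: M_iff)
  qed
  have "cproj M (sh g m) = q"
  proof (rule cproj_eqI[OF M qM])
    fix z assume "z \<in> M"
    then have "cinner z (sh g m - q) = 0"
      by (simp add: q_def cinner_scaleC_right cinner_diff_right M_iff coord_def)
    then show "cinner (sh g m - q) z = 0" by (rule cinner_eq_0_sym)
  qed
  then have qN: "q \<in> N" using N(3)[OF m(1), of g] by simp
  have gg: "(g + g) - g \<in> P" "g + g \<noteq> g" "(g + g + g) - g \<in> P" "g + g + g \<noteq> g"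
    using g g_ne P_add[OF g(1) g(1)] g_shift_ne by (auto simp: add.assoc)
  \<comment> \<open>Shifts by more than \<open>g\<close> act within \<open>N\<close> without
    projection. Comparing three steps at once with one projected step and two more cancels
    \<open>m\<close> and leaves only the correction term.\<close>
  have "sh (g + g + g) m - sh (g + g) q = (l / 2) *\<^sub>C (e (g + g + g) - e (g + g))"
    by (simp add: q_def sh_diff sh_scaleC sh_e sh_sh add.assoc)
  then have "(l / 2) *\<^sub>C (e (g + g + g) - e (g + g)) \<in> N"
    using N_simps(3)[OF shN[OF m(1) gg(3,4)] shN[OF qN gg(1,2)]] by simp
  then have "(2 / l) *\<^sub>C (l / 2) *\<^sub>C (e (g + g + g) - e (g + g)) \<in> N" by (rule N_simps(2))
  then have w: "e (g + g + g) - e (g + g) \<in> N" using l0 by (simp add: scaleC_scaleC)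
  \<comment> \<open>Shifting back past 0 loses \<open>e (- g)\<close> under projection and turns
    \<open>e 0\<close> into half of \<open>u\<close>.\<close>
  have "sh (- (g + g + g)) (e (g + g + g) - e (g + g)) = e 0 - e (- g)"
    by (simp add: sh_diff sh_e algebra_simps)
  moreover have "- g \<notin> I" "- g \<noteq> 0" "- g \<noteq> g"
    using I_subset_P P_antisym[OF g(1)] g_ne g(1) by auto
  ultimately have "(1 / 2) *\<^sub>C u \<in> N"
    using N(3)[OF w, of "- (g + g + g)"] by (simp add: cproj_diff[OF M] cproj_M_e0 cproj_M_e_out)
  then have uN: "u \<in> N" using N_simps(1) half_u by metis
  \<comment> \<open>A shift by \<open>g\<close> sends \<open>e 0\<close> to \<open>e g\<close>,
    which projects to half of \<open>u\<close>; subtracting that half isolates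
    \<open>e (g + g)\<close>.\<close>
  have "cproj M (sh g u) = (1 / 2) *\<^sub>C u + e (g + g)"
    by (simp add: u_def sh_add sh_e cproj_add[OF M] cproj_M_eg[unfolded u_def] cproj_ident[OF M e_M[OF gg_I]])
  then have "((1 / 2) *\<^sub>C u + e (g + g)) - (1 / 2) *\<^sub>C u \<in> N"
    using N(3)[OF uN, of g] N_simps(2)[OF uN] N_simps(3) by metis
  then have "e (g + g) \<in> N" by simp
  \<comment> \<open>One basis vector with index in \<open>I\<close> suffices, because the shift may
    be by any group element.\<close>
  then have eN: "e x \<in> N" if "x \<in> I" for x
    using N(3)[of "e (g + g)" "x - (g + g)"] cproj_ident[OF M e_M[OF that]] by (simp add: sh_e)
  show ?thesis
  proof (rule closed_csubspace_eqI[OF N(1) M N(2)])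
    fix y assume y: "y \<in> M" "\<And>z. z \<in> N \<Longrightarrow> cinner y z = 0"
    have "coord y 0 + coord y g = 0" using y(2)[OF uN] by (simp add: u_def cinner_add_right coord_def)
    then have "coord y 0 = 0" "coord y g = 0" using y(1) by (auto simp: M_iff)
    then have "coord y x = 0" for x
      using y(2)[OF eN[of x]] coord_M_out[OF y(1), of x] by (cases "x \<in> I") (auto simp: coord_def)
    then show "y = 0" using y(1) by (intro H0_eqI) (auto simp: M_iff coord_simps closed_csubspaceD[OF H0])
  qed
qed

lemma shift_subspace_M: "shift_subspace e P S M u"
proof unfold_locales
  show "M \<subseteq> H0" by (auto simp: M_iff)
  show "\<And>x g. x \<in> M \<Longrightarrow> coord x g \<noteq> 0 \<Longrightarrow> g \<in> P"
    using I_subset_P g(1) positive_cone_zero[OF cone] by (auto simp: M_iff)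
qed (use cone S generates nontrivial M sh_M u_M M_cyclic g_ne in \<open>auto simp: coord_simps u_def[of]\<close>)

text \<open>Test with \<open>V_a u\<close>, where \<open>g = b - a\<close>. The range projection of
  \<open>T a\<close> fixes it, and that of \<open>T b\<close> sends it to half of
  \<open>V_b u\<close>, which vanishes at \<open>a\<close>. In the other order the projection of
  \<open>T a\<close> comes last and, through the gluing, creates the coordinate 1/4 at
  \<open>a\<close>.\<close>

lemma M_not_commute:
  defines "T \<equiv> shift_subspace.rep e M"
  shows "\<exists>a\<in>S. \<exists>b\<in>S. T a o\<^sub>L adj (T a) o\<^sub>L T b o\<^sub>L adj (T b) \<noteq> T b o\<^sub>L adj (T b) o\<^sub>L T a o\<^sub>L adj (T a)"
proof -
  interpret gap: shift_subspace e P S M u by (rule shift_subspace_M)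
  obtain b a where ab: "b \<in> S" "a \<in> S" "g = b - a" using generates by blast
  have a0: "a \<noteq> 0" using ab g by auto
  let ?x = "sh a u"
  have x: "?x \<in> M" by (rule sh_M[OF ab(2) u_M])
  have Q: "blinfun_apply (T c) (blinfun_apply (adj (T c)) y) = sh c (cproj M (sh (- c) y))"
    if "c \<in> S" "y \<in> M" for c y
    using that by (simp add: T_def gap.adj_rep_M gap.rep_M cproj_mem[OF M])
  have QM: "sh c (cproj M (sh (- c) y)) \<in> M" if "c \<in> S" for c y
    by (rule sh_M[OF that cproj_mem[OF M]])
  have Qax: "sh a (cproj M (sh (- a) ?x)) = ?x"
    using cproj_ident[OF M u_M] M_H0[OF u_M] by (simp add: sh_sh sh_0)
  have "- g \<notin> I" "- g \<noteq> 0" "- g \<noteq> g"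
    using I_subset_P P_antisym[OF g(1)] g_ne g(1) by auto
  moreover have "sh (- b) ?x = e (- g) + e 0"
  proof -
    have "sh (- b) ?x = sh (- g) u" by (simp add: sh_sh ab(3))
    then show ?thesis by (simp add: u_def sh_add sh_e)
  qed
  ultimately have "cproj M (sh (- b) ?x) = (1 / 2) *\<^sub>C u"
    by (simp add: cproj_add[OF M] cproj_M_e0 cproj_M_e_out)
  then have Qbx: "sh b (cproj M (sh (- b) ?x)) = (1 / 2) *\<^sub>C sh b u" by (simp add: sh_scaleC)
  have "sh (- a) ((1 / 2) *\<^sub>C sh b u) = (1 / 2) *\<^sub>C (e g + e (g + g))"
  proof -
    have "sh (- a) ((1 / 2) *\<^sub>C sh b u) = (1 / 2) *\<^sub>C sh g u"
      by (simp add: sh_scaleC sh_sh ab(3))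
    then show ?thesis by (simp add: u_def sh_add sh_e)
  qed
  then have "cproj M (sh (- a) ((1 / 2) *\<^sub>C sh b u)) = (1 / 2) *\<^sub>C ((1 / 2) *\<^sub>C u + e (g + g))"
    by (simp add: cproj_scaleC[OF M] cproj_add[OF M] cproj_M_eg cproj_ident[OF M e_M[OF gg_I]])
  then have "coord (sh a (cproj M (sh (- a) ((1 / 2) *\<^sub>C sh b u)))) a = 1 / 4"
    using g_ne g_shift_ne by (simp add: coord_sh coord_simps u_def)
  moreover have "coord ((1 / 2) *\<^sub>C sh b u) a = 0"
  proof -
    have "a - b = - g" using ab(3) by simp
    then show ?thesis using coord_neg[OF u_M, of "- g"] g g_ne by (simp add: coord_simps coord_sh)
  qed
  ultimately have ne: "sh a (cproj M (sh (- a) ((1 / 2) *\<^sub>C sh b u))) \<noteq> (1 / 2) *\<^sub>C sh b u" by auto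
  have "blinfun_apply (T a o\<^sub>L adj (T a) o\<^sub>L T b o\<^sub>L adj (T b)) ?x =
      sh a (cproj M (sh (- a) ((1 / 2) *\<^sub>C sh b u)))"
    using Q[OF ab(1) x] Q[OF ab(2) QM[OF ab(1), of ?x]] by (simp add: Qbx)
  moreover have "blinfun_apply (T b o\<^sub>L adj (T b) o\<^sub>L T a o\<^sub>L adj (T a)) ?x = (1 / 2) *\<^sub>C sh b u"
    using Q[OF ab(2) x] Q[OF ab(1) x] by (simp add: Qax Qbx)
  ultimately show ?thesis using ab ne by metis
qed

end

section \<open>The equivalences\<close>

lemma (in isorep) inverse_rep_imp_commute:
  assumes "inverse_rep S V" "a \<in> S" "b \<in> S"
  shows "V a o\<^sub>L adj (V a) o\<^sub>L V b o\<^sub>L adj (V b) = V b o\<^sub>L adj (V b) o\<^sub>L V a o\<^sub>L adj (V a)"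
proof -
  have mem: "V a o\<^sub>L adj (V a) \<in> rep_semigroup S V" if "a \<in> S" for a
    using that by (intro rep_semigroup.intros)
  have idem: "(V a o\<^sub>L adj (V a)) o\<^sub>L (V a o\<^sub>L adj (V a)) = V a o\<^sub>L adj (V a)" if "a \<in> S" for a
  proof -
    have "(V a o\<^sub>L adj (V a)) o\<^sub>L (V a o\<^sub>L adj (V a)) = V a o\<^sub>L (adj (V a) o\<^sub>L V a) o\<^sub>L adj (V a)"
      by (simp add: blinfun_compose_assoc)
    then show ?thesis using that by (simp add: adjV_V compose_V0 V_ops)
  qed
  have "(V a o\<^sub>L adj (V a)) o\<^sub>L (V b o\<^sub>L adj (V b)) = (V b o\<^sub>L adj (V b)) o\<^sub>L (V a o\<^sub>L adj (V a))"
    using assms(1) unfolding inverse_rep_def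
    by (rule inverse_semigroup_idempotents_commute[where m = "(o\<^sub>L)", OF _ mem[OF assms(2)] idem[OF assms(2)]
          mem[OF assms(3)] idem[OF assms(3)]])
  then show ?thesis by (simp add: blinfun_compose_assoc)
qed

lemma cstar_gen_closed:
  assumes "A \<in> cstar_gen K X"
  shows "adj A \<in> cstar_gen K X" "B \<in> cstar_gen K X \<Longrightarrow> A o\<^sub>L B \<in> cstar_gen K X"
  using assms unfolding cstar_gen_def by (auto simp: star_subalgebra_def)

text \<open>Commutation is an identity between words in generators and adjoints, so a canonical
  isomorphism transports it. This separates the regular representation from the glued one.\<close>

lemma canonically_isomorphic_commute:
  assumes "canonically_isomorphic S (K, V) (L, W)" and a: "a \<in> S" and b: "b \<in> S"
    and commute: "V a o\<^sub>L adj (V a) o\<^sub>L V b o\<^sub>L adj (V b) = V b o\<^sub>L adj (V b) o\<^sub>L V a o\<^sub>L adj (V a)"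
  shows "W a o\<^sub>L adj (W a) o\<^sub>L W b o\<^sub>L adj (W b) = W b o\<^sub>L adj (W b) o\<^sub>L W a o\<^sub>L adj (W a)"
proof -
  obtain \<phi> where iso: "star_isomorphism (cstar_gen K (V ` S)) (cstar_gen L (W ` S)) \<phi>"
    and \<phi>V: "\<And>a. a \<in> S \<Longrightarrow> \<phi> (V a) = W a"
    using assms(1) unfolding canonically_isomorphic_def by blast
  have mem: "V c \<in> cstar_gen K (V ` S)" if "c \<in> S" for c
    using that by (auto simp: cstar_gen_def)
  have "\<phi> (V c o\<^sub>L adj (V c) o\<^sub>L V d o\<^sub>L adj (V d)) = W c o\<^sub>L adj (W c) o\<^sub>L W d o\<^sub>L adj (W d)"
    if "c \<in> S" "d \<in> S" for c d
    using iso mem[OF that(1)] mem[OF that(2)] that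
    by (simp add: star_isomorphism_def cstar_gen_closed \<phi>V)
  then show ?thesis using commute a b by metis
qed

theorem theorem2p1:
  fixes Gp S :: "'g::ab_group_add set"
    and e :: "'g \<Rightarrow> 'h::chilbert_space"
  assumes "positive_cone Gp"
    and "subsemigroup S" and "S \<subseteq> Gp" and "0 \<in> S" and "no_nontrivial_subgroup S"
    and generates: "\<forall>g. \<exists>a\<in>S. \<exists>b\<in>S. g = a - b"
    and ambient: "orthonormal_family e"
  defines "\<Delta> \<equiv> (Delta S :: ('h set \<times> ('g \<Rightarrow> 'h \<Rightarrow>\<^sub>L 'h)) set)"
  defines "P1 \<equiv> S = Gp"
    and "P2 \<equiv> \<forall>\<V>\<in>\<Delta>. \<forall>\<W>\<in>\<Delta>. canonically_isomorphic S \<V> \<W>"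
    and "P3 \<equiv> \<forall>(K, V)\<in>\<Delta>. inverse_rep S V"
    and "P4 \<equiv> \<forall>(K, V)\<in>\<Delta>. \<forall>a\<in>S. \<forall>b\<in>S.
           V a o\<^sub>L adj (V a) o\<^sub>L V b o\<^sub>L adj (V b) = V b o\<^sub>L adj (V b) o\<^sub>L V a o\<^sub>L adj (V a)"
  shows "(P1 \<longleftrightarrow> P2) \<and> (P1 \<longleftrightarrow> P3) \<and> (P1 \<longleftrightarrow> P4)"
proof -
  have isorep: "isorep S K V" if "(K, V) \<in> \<Delta>" for K and V :: "'g \<Rightarrow> 'h \<Rightarrow>\<^sub>L 'h"
    using that assms(2,4) by (simp add: isorep_def \<Delta>_def Delta_def)
  have pos: "P2 \<and> P3 \<and> P4" if "P1"
  proof -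
    have S: "S = Gp" using that by (simp add: P1_def)
    have conerep: "conerep S K V" if "(K, V) \<in> \<Delta>" for K and V :: "'g \<Rightarrow> 'h \<Rightarrow>\<^sub>L 'h"
      using isorep[OF that] assms(1) S by (simp add: conerep_def conerep_axioms_def)
    have P2
      unfolding P2_def
    proof (intro ballI)
      fix \<V> \<W> assume VW: "\<V> \<in> \<Delta>" "\<W> \<in> \<Delta>"
      obtain K V L W where eq: "\<V> = (K, V)" "\<W> = (L, W)" by (cases \<V>, cases \<W>)
      interpret V: conerep S K V using conerep VW eq by simp
      interpret W: conerep S L W using conerep VW eq by simp
      have nu: "nonunitary_rep S K V" "nonunitary_rep S L W"
        using VW eq by (auto simp: \<Delta>_def Delta_def)
      \<comment> \<open>\<open>V 0\<close> is unitary, so a representation that is not unitary needs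
        a nonzero element of \<open>S\<close>.\<close>
      obtain u where "u \<in> S" "u \<noteq> 0"
        using nu(1) V.unitary_V0 unfolding nonunitary_rep_def by metis
      then have "conerep_pair S K V L W u"
        using nu by unfold_locales (auto simp: nonunitary_rep_def)
      then show "canonically_isomorphic S \<V> \<W>"
        unfolding eq by (rule conerep_pair.canonically_isomorphic)
    qed
    moreover have P3
      unfolding P3_def
      using conerep.inverse_rep[OF conerep] by (auto simp: \<Delta>_def Delta_def faithful_rep_def)
    moreover have P4
      unfolding P4_def using isorep.inverse_rep_imp_commute[OF isorep] \<open>P3\<close>
      unfolding P3_def by blast
    ultimately show ?thesis by blast
  qed
  have neg: "\<not> P2 \<and> \<not> P3 \<and> \<not> P4" if notP1: "\<not> P1"
  proof -
    obtain g where g: "g \<in> Gp" "g \<notin> S" using notP1 assms(3) unfolding P1_def by blast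
    interpret gap e Gp S g
      by unfold_locales (use assms generates ambient g notP1 in \<open>auto simp: P1_def\<close>)
    interpret reg: shift_subspace e Gp S reg "e 0" by (rule shift_subspace_reg)
    interpret gap: shift_subspace e Gp S M u by (rule shift_subspace_M)
    have reg_\<Delta>: "(reg, reg.rep) \<in> \<Delta>" and gap_\<Delta>: "(M, gap.rep) \<in> \<Delta>"
      using reg.rep_in_Delta gap.rep_in_Delta by (simp_all add: \<Delta>_def)
    obtain a b where ab: "a \<in> S" "b \<in> S"
      "gap.rep a o\<^sub>L adj (gap.rep a) o\<^sub>L gap.rep b o\<^sub>L adj (gap.rep b) \<noteq>
        gap.rep b o\<^sub>L adj (gap.rep b) o\<^sub>L gap.rep a o\<^sub>L adj (gap.rep a)"
      using M_not_commute by blast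
    have "\<not> P4" using gap_\<Delta> ab unfolding P4_def by blast
    moreover have "\<not> P3"
      using gap_\<Delta> isorep.inverse_rep_imp_commute[OF isorep[OF gap_\<Delta>] _ ab(1,2)] ab(3)
      unfolding P3_def by blast
    \<comment> \<open>One pair suffices: range projections commute on \<open>reg\<close> but not on
      \<open>M\<close>.\<close>
    moreover have "\<not> P2"
      using reg_\<Delta> gap_\<Delta> canonically_isomorphic_commute[OF _ ab(1,2) reg_commute[OF ab(1,2)]] ab(3)
      unfolding P2_def by blast
    ultimately show ?thesis by blast
  qed
  from pos neg show ?thesis by blast
qed

end
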